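(* For every bond dimension $D$, let $\mathcal{C}_D$ and $\mathcal{C}_D^{\mathrm{coarse}}$ denote the sets of families of matrix product states $\mathcal{V}(A)$ of bond dimension $D$ which have a continuum limit and a coarse continuum limit, respectively. Then, for every bond dimension $D$: 1. $\mathcal{C}_D$ is strictly included in $\mathcal{C}_D^{\mathrm{coarse}}$; and 2. there are states (that is, families $\mathcal{V}(A)$ of bond dimension $D$) that are not in $\mathcal{C}_D^{\mathrm{coarse}}$.
   Context: $\mathcal{M}_D$ is the set of complex $D\times D$ matrices; $\mathbb{N}=\{1,2,\dots\}$. A tensor $A=\{A^i\in\mathcal{M}_D\}_{i=1}^d$ (with finite bond dimension $D$ and finite physical dimension $d$) generates, for every $N\in\mathbb{N}$, the translationally invariant matrix product state $|V_N(A)\rangle=\sum_{i_1,\dots,i_N=1}^d\mathrm{Tr}(A^{i_1}\cdots A^{i_N})|i_1,\dots,i_N\rangle$, and the family $\mathcal{V}(A)=\{|V_N(A)\rangle\}_{N\in\mathbb{N}}$. Transfer matrix: $E_A=\sum_i A^i\otimes\bar A^i$ (bar = complex conjugation), identified with the completely positive map $\mathcal{E}(X)=\sum_i A^iXA^{i\dagger}$ on $\mathcal{M}_D$. A quantum channel is a trace-preserving completely positive map. Powers denote composition. Without loss of generality, tensors are taken in irreducible form, i.e. $A^i=\bigoplus_j\mu_jA^i_j$ with $\mu_j>0$ and each $E_{A_j}$ an irreducible completely positive map (i.e. with a non-degenerate eigenvalue 1, but possibly with other eigenvalues of modulus 1), and their transfer matrices are taken to be quantum channels. Refinement: for an integer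 $n$, $\mathcal{V}(A)$ is an $n$-refinement of $\mathcal{V}(B)$ if there is an isometry $W$ from the physical space of one site of $B$ into the space of $n$ sites of $A$ with $|V_{nN}(A)\rangle=W^{\otimes N}|V_N(B)\rangle$ for all $N\in\mathbb{N}$; at the level of transfer matrices this corresponds to $E_B=E_A^n$. Continuum limit: $\mathcal{V}(B)$ has a continuum limit if there is an integer $p>1$ such that the procedure of $p$-refining $\ell$ times followed by the blocking of $n_\ell\in\mathbb{N}$ of the resulting spins converges in $\ell$, as long as $n_\ell/p^\ell\to0$ as $\ell\to\infty$. In terms of transfer matrices, this means: there exist an integer $p>1$, quantum channels $\{E_{p^\ell}\}_{\ell\in\mathbb{N}}$ with $E_{p^\ell}^{p^\ell}=E_B$ for all $\ell$, and a matrix $Q$, such that for all sequences $(n_k,\ell_k)_{k\ge1}$ in $\mathbb{N}\times\mathbb{N}$ with $\lim_{k\to\infty}n_k/p^{\ell_k}=0$ one has $\lim_{k\to\infty}E_{p^{\ell_k}}^{\,n_k}=Q$. Coarse continuum limit: $\mathcal{V}(A)$ has a coarse continuum limit if there are a $\mathcal{V}(B)$ and an $n\in\mathbb{N}$ such that $\mathcal{V}(A)$ is the $n$-refinement of $\mathcal{V}(B)$ and $\mathcal{V}(B)$ has a continuum limit.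
   Formalization: The claim is stated for bond dimension D ≥ 2 only: for D = 1 every transfer matrix that is a quantum channel is the identity, so every family has a continuum limit and both parts are false. *)

theory Defs
  imports Complex_Main "Jordan_Normal_Form.Schur_Decomposition"
begin

section \<open>Linear maps on \<open>D \<times> D\<close> matrices\<close>

text \<open>
  Linear maps on the space of complex \<open>D \<times> D\<close> matrices are HOL functions of which only the
  behaviour on \<^term>\<open>carrier_mat D D\<close> matters; identities between them are always stated on that
  carrier.
\<close>

definition linear_map :: "nat \<Rightarrow> (complex mat \<Rightarrow> complex mat) \<Rightarrow> bool" where
  "linear_map D T \<longleftrightarrow>
     (\<forall>X \<in> carrier_mat D D. T X \<in> carrier_mat D D) \<and>
     (\<forall>X \<in> carrier_mat D D. \<forall>Y \<in> carrier_mat D D. T (X + Y) = T X + T Y) \<and>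
     (\<forall>c. \<forall>X \<in> carrier_mat D D. T (c \<cdot>\<^sub>m X) = c \<cdot>\<^sub>m T X)"

definition mat_trace :: "complex mat \<Rightarrow> complex" where
  "mat_trace X = (\<Sum>i < dim_row X. X $$ (i, i))"

text \<open>
  The order on \<^typ>\<open>complex\<close> makes \<open>0 \<le> z\<close> mean that \<open>z\<close> is real and nonnegative; over the complex
  numbers this already forces the matrix to be Hermitian. The inner product \<open>\<bullet>c\<close> conjugates its
  second argument.
\<close>

definition pos_semidef :: "nat \<Rightarrow> complex mat \<Rightarrow> bool" where
  "pos_semidef m X \<longleftrightarrow> X \<in> carrier_mat m m \<and> (\<forall>v \<in> carrier_vec m. 0 \<le> (X *\<^sub>v v) \<bullet>c v)"

text \<open>
  \<open>ampliation D k T\<close> is \<open>id \<otimes> T\<close> on \<open>k \<times> k\<close> block matrices with blocks of size \<open>D \<times> D\<close>.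
\<close>

definition block_of :: "nat \<Rightarrow> complex mat \<Rightarrow> nat \<Rightarrow> nat \<Rightarrow> complex mat" where
  "block_of D X a b = mat D D (\<lambda>(i, j). X $$ (a * D + i, b * D + j))"

definition ampliation ::
    "nat \<Rightarrow> nat \<Rightarrow> (complex mat \<Rightarrow> complex mat) \<Rightarrow> complex mat \<Rightarrow> complex mat" where
  "ampliation D k T X =
     mat (k * D) (k * D) (\<lambda>(i, j). T (block_of D X (i div D) (j div D)) $$ (i mod D, j mod D))"

definition completely_positive :: "nat \<Rightarrow> (complex mat \<Rightarrow> complex mat) \<Rightarrow> bool" where
  "completely_positive D T \<longleftrightarrow> linear_map D T \<and>
     (\<forall>k X. pos_semidef (k * D) X \<longrightarrow> pos_semidef (k * D) (ampliation D k T X))"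

definition trace_preserving :: "nat \<Rightarrow> (complex mat \<Rightarrow> complex mat) \<Rightarrow> bool" where
  "trace_preserving D T \<longleftrightarrow> (\<forall>X \<in> carrier_mat D D. mat_trace (T X) = mat_trace X)"

definition quantum_channel :: "nat \<Rightarrow> (complex mat \<Rightarrow> complex mat) \<Rightarrow> bool" where
  "quantum_channel D T \<longleftrightarrow> completely_positive D T \<and> trace_preserving D T"

definition orth_projection :: "nat \<Rightarrow> complex mat \<Rightarrow> bool" where
  "orth_projection D P \<longleftrightarrow> P \<in> carrier_mat D D \<and> P * P = P \<and> mat_adjoint P = P"

text \<open>
  Irreducibility: no nontrivial orthogonal projection \<open>P\<close> for which \<open>T\<close> leaves the corner
  \<open>P M\<^sub>D P\<close> invariant.
\<close>

definition irreducible_cp :: "nat \<Rightarrow> (complex mat \<Rightarrow> complex mat) \<Rightarrow> bool" where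
  "irreducible_cp D T \<longleftrightarrow> completely_positive D T \<and>
     (\<forall>P. orth_projection D P \<and>
          (\<forall>X \<in> carrier_mat D D. T (P * X * P) = P * T (P * X * P) * P) \<longrightarrow>
          P = 0\<^sub>m D D \<or> P = 1\<^sub>m D)"

text \<open>
  The eigenvalue 1 is algebraically simple: already the kernel of \<open>(T - id)\<^sup>2\<close> is spanned by one
  eigenvector.
\<close>

definition nondegenerate_eigenvalue_one :: "nat \<Rightarrow> (complex mat \<Rightarrow> complex mat) \<Rightarrow> bool" where
  "nondegenerate_eigenvalue_one D T \<longleftrightarrow>
     (\<exists>X \<in> carrier_mat D D. X \<noteq> 0\<^sub>m D D \<and> T X = X \<and>
        (\<forall>Y \<in> carrier_mat D D. T (T Y - Y) = T Y - Y \<longrightarrow> (\<exists>c. Y = c \<cdot>\<^sub>m X)))"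

definition eigenvalues_in_unit_disc :: "nat \<Rightarrow> (complex mat \<Rightarrow> complex mat) \<Rightarrow> bool" where
  "eigenvalues_in_unit_disc D T \<longleftrightarrow>
     (\<forall>z. \<forall>X \<in> carrier_mat D D. X \<noteq> 0\<^sub>m D D \<and> T X = z \<cdot>\<^sub>m X \<longrightarrow> cmod z \<le> 1)"


section \<open>Tensors and matrix product states\<close>

text \<open>
  A tensor with physical dimension \<open>d\<close> is the list of its \<open>d\<close> matrices, so physical indices run
  over \<open>{..<d}\<close>.
\<close>

type_synonym tensor = "complex mat list"

definition transfer :: "nat \<Rightarrow> tensor \<Rightarrow> complex mat \<Rightarrow> complex mat" where
  "transfer D A X = foldr (\<lambda>M S. M * X * mat_adjoint M + S) A (0\<^sub>m D D)"

text \<open>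
  \<open>A\<^sup>i = \<Oplus>\<^sub>j \<mu>\<^sub>j A\<^sub>j\<^sup>i\<close>, where every block is irreducible and normalised to spectral radius 1. A block is
  given as \<open>(\<mu>\<^sub>j, m\<^sub>j, A\<^sub>j)\<close> with \<open>m\<^sub>j\<close> its bond dimension.
\<close>

definition irreducible_form :: "tensor \<Rightarrow> bool" where
  "irreducible_form A \<longleftrightarrow>
     (\<exists>bs :: (real \<times> nat \<times> tensor) list.
        (\<forall>(\<mu>, m, B) \<in> set bs. \<mu> > 0 \<and> m \<ge> 1 \<and> length B = length A \<and>
            set B \<subseteq> carrier_mat m m \<and>
            irreducible_cp m (transfer m B) \<and>
            nondegenerate_eigenvalue_one m (transfer m B) \<and>
            eigenvalues_in_unit_disc m (transfer m B)) \<and>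
        (\<forall>i < length A.
            A ! i = diag_block_mat (map (\<lambda>(\<mu>, m, B). complex_of_real \<mu> \<cdot>\<^sub>m (B ! i)) bs)))"

definition tensors :: "nat \<Rightarrow> tensor set" where
  "tensors D = {A. D \<ge> 1 \<and> set A \<subseteq> carrier_mat D D \<and> irreducible_form A \<and>
                   quantum_channel D (transfer D A)}"

definition spin_words :: "nat \<Rightarrow> nat \<Rightarrow> nat list set" where
  "spin_words d N = {w. length w = N \<and> set w \<subseteq> {..<d}}"

text \<open>
  A family consists of its physical dimension and, for each number \<open>N \<ge> 1\<close> of spins, the amplitudes
  of the state in the product basis. Values at \<open>N = 0\<close> and at lists that are not words of length
  \<open>N\<close> carry no information and are set to 0, so that equality of families is HOL equality.
\<close>

type_synonym mps_family = "nat \<times> (nat \<Rightarrow> nat list \<Rightarrow> complex)"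

definition mps :: "nat \<Rightarrow> tensor \<Rightarrow> mps_family" where
  "mps D A = (length A,
     \<lambda>N w. if N \<ge> 1 \<and> w \<in> spin_words (length A) N
           then mat_trace (foldr (\<lambda>i M. (A ! i) * M) w (1\<^sub>m D)) else 0)"

definition mps_families :: "nat \<Rightarrow> mps_family set" where
  "mps_families D = mps D ` tensors D"


section \<open>Refinements and continuum limits\<close>

text \<open>
  \<open>W I j\<close> is the matrix element of \<open>W\<close> between the basis state \<open>I\<close> of \<open>n\<close> spins of dimension \<open>d\<close>
  and the basis state \<open>j\<close> of one spin of dimension \<open>d'\<close>.
\<close>

definition is_isometry :: "nat \<Rightarrow> nat \<Rightarrow> nat \<Rightarrow> (nat list \<Rightarrow> nat \<Rightarrow> complex) \<Rightarrow> bool" where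
  "is_isometry n d d' W \<longleftrightarrow>
     (\<forall>j < d'. \<forall>j' < d'. (\<Sum>I \<in> spin_words d n. cnj (W I j) * W I j') = (if j = j' then 1 else 0))"

text \<open>
  \<open>tensor_power_apply n N W d' v\<close> is \<open>W\<^sup>\<otimes>\<^sup>N v\<close>: its amplitude at a word \<open>w\<close> of length \<open>n * N\<close>, the
  \<open>k\<close>-th length-\<open>n\<close> segment of \<open>w\<close> being paired with the \<open>k\<close>-th letter of \<open>u\<close>.
\<close>

definition tensor_power_apply ::
    "nat \<Rightarrow> nat \<Rightarrow> (nat list \<Rightarrow> nat \<Rightarrow> complex) \<Rightarrow> nat \<Rightarrow> (nat list \<Rightarrow> complex) \<Rightarrow> nat list \<Rightarrow> complex"
  where
  "tensor_power_apply n N W d' v w =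
     (\<Sum>u \<in> spin_words d' N. (\<Prod>k < N. W (take n (drop (k * n) w)) (u ! k)) * v u)"

definition is_refinement :: "nat \<Rightarrow> mps_family \<Rightarrow> mps_family \<Rightarrow> bool" where
  "is_refinement n F G \<longleftrightarrow>
     (\<exists>W. is_isometry n (fst F) (fst G) W \<and>
        (\<forall>N \<ge> 1. \<forall>w \<in> spin_words (fst F) (n * N).
            snd F (n * N) w = tensor_power_apply n N W (fst G) (snd G N) w))"

text \<open>
  \<open>R l\<close> is the channel written \<open>E\<close> with index \<open>p\<^sup>l\<close> in the physics notation. Convergence of matrices
  is convergence of all entries of the images of all \<open>D \<times> D\<close> matrices.
\<close>

definition channel_continuum_limit :: "nat \<Rightarrow> (complex mat \<Rightarrow> complex mat) \<Rightarrow> bool" where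
  "channel_continuum_limit D E \<longleftrightarrow>
     (\<exists>p :: nat. p > 1 \<and> (\<exists>(R :: nat \<Rightarrow> complex mat \<Rightarrow> complex mat) Q.
        (\<forall>l \<ge> 1. quantum_channel D (R l) \<and> (\<forall>X \<in> carrier_mat D D. (R l ^^ (p ^ l)) X = E X)) \<and>
        linear_map D Q \<and>
        (\<forall>n l :: nat \<Rightarrow> nat.
           (\<forall>k. n k \<ge> 1 \<and> l k \<ge> 1) \<and> (\<lambda>k. real (n k) / real p ^ l k) \<longlonglongrightarrow> 0 \<longrightarrow>
           (\<forall>X \<in> carrier_mat D D. \<forall>i < D. \<forall>j < D.
              (\<lambda>k. (R (l k) ^^ n k) X $$ (i, j)) \<longlonglongrightarrow> Q X $$ (i, j)))))"

definition continuum_families :: "nat \<Rightarrow> mps_family set" where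
  "continuum_families D = mps D ` {B \<in> tensors D. channel_continuum_limit D (transfer D B)}"

text \<open>The bond dimension \<open>D'\<close> of the coarser family is not constrained.\<close>

definition coarse_continuum_families :: "nat \<Rightarrow> mps_family set" where
  "coarse_continuum_families D =
     {F \<in> mps_families D. \<exists>n \<ge> 1. \<exists>D'. \<exists>G \<in> continuum_families D'. is_refinement n F G}"

text \<open>
  In bond dimension 1 every transfer matrix in question is the identity, so every family has a
  continuum limit and no family separates the two classes.
\<close>

lemma continuum_families_one: "continuum_families 1 = mps_families 1"
proof -
  have "channel_continuum_limit 1 (transfer 1 A)" if A: "A \<in> tensors 1" for A
  proof -
    let ?T = "transfer 1 A"
    have qc: "quantum_channel 1 ?T"
      using A by (simp add: tensors_def)
    then have lin: "linear_map 1 ?T" and tp: "trace_preserving 1 ?T"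
      by (simp_all add: quantum_channel_def completely_positive_def)
    have id: "?T X = X" if X: "X \<in> carrier_mat 1 1" for X
    proof -
      have TX: "?T X \<in> carrier_mat 1 1"
        using lin X by (simp add: linear_map_def)
      have "mat_trace (?T X) = mat_trace X"
        using tp X by (simp add: trace_preserving_def)
      then have "?T X $$ (0, 0) = X $$ (0, 0)"
        using TX X by (simp add: mat_trace_def)
      then show ?thesis
        using TX X by (intro eq_matI) auto
    qed
    have pow: "(?T ^^ m) X = X" if "X \<in> carrier_mat 1 1" for m X
      using that by (induction m) (simp_all add: id[unfolded One_nat_def])
    show ?thesis
      unfolding channel_continuum_limit_def
      by (rule exI[of _ 2], simp, rule exI[of _ "\<lambda>_. ?T"])
         (use qc lin in \<open>auto simp: pow[unfolded One_nat_def] id[unfolded One_nat_def] intro!: exI[of _ ?T]\<close>)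
  qed
  then show ?thesis
    by (auto simp: continuum_families_def mps_families_def)
qed

end

theory Submission
  imports Defs
begin

text \<open>
  Both examples come from channels \<open>E\<^sub>c(X) = tr(X)/D \<cdot> 1 + c \<cdot> tr(F X) \<cdot> G\<close> with \<open>tr F = tr G = 0\<close>
  and \<open>tr(F G) = 1\<close>. They satisfy \<open>E\<^sub>c E\<^sub>d = E\<^bsub>c d\<^esub>\<close> and have the nonzero eigenvalues 1 and \<open>c\<close>.

  Let \<open>E\<^sub>B\<close> have a continuum limit and nonzero spectrum \<open>{1, c}\<close>. Every root \<open>R\<close> of high order then has
  exactly two nonzero eigenvalues, both tending to 1, which forces the limit to be the spectral
  projection \<open>Q = ((1 + c) E\<^sub>B - E\<^sub>B\<^sup>2) / c\<close>. Since the traces of \<open>R\<close> and \<open>R\<^sup>2\<close> are real, \<open>c > 0\<close>; and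
  \<open>Q\<close> is completely positive.

  Both consequences pass through a refinement in any bond dimension. The spectrum is read off from
  the norms of the states, and for \<open>X\<close> a combination of words in \<open>B\<close> the inequality
  \<open>\<langle>X|Q|X\<rangle> \<ge> 0\<close> compares \<open>\<Sum>\<^sub>i |tr(X B\<^sup>i)|\<^sup>2\<close> with \<open>\<Sum>\<^sub>i\<^sub>j |tr(X B\<^sup>i B\<^sup>j)|\<^sup>2\<close>, which are norms of partial
  contractions of the states and so are preserved by the isometry. Hence \<open>E\<^sub>c\<close> with \<open>c < 0\<close> and
  \<open>E\<^sub>1\<close> completely positive separates the two classes, while \<open>E\<^sub>c\<close> with \<open>c > 0\<close> and \<open>E\<^sub>1\<close> not completely
  positive has no coarse continuum limit.
\<close>

text \<open>The coarser family may have any bond dimension, and a family does not single out its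
  tensor, so a transfer matrix as such is no invariant: every obstruction must be a number computed
  from the states. Two kinds of numbers suffice. The trace of the k-th power of the transfer map is
  the squared norm of the k-site state, and \<open>choi_form\<close> at a combination of words is
  the squared norm of a state with some sites contracted.

  A root equation alone leaves the phases of the eigenvalues of R open, because of roots of unity.
  They are pinned to 1 by the requirement that every fixed number of blocked spins gives the same
  limit. Zero eigenvalues of R may carry Jordan blocks; their contribution dies after boundedly many
  powers, so comparisons are made only at exponents at least the size of the matrix.

  Complete positivity of Q is tested only at those X that words reach. The second example therefore
  needs words of every positive length to span all matrices, which D * D Kraus operators with
  strictly positive weights provide.\<close>

section \<open>Spectra of roots of a matrix\<close>

text \<open>By linearity the two lists agree on sums of \<open>x * poly p x\<close> for every
  polynomial p. A p vanishing at all entries other than z isolates the multiplicity of z, weighted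
  by \<open>z * poly p z\<close>; this weight is why 0 stays invisible.\<close>

lemma power_sums_count_list_eq:
  fixes xs ys :: "complex list"
  assumes eq: "\<And>k. k \<ge> 1 \<Longrightarrow> (\<Sum>x\<leftarrow>xs. x ^ k) = (\<Sum>y\<leftarrow>ys. y ^ k)" and z: "z \<noteq> 0"
  shows "count_list xs z = count_list ys z"
proof -
  have poly_eq: "(\<Sum>x\<leftarrow>xs. x ^ k * poly p x) = (\<Sum>y\<leftarrow>ys. y ^ k * poly p y)" if "k \<ge> 1" for p k
    using that
  proof (induction p arbitrary: k)
    case 0
    then show ?case by simp
  next
    case (pCons a p)
    have "(\<Sum>x\<leftarrow>zs. x ^ k * poly (pCons a p) x) =
        a * (\<Sum>x\<leftarrow>zs. x ^ k) + (\<Sum>x\<leftarrow>zs. x ^ Suc k * poly p x)" for zs :: "complex list"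
      by (induction zs) (simp_all add: algebra_simps)
    then show ?case
      using eq[OF pCons.prems] pCons.IH[of "Suc k"] by simp
  qed
  define p where "p = (\<Prod>y\<in>set (xs @ ys) - {z}. [:- y, 1:])"
  have p_z: "poly p z \<noteq> 0"
    by (auto simp: p_def poly_prod)
  have p_other: "poly p x = 0" if "x \<in> set (xs @ ys)" "x \<noteq> z" for x
    using that by (auto simp: p_def poly_prod intro!: bexI[of _ x])
  have "(\<Sum>x\<leftarrow>zs. x ^ 1 * poly p x) = of_nat (count_list zs z) * (z * poly p z)"
    if "set zs \<subseteq> set (xs @ ys)" for zs
    using that by (induction zs) (use p_other in \<open>auto simp: algebra_simps\<close>)
  from this[of xs] this[of ys] poly_eq[of 1 p]
  have "of_nat (count_list xs z) * (z * poly p z) = of_nat (count_list ys z) * (z * poly p z)"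
    by simp
  then show ?thesis
    using z p_z by simp
qed

section \<open>Traces and powers of triangularised matrices\<close>

lemma mat_trace_mult_comm:
  assumes "A \<in> carrier_mat n m" "B \<in> carrier_mat m n"
  shows "mat_trace (A * B) = mat_trace (B * A)"
proof -
  have "mat_trace (A * B) = (\<Sum>i<n. \<Sum>j<m. A $$ (i, j) * B $$ (j, i))"
    using assms by (auto simp: mat_trace_def scalar_prod_def atLeast0LessThan intro!: sum.cong)
  also have "\<dots> = (\<Sum>j<m. \<Sum>i<n. B $$ (j, i) * A $$ (i, j))"
    by (subst sum.swap) (simp add: mult.commute)
  also have "\<dots> = mat_trace (B * A)"
    using assms by (auto simp: mat_trace_def scalar_prod_def atLeast0LessThan intro!: sum.cong)
  finally show ?thesis .
qed

lemma mat_trace_similar: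
  assumes A: "A \<in> carrier_mat n n" and wit: "similar_mat_wit A B P Q"
  shows "mat_trace A = mat_trace B"
proof -
  note w = similar_mat_witD2[OF A wit]
  have "mat_trace A = mat_trace (P * (B * Q))"
    using w by (metis assoc_mult_mat)
  also have "\<dots> = mat_trace ((B * Q) * P)"
    using w by (intro mat_trace_mult_comm[where n = n and m = n]) auto
  also have "\<dots> = mat_trace B"
    using w by (metis assoc_mult_mat right_mult_one_mat)
  finally show ?thesis .
qed

lemma upper_triangular_pow:
  fixes B :: "complex mat"
  assumes B: "B \<in> carrier_mat n n" and up: "upper_triangular B"
  shows "i < n \<Longrightarrow> j < i \<Longrightarrow> (B ^\<^sub>m k) $$ (i, j) = 0"
    and "i < n \<Longrightarrow> (B ^\<^sub>m k) $$ (i, i) = (B $$ (i, i)) ^ k"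
proof -
  have "(\<forall>i<n. \<forall>j<i. (B ^\<^sub>m k) $$ (i, j) = 0) \<and> (\<forall>i<n. (B ^\<^sub>m k) $$ (i, i) = (B $$ (i, i)) ^ k)"
  proof (induction k)
    case 0
    then show ?case using B by auto
  next
    case (Suc k)
    have entry: "(B ^\<^sub>m Suc k) $$ (i, j) = (\<Sum>l<n. (B ^\<^sub>m k) $$ (i, l) * B $$ (l, j))"
      if "i < n" "j < n" for i j
      using B that by (auto simp: scalar_prod_def atLeast0LessThan intro!: sum.cong)
    have "(B ^\<^sub>m Suc k) $$ (i, j) = 0" if "i < n" "j < i" for i j
    proof -
      have "(B ^\<^sub>m k) $$ (i, l) * B $$ (l, j) = 0" if "l < n" for l
        using Suc.IH up B that \<open>i < n\<close> \<open>j < i\<close> unfolding upper_triangular_def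
        by (cases "l < i") auto
      then show ?thesis using that by (subst entry) (auto intro!: sum.neutral)
    qed
    moreover have "(B ^\<^sub>m Suc k) $$ (i, i) = (B $$ (i, i)) ^ Suc k" if "i < n" for i
    proof -
      have "(B ^\<^sub>m k) $$ (i, l) * B $$ (l, i) =
          (if l = i then (B $$ (i, i)) ^ Suc k else 0)" if "l < n" for l
        using Suc.IH up B that \<open>i < n\<close> unfolding upper_triangular_def
        by (cases l i rule: linorder_cases) (auto simp: mult.commute)
      then have "(B ^\<^sub>m Suc k) $$ (i, i) = (\<Sum>l<n. if l = i then (B $$ (i, i)) ^ Suc k else 0)"
        using that by (subst entry) (auto intro!: sum.cong)
      then show ?thesis using that by simp
    qed
    ultimately show ?case by blast
  qed
  then show "i < n \<Longrightarrow> j < i \<Longrightarrow> (B ^\<^sub>m k) $$ (i, j) = 0"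
    and "i < n \<Longrightarrow> (B ^\<^sub>m k) $$ (i, i) = (B $$ (i, i)) ^ k" by auto
qed

lemma mat_trace_pow_eigenvalues:
  assumes A: "(A :: complex mat) \<in> carrier_mat n n" and c: "char_poly A = (\<Prod>e\<leftarrow>es. [:- e, 1:])"
  shows "mat_trace (A ^\<^sub>m k) = (\<Sum>e\<leftarrow>es. e ^ k)"
proof -
  obtain B P Q where s: "schur_decomposition A es = (B, P, Q)"
    by (metis prod.collapse)
  from schur_decomposition[OF A c s]
  have wit: "similar_mat_wit A B P Q" and up: "upper_triangular B" and d: "diag_mat B = es" by auto
  note w = similar_mat_witD2[OF A wit]
  have "mat_trace (A ^\<^sub>m k) = mat_trace (B ^\<^sub>m k)"
    by (rule mat_trace_similar[OF _ similar_mat_wit_pow[OF wit]]) (use A in auto)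
  also have "\<dots> = (\<Sum>i<n. (B $$ (i, i)) ^ k)"
    using w upper_triangular_pow(2)[OF _ up] by (auto simp: mat_trace_def intro!: sum.cong)
  also have "\<dots> = (\<Sum>e\<leftarrow>es. e ^ k)"
    using w by (simp add: d[symmetric] diag_mat_def interv_sum_list_conv_sum_set_nat atLeast0LessThan)
  finally show ?thesis .
qed

lemma pow_mat_Suc_left:
  assumes "(B :: complex mat) \<in> carrier_mat n n"
  shows "B ^\<^sub>m Suc k = B * B ^\<^sub>m k"
proof (induction k)
  case 0
  then show ?case using assms by simp
next
  case (Suc k)
  have "B ^\<^sub>m Suc (Suc k) = (B * B ^\<^sub>m k) * B"
    using Suc by simp
  also have "\<dots> = B * B ^\<^sub>m Suc k"
    using assms by (simp add: assoc_mult_mat[of _ n n _ n _ n])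
  finally show ?case .
qed

lemma pow_mat_add:
  assumes "(B :: complex mat) \<in> carrier_mat n n"
  shows "B ^\<^sub>m (a + b) = B ^\<^sub>m a * B ^\<^sub>m b"
proof (induction b)
  case 0
  then show ?case using assms by simp
next
  case (Suc b)
  then show ?case
    using assms by (simp add: assoc_mult_mat[of _ n n _ n _ n])
qed

lemma pow_mat_pow:
  assumes "(B :: complex mat) \<in> carrier_mat n n"
  shows "(B ^\<^sub>m a) ^\<^sub>m b = B ^\<^sub>m (a * b)"
  using assms by (induction b) (simp_all add: pow_mat_add[of _ n, symmetric] add.commute)

lemma index_mult_mat_sum:
  assumes "A \<in> carrier_mat n m" "B \<in> carrier_mat m r" "i < n" "j < r"
  shows "(A * B) $$ (i, j) = (\<Sum>k<m. A $$ (i, k) * B $$ (k, j))"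
  using assms by (auto simp: scalar_prod_def atLeast0LessThan intro!: sum.cong)

text \<open>The q-th powers of the eigenvalues of S have the same power sums as the list
  \<open>[1, c]\<close>. Since q is positive, \<open>x ^ q\<close> vanishes only for x = 0, so
  exactly two eigenvalues are nonzero; they are named by which of 1 and c they are a root
  of.\<close>

lemma obtain_two_nonzero_eigenvalues:
  assumes S: "(S :: complex mat) \<in> carrier_mat N N" and q: "q \<ge> 1"
    and tr: "\<And>k. k \<ge> 1 \<Longrightarrow> mat_trace (S ^\<^sub>m (q * k)) = 1 + c ^ k" and c: "c \<noteq> 0"
  obtains s1 s2 m where "s1 ^ q = 1" "s2 ^ q = c" "N = m + 2"
    "char_poly S = (\<Prod>e\<leftarrow>s1 # s2 # replicate m 0. [:- e, 1:])"
proof -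
  from char_poly_factorized[OF S] obtain as where
    as: "char_poly S = (\<Prod>a\<leftarrow>as. [:- a, 1:])" and len: "length as = N" by blast
  define bs where "bs = filter (\<lambda>a. a \<noteq> 0) as"
  have sums: "(\<Sum>x\<leftarrow>map (\<lambda>a. a ^ q) as. x ^ k) = (\<Sum>x\<leftarrow>[1, c]. x ^ k)" if "k \<ge> 1" for k
    using mat_trace_pow_eigenvalues[OF S as, of "q * k"] tr[OF that]
    by (simp add: power_mult o_def)
  have cnt: "count_list (map (\<lambda>a. a ^ q) as) z = count_list [1, c] z" if "z \<noteq> 0" for z
    using power_sums_count_list_eq[OF sums that] by blast
  have map_bs: "map (\<lambda>a. a ^ q) bs = filter (\<lambda>x. x \<noteq> 0) (map (\<lambda>a. a ^ q) as)"
    using q unfolding bs_def by (induction as) auto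
  have count_filter: "count_list (filter (\<lambda>x. x \<noteq> 0) zs) z = (if z = 0 then 0 else count_list zs z)"
    for zs :: "complex list" and z by (induction zs) auto
  have ms: "mset (map (\<lambda>a. a ^ q) bs) = {#1, c#}"
  proof (rule multiset_eqI)
    fix z
    show "count (mset (map (\<lambda>a. a ^ q) bs)) z = count {#1, c#} z"
      unfolding map_bs count_mset count_filter using cnt[of z] c by auto
  qed
  then have "size (mset (map (\<lambda>a. a ^ q) bs)) = 2"
    by simp
  then have "length bs = 2"
    by simp
  then obtain b1 b2 where bs: "bs = [b1, b2]"
    by (metis One_nat_def Suc_1 length_0_conv length_Suc_conv)
  have "(b1 ^ q = 1 \<and> b2 ^ q = c) \<or> (b1 ^ q = c \<and> b2 ^ q = 1)"
  proof -
    have "b1 ^ q \<in># {#1, c#}"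
      unfolding ms[symmetric] bs by simp
    then consider "b1 ^ q = 1" | "b1 ^ q = c" by auto
    then show ?thesis
    proof cases
      case 1
      then show ?thesis using ms by (simp add: bs)
    next
      case 2
      then show ?thesis using ms by (simp add: bs add_mset_commute[of 1])
    qed
  qed
  then obtain s1 s2 where s: "s1 ^ q = 1" "s2 ^ q = c" "mset bs = mset [s1, s2]"
    using bs by (metis add_mset_commute mset.simps)
  define m where "m = length (filter (\<lambda>a. a = 0) as)"
  have zeros: "filter (\<lambda>a. a = 0) as = replicate m 0"
    unfolding m_def by (induction as) auto
  have "mset as = mset bs + mset (filter (\<lambda>a. a = 0) as)"
    unfolding bs_def by (induction as) auto
  then have perm: "mset as = mset (s1 # s2 # replicate m 0)"
    by (simp add: s(3) zeros)
  have "N = m + 2"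
    using arg_cong[OF perm, of size] len by simp
  moreover have "char_poly S = (\<Prod>e\<leftarrow>s1 # s2 # replicate m 0. [:- e, 1:])"
    unfolding as prod_mset_prod_list[symmetric] mset_map perm ..
  ultimately show ?thesis
    using that s by blast
qed

text \<open>This is (S - s1)(S - s2) S^n = 0 for n at least N, entry by entry. S need not be
  diagonalisable, but in a Schur form with diagonal s1, s2, 0, ..., 0 the rows from index 2 on are
  nilpotent and have died out by then; what remains is a triangular recurrence in the first two
  rows.\<close>

lemma pow_entries_recurrence:
  assumes S: "(S :: complex mat) \<in> carrier_mat N N" and N: "N = m + 2"
    and c: "char_poly S = (\<Prod>e\<leftarrow>s1 # s2 # replicate m 0. [:- e, 1:])"
    and ij: "i < N" "j < N" and n: "n \<ge> N"
  shows "(S ^\<^sub>m (n + 2)) $$ (i, j) =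
    (s1 + s2) * (S ^\<^sub>m (n + 1)) $$ (i, j) - s1 * s2 * (S ^\<^sub>m n) $$ (i, j)"
proof -
  obtain B P Q where s: "schur_decomposition S (s1 # s2 # replicate m 0) = (B, P, Q)"
    by (metis prod.collapse)
  from schur_decomposition[OF S c s]
  have wit: "similar_mat_wit S B P Q" and up: "upper_triangular B"
    and d: "diag_mat B = s1 # s2 # replicate m 0" by auto
  note w = similar_mat_witD2[OF S wit]
  have B: "B \<in> carrier_mat N N" and P: "P \<in> carrier_mat N N" and Q: "Q \<in> carrier_mat N N"
    using w by auto
  have diag: "B $$ (k, k) = (s1 # s2 # replicate m 0) ! k" if "k < N" for k
    using that B unfolding d[symmetric] by (simp add: diag_mat_def)
  have low: "B $$ (k, l) = 0" if "k < N" "l < k" for k l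
    using up B that by (auto simp: upper_triangular_def)
  have left: "(B ^\<^sub>m Suc r) $$ (k, l) = (\<Sum>t<N. B $$ (k, t) * (B ^\<^sub>m r) $$ (t, l))"
    if "k < N" "l < N" for k l r
    unfolding pow_mat_Suc_left[OF B] using B that by (intro index_mult_mat_sum) auto
  \<comment> \<open>Each factor B moves the support of such a row at least one place to the right,
    because the diagonal is zero there.\<close>
  have strict: "(B ^\<^sub>m r) $$ (k, l) = 0" if "k < N" "2 \<le> k" "l < N" "l < k + r" for k l r
    using that
  proof (induction r arbitrary: k l)
    case 0
    then show ?case using B by auto
  next
    case (Suc r)
    have "B $$ (k, t) * (B ^\<^sub>m r) $$ (t, l) = 0" if "t < N" for t
    proof (cases t k rule: linorder_cases)
      case less
      then show ?thesis using low Suc.prems by simp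
    next
      case equal
      then show ?thesis using diag[of k] Suc.prems N by (auto simp: nth_Cons split: nat.splits)
    next
      case greater
      then show ?thesis using Suc.IH[of t l] Suc.prems that by simp
    qed
    then show ?case using Suc.prems by (subst left) (auto intro!: sum.neutral)
  qed
  have split_sum: "(\<Sum>t<N. f t) = f 0 + f 1" if "\<And>t. 2 \<le> t \<Longrightarrow> t < N \<Longrightarrow> f t = 0"
    for f :: "nat \<Rightarrow> complex"
  proof -
    have "(\<Sum>t<N. f t) = (\<Sum>t<2. f t)"
      using N that by (intro sum.mono_neutral_right) auto
    then show ?thesis by (simp add: numeral_2_eq_2)
  qed
  have rec_B: "(B ^\<^sub>m (n + 2)) $$ (k, l) =
      (s1 + s2) * (B ^\<^sub>m (n + 1)) $$ (k, l) - s1 * s2 * (B ^\<^sub>m n) $$ (k, l)"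
    if kl: "k < N" "l < N" for k l
  proof -
    have tail: "(B ^\<^sub>m r) $$ (t, l) = 0" if "2 \<le> t" "t < N" "r \<ge> n" for t r
      using strict[of t l r] that kl n by simp
    have row1: "(B ^\<^sub>m Suc r) $$ (1, l) = s2 * (B ^\<^sub>m r) $$ (1, l)" if "r \<ge> n" for r
      using that kl N tail low[of 1 0] diag[of 1] by (subst left, simp, simp, subst split_sum) auto
    have row0: "(B ^\<^sub>m Suc r) $$ (0, l) = s1 * (B ^\<^sub>m r) $$ (0, l) + B $$ (0, 1) * (B ^\<^sub>m r) $$ (1, l)"
      if "r \<ge> n" for r
      using that kl N tail diag[of 0] by (subst left, simp, simp, subst split_sum) auto
    consider "k = 0" | "k = 1" | "k \<ge> 2" by linarith
    then show ?thesis
    proof cases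
      case 1
      show ?thesis
        using row0[of n] row0[of "Suc n"] row1[of n] 1 by (simp add: algebra_simps del: pow_mat.simps)
    next
      case 2
      show ?thesis
        using row1[of n] row1[of "Suc n"] 2 by (simp add: algebra_simps del: pow_mat.simps)
    next
      case 3
      then show ?thesis using tail[of k] kl by (simp del: pow_mat.simps)
    qed
  qed
  have S_pow: "(S ^\<^sub>m r) $$ (i, j) = (\<Sum>l<N. \<Sum>k<N. P $$ (i, k) * (B ^\<^sub>m r) $$ (k, l) * Q $$ (l, j))" for r
  proof -
    have "(S ^\<^sub>m r) $$ (i, j) = (\<Sum>l<N. (P * B ^\<^sub>m r) $$ (i, l) * Q $$ (l, j))"
      unfolding similar_mat_wit_pow_id[OF wit]
      by (rule index_mult_mat_sum) (use B P Q ij in auto)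
    also have "\<dots> = (\<Sum>l<N. (\<Sum>k<N. P $$ (i, k) * (B ^\<^sub>m r) $$ (k, l)) * Q $$ (l, j))"
      by (intro sum.cong refl arg_cong2[where f = "(*)"] index_mult_mat_sum) (use B P Q ij in auto)
    finally show ?thesis by (simp add: sum_distrib_right)
  qed
  show ?thesis
  proof -
    let ?b = "\<lambda>r k l. (B ^\<^sub>m r) $$ (k, l)"
    have "(S ^\<^sub>m (n + 2)) $$ (i, j) = (\<Sum>l<N. \<Sum>k<N. P $$ (i, k) *
        ((s1 + s2) * ?b (n + 1) k l - s1 * s2 * ?b n k l) * Q $$ (l, j))"
      unfolding S_pow by (intro sum.cong refl) (subst rec_B, auto)
    also have "\<dots> = (\<Sum>l<N. \<Sum>k<N. (s1 + s2) * (P $$ (i, k) * ?b (n + 1) k l * Q $$ (l, j)) -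
        s1 * s2 * (P $$ (i, k) * ?b n k l * Q $$ (l, j)))"
      by (intro sum.cong refl) (simp add: algebra_simps del: pow_mat.simps)
    finally show ?thesis
      by (simp add: S_pow sum_subtractf sum_distrib_left del: pow_mat.simps)
  qed
qed

lemma linear_recurrence_solution:
  fixes x :: "nat \<Rightarrow> complex"
  assumes rec: "\<And>n. n \<ge> N \<Longrightarrow> x (n + 2) = (s1 + s2) * x (n + 1) - s1 * s2 * x n"
    and s: "s1 \<noteq> s2" "s1 \<noteq> 0" "s2 \<noteq> 0"
  obtains u v where "\<And>n. n \<ge> N \<Longrightarrow> x n = s1 ^ n * u + s2 ^ n * v"
proof -
  \<comment> \<open>Cramer's rule for the values at N and N + 1, where the recurrence starts.
    Dividing by the N-th powers lets the solution be written with exponent n instead of n -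
    N.\<close>
  define u where "u = (x (N + 1) - s2 * x N) / (s1 ^ N * (s1 - s2))"
  define v where "v = (s1 * x N - x (N + 1)) / (s2 ^ N * (s1 - s2))"
  have u: "s1 ^ N * u = (x (N + 1) - s2 * x N) / (s1 - s2)"
    and v: "s2 ^ N * v = (s1 * x N - x (N + 1)) / (s1 - s2)"
    using s by (simp_all add: u_def v_def)
  have base0: "x N = s1 ^ N * u + s2 ^ N * v"
    unfolding u v add_divide_distrib[symmetric] using s by (simp add: eq_divide_eq algebra_simps)
  have "s1 ^ (N + 1) * u + s2 ^ (N + 1) * v = s1 * (s1 ^ N * u) + s2 * (s2 ^ N * v)"
    by simp
  also have "\<dots> = x (N + 1)"
    unfolding u v times_divide_eq_right add_divide_distrib[symmetric] using s
    by (simp add: divide_eq_eq algebra_simps)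
  finally have base1: "x (N + 1) = s1 ^ (N + 1) * u + s2 ^ (N + 1) * v" ..
  have "x n = s1 ^ n * u + s2 ^ n * v \<and> x (n + 1) = s1 ^ (n + 1) * u + s2 ^ (n + 1) * v" if "n \<ge> N" for n
    using that
  proof (induction n rule: dec_induct)
    case base
    show ?case using base0 base1 by simp
  next
    case (step n)
    then show ?case using rec[of n] by (simp add: algebra_simps)
  qed
  then show ?thesis using that by blast
qed

text \<open>The modulus of \<open>s l\<close> is a root of growing order of the modulus of c and
  tends to 1 by itself. For the phase, the limit a of \<open>s l ^ n * u\<close> is the same for all
  n and has the modulus of u, so it is nonzero; the quotient of the sequences for N + 1 and N is
  \<open>s l\<close> and tends to a / a.\<close>

lemma root_of_constant_tendsto_one:
  fixes s :: "nat \<Rightarrow> complex"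
  assumes root: "\<forall>\<^sub>F l in sequentially. s l ^ q l = c" and c: "c \<noteq> 0"
    and q: "filterlim q at_top sequentially"
    and lim: "\<And>n. n \<ge> N \<Longrightarrow> (\<lambda>l. s l ^ n * u) \<longlonglongrightarrow> a" and u: "u \<noteq> 0"
  shows "s \<longlonglongrightarrow> 1"
proof -
  have q1: "\<forall>\<^sub>F l in sequentially. q l \<ge> 1"
    using q by (simp add: filterlim_at_top)
  have s_nz: "\<forall>\<^sub>F l in sequentially. s l \<noteq> 0"
    using root q1 by eventually_elim (use c in \<open>auto simp: power_0_left\<close>)
  have norm_eq: "\<forall>\<^sub>F l in sequentially. norm (s l) = norm c powr (1 / real (q l))"
    using root q1 s_nz
  proof eventually_elim
    case (elim l)
    have "norm c = norm (s l) ^ q l"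
      using elim by (metis norm_power)
    also have "\<dots> = norm (s l) powr real (q l)"
      using elim by (simp add: powr_realpow)
    finally show ?case
      using elim by (simp add: powr_powr)
  qed
  have "(\<lambda>l. 1 / real (q l)) \<longlonglongrightarrow> 0"
    by (intro tendsto_divide_0[OF tendsto_const] filterlim_at_top_imp_at_infinity
        filterlim_compose[OF filterlim_real_sequentially q])
  then have "(\<lambda>l. norm c powr (1 / real (q l))) \<longlonglongrightarrow> norm c powr 0"
    using c by (intro tendsto_intros) auto
  then have norm_lim: "(\<lambda>l. norm (s l)) \<longlonglongrightarrow> 1"
    using c by (subst tendsto_cong[OF norm_eq]) simp
  have "(\<lambda>l. norm (s l ^ N * u)) \<longlonglongrightarrow> 1 ^ N * norm u"
    unfolding norm_mult norm_power by (intro tendsto_intros norm_lim)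
  moreover have "(\<lambda>l. norm (s l ^ N * u)) \<longlonglongrightarrow> norm a"
    by (intro tendsto_norm lim) simp
  ultimately have "norm a = norm u"
    using LIMSEQ_unique by fastforce
  then have a: "a \<noteq> 0" using u by auto
  have "(\<lambda>l. (s l ^ Suc N * u) / (s l ^ N * u)) \<longlonglongrightarrow> a / a"
    using a by (intro tendsto_divide lim) auto
  moreover have "\<forall>\<^sub>F l in sequentially. (s l ^ Suc N * u) / (s l ^ N * u) = s l"
    using s_nz by eventually_elim (use u in simp)
  ultimately show ?thesis
    using a by (simp add: tendsto_cong)
qed

section \<open>Convergent sequences of roots of a matrix with nonzero eigenvalues 1 and c\<close>

context
  fixes M Q :: "complex mat" and S :: "nat \<Rightarrow> complex mat" and N :: nat and c :: complex
    and q :: "nat \<Rightarrow> nat"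
  assumes M: "M \<in> carrier_mat N N" and c: "c \<noteq> 0" "c \<noteq> 1"
    and tr: "\<And>k. k \<ge> 1 \<Longrightarrow> mat_trace (M ^\<^sub>m k) = 1 + c ^ k"
    and S: "\<And>l. S l \<in> carrier_mat N N" and root: "\<And>l. S l ^\<^sub>m q l = M"
    and q: "filterlim q at_top sequentially"
    and lim: "\<And>n i j. n \<ge> 1 \<Longrightarrow> i < N \<Longrightarrow> j < N \<Longrightarrow>
      (\<lambda>l. (S l ^\<^sub>m n) $$ (i, j)) \<longlonglongrightarrow> Q $$ (i, j)"
begin

text \<open>The two parts \<open>U\<close> and \<open>V\<close> of \<open>M\<close> are determined by \<open>M = U + c V\<close> and \<open>M\<^sup>2 = U + c\<^sup>2 V\<close>.\<close>

definition subdominant_part :: "nat \<times> nat \<Rightarrow> complex" where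
  "subdominant_part ij = ((M * M) $$ ij - M $$ ij) / (c ^ 2 - c)"

definition dominant_part :: "nat \<times> nat \<Rightarrow> complex" where
  "dominant_part ij = M $$ ij - c * subdominant_part ij"

lemma square_minus_self_nonzero: "c ^ 2 - c \<noteq> 0"
proof -
  have "c ^ 2 - c = c * (c - 1)" by (simp add: power2_eq_square algebra_simps)
  then show ?thesis using c by simp
qed

text \<open>A priori the coefficients of s1^n and s2^n depend on l. Evaluating at the exponents q l
  and 2 * q l, where the power of S is M and M * M, gives two equations that determine them from M
  alone. The bound on q l puts both exponents beyond the nilpotent transient.\<close>

lemma root_spectrum:
  assumes "q l \<ge> max N 1"
  shows "\<exists>s1 s2. s1 ^ q l = 1 \<and> s2 ^ q l = c \<and>
    (\<forall>k\<ge>1. mat_trace (S l ^\<^sub>m k) = s1 ^ k + s2 ^ k) \<and>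
    (\<forall>i<N. \<forall>j<N. \<forall>n\<ge>N. (S l ^\<^sub>m n) $$ (i, j) = s1 ^ n * dominant_part (i, j) + s2 ^ n * subdominant_part (i, j))"
proof -
  have q1: "q l \<ge> 1" "q l \<ge> N" using assms by auto
  have "mat_trace (S l ^\<^sub>m (q l * k)) = 1 + c ^ k" if "k \<ge> 1" for k
    using tr[OF that] root[of l] pow_mat_pow[OF S, of l "q l" k] by simp
  from obtain_two_nonzero_eigenvalues[OF S q1(1) this c(1)]
  obtain s1 s2 m where s: "s1 ^ q l = 1" "s2 ^ q l = c" "N = m + 2"
    "char_poly (S l) = (\<Prod>e\<leftarrow>s1 # s2 # replicate m 0. [:- e, 1:])" by blast
  have nz: "s1 \<noteq> s2" "s1 \<noteq> 0" "s2 \<noteq> 0"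
    using s(1,2) c q1 by (auto simp: power_0_left)
  have "mat_trace (S l ^\<^sub>m k) = s1 ^ k + s2 ^ k" if "k \<ge> 1" for k
    using that by (subst mat_trace_pow_eigenvalues[OF S s(4)]) (simp add: sum_list_replicate power_0_left)
  moreover have "(S l ^\<^sub>m n) $$ (i, j) = s1 ^ n * dominant_part (i, j) + s2 ^ n * subdominant_part (i, j)"
    if ij: "i < N" "j < N" and n: "n \<ge> N" for i j n
  proof -
    obtain u v where uv: "\<And>n. n \<ge> N \<Longrightarrow> (S l ^\<^sub>m n) $$ (i, j) = s1 ^ n * u + s2 ^ n * v"
      using linear_recurrence_solution[of N "\<lambda>n. (S l ^\<^sub>m n) $$ (i, j)", OF pow_entries_recurrence[OF S s(3,4) ij] nz]
      by blast
    have 1: "M $$ (i, j) = u + c * v"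
      using uv[of "q l"] q1 s by (simp add: root)
    have "S l ^\<^sub>m (q l * 2) = M * M"
      by (simp only: mult_2_right pow_mat_add[OF S] root)
    then have 2: "(M * M) $$ (i, j) = u + c ^ 2 * v"
      using uv[of "q l * 2"] q1 s by (simp add: power_mult)
    have "(M * M) $$ (i, j) - M $$ (i, j) = (c ^ 2 - c) * v"
      unfolding 1 2 by (simp add: algebra_simps)
    then have "v = subdominant_part (i, j)"
      using square_minus_self_nonzero by (simp add: subdominant_part_def)
    moreover from this have "u = dominant_part (i, j)"
      by (simp add: dominant_part_def 1)
    ultimately show ?thesis using uv[OF n] by simp
  qed
  ultimately show ?thesis using s by blast
qed

text \<open>Trace 1 guarantees a nonzero diagonal entry in each part, and hence an entry in which
  the behaviour of the corresponding eigenvalue of the roots can be observed.\<close>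

lemma trace_spectral_parts: "(\<Sum>i<N. subdominant_part (i, i)) = 1" "(\<Sum>i<N. dominant_part (i, i)) = 1"
proof -
  have t1: "(\<Sum>i<N. M $$ (i, i)) = 1 + c"
    using tr[of 1] M by (simp add: mat_trace_def)
  have t2: "(\<Sum>i<N. (M * M) $$ (i, i)) = 1 + c ^ 2"
    using tr[of 2] M by (simp add: mat_trace_def numeral_2_eq_2)
  show 1: "(\<Sum>i<N. subdominant_part (i, i)) = 1"
    unfolding subdominant_part_def using square_minus_self_nonzero
    by (simp add: sum_divide_distrib[symmetric] sum_subtractf t1 t2 del: index_mult_mat)
  show "(\<Sum>i<N. dominant_part (i, i)) = 1"
    unfolding dominant_part_def by (simp add: sum_subtractf sum_distrib_left[symmetric] 1 t1)
qed

text \<open>The two eigenvalues are separated by comparing the exponents n and n + q l: the first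
  summand is unchanged while the second is multiplied by c. Both powers converge, to Q and to Q M,
  because raising the exponent by q l multiplies by M; as c differs from 1, each summand converges
  separately, to a limit that does not depend on n.\<close>

lemma eigenvalue_roots_tendsto_one:
  obtains s1 s2 where
    "\<And>l. q l \<ge> max N 1 \<Longrightarrow> s1 l ^ q l = 1" "\<And>l. q l \<ge> max N 1 \<Longrightarrow> s2 l ^ q l = c"
    "\<And>l k. q l \<ge> max N 1 \<Longrightarrow> k \<ge> 1 \<Longrightarrow> mat_trace (S l ^\<^sub>m k) = s1 l ^ k + s2 l ^ k"
    "\<And>l i j n. q l \<ge> max N 1 \<Longrightarrow> i < N \<Longrightarrow> j < N \<Longrightarrow> n \<ge> N \<Longrightarrow>
      (S l ^\<^sub>m n) $$ (i, j) = s1 l ^ n * dominant_part (i, j) + s2 l ^ n * subdominant_part (i, j)"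
    "s1 \<longlonglongrightarrow> 1" "s2 \<longlonglongrightarrow> 1"
proof -
  obtain s1 s2 where s:
    "\<And>l. q l \<ge> max N 1 \<Longrightarrow> s1 l ^ q l = 1" "\<And>l. q l \<ge> max N 1 \<Longrightarrow> s2 l ^ q l = c"
    "\<And>l k. q l \<ge> max N 1 \<Longrightarrow> k \<ge> 1 \<Longrightarrow> mat_trace (S l ^\<^sub>m k) = s1 l ^ k + s2 l ^ k"
    "\<And>l i j n. q l \<ge> max N 1 \<Longrightarrow> i < N \<Longrightarrow> j < N \<Longrightarrow> n \<ge> N \<Longrightarrow>
      (S l ^\<^sub>m n) $$ (i, j) = s1 l ^ n * dominant_part (i, j) + s2 l ^ n * subdominant_part (i, j)"
    using root_spectrum by metis
  have ev: "\<forall>\<^sub>F l in sequentially. q l \<ge> max N 1"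
    using q unfolding filterlim_at_top by blast
  define R where "R i j = (\<Sum>k<N. Q $$ (i, k) * M $$ (k, j))" for i j
  have limM: "(\<lambda>l. (S l ^\<^sub>m (n + q l)) $$ (i, j)) \<longlonglongrightarrow> R i j"
    if "n \<ge> 1" "i < N" "j < N" for n i j
  proof -
    have "(\<lambda>l. \<Sum>k<N. (S l ^\<^sub>m n) $$ (i, k) * M $$ (k, j)) \<longlonglongrightarrow> R i j"
      unfolding R_def using that by (intro tendsto_intros lim) auto
    moreover have "(S l ^\<^sub>m (n + q l)) $$ (i, j) = (\<Sum>k<N. (S l ^\<^sub>m n) $$ (i, k) * M $$ (k, j))" for l
      unfolding pow_mat_add[OF S] root
      by (rule index_mult_mat_sum) (use S M that in auto)
    ultimately show ?thesis by simp
  qed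
  have lim1: "(\<lambda>l. s1 l ^ n * dominant_part (i, j)) \<longlonglongrightarrow> (c * Q $$ (i, j) - R i j) / (c - 1)"
    and lim2: "(\<lambda>l. s2 l ^ n * subdominant_part (i, j)) \<longlonglongrightarrow> (R i j - Q $$ (i, j)) / (c - 1)"
    if "n \<ge> max N 1" "i < N" "j < N" for n i j
  proof -
    let ?x = "\<lambda>l. (S l ^\<^sub>m n) $$ (i, j)" and ?y = "\<lambda>l. (S l ^\<^sub>m (n + q l)) $$ (i, j)"
    have xy: "?x l = s1 l ^ n * dominant_part (i, j) + s2 l ^ n * subdominant_part (i, j)"
      "?y l = s1 l ^ n * dominant_part (i, j) + c * (s2 l ^ n * subdominant_part (i, j))"
      if "q l \<ge> max N 1" for l
      using s(4)[OF that \<open>i < N\<close> \<open>j < N\<close>, of n] s(4)[OF that \<open>i < N\<close> \<open>j < N\<close>, of "n + q l"]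
        \<open>n \<ge> max N 1\<close> s(1,2)[OF that] by (simp_all add: power_add)
    have "\<forall>\<^sub>F l in sequentially. (c * ?x l - ?y l) / (c - 1) = s1 l ^ n * dominant_part (i, j)"
      using ev by eventually_elim (use c xy in \<open>simp add: divide_eq_eq algebra_simps\<close>)
    moreover have "(\<lambda>l. (c * ?x l - ?y l) / (c - 1)) \<longlonglongrightarrow> (c * Q $$ (i, j) - R i j) / (c - 1)"
      using c that by (intro tendsto_intros lim limM) auto
    ultimately show "(\<lambda>l. s1 l ^ n * dominant_part (i, j)) \<longlonglongrightarrow> (c * Q $$ (i, j) - R i j) / (c - 1)"
      by (rule Lim_transform_eventually[rotated])
    have "\<forall>\<^sub>F l in sequentially. (?y l - ?x l) / (c - 1) = s2 l ^ n * subdominant_part (i, j)"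
      using ev by eventually_elim (use c xy in \<open>simp add: divide_eq_eq algebra_simps\<close>)
    moreover have "(\<lambda>l. (?y l - ?x l) / (c - 1)) \<longlonglongrightarrow> (R i j - Q $$ (i, j)) / (c - 1)"
      using c that by (intro tendsto_intros lim limM) auto
    ultimately show "(\<lambda>l. s2 l ^ n * subdominant_part (i, j)) \<longlonglongrightarrow> (R i j - Q $$ (i, j)) / (c - 1)"
      by (rule Lim_transform_eventually[rotated])
  qed
  have "\<not> (\<forall>i\<in>{..<N}. dominant_part (i, i) = 0)"
  proof
    assume "\<forall>i\<in>{..<N}. dominant_part (i, i) = 0"
    from sum.neutral[OF this] show False using trace_spectral_parts(2) by simp
  qed
  then obtain i where i: "i < N" "dominant_part (i, i) \<noteq> 0"
    by auto
  have "\<not> (\<forall>i\<in>{..<N}. subdominant_part (i, i) = 0)"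
  proof
    assume "\<forall>i\<in>{..<N}. subdominant_part (i, i) = 0"
    from sum.neutral[OF this] show False using trace_spectral_parts(1) by simp
  qed
  then obtain j where j: "j < N" "subdominant_part (j, j) \<noteq> 0"
    by auto
  have "s1 \<longlonglongrightarrow> 1"
  proof (rule root_of_constant_tendsto_one)
    show "\<forall>\<^sub>F l in sequentially. s1 l ^ q l = 1"
      using ev by eventually_elim (rule s(1))
    show "(\<lambda>l. s1 l ^ n * dominant_part (i, i)) \<longlonglongrightarrow> (c * Q $$ (i, i) - R i i) / (c - 1)" if "n \<ge> max N 1" for n
      using lim1 that i by blast
  qed (use q i in auto)
  moreover have "s2 \<longlonglongrightarrow> 1"
  proof (rule root_of_constant_tendsto_one)
    show "\<forall>\<^sub>F l in sequentially. s2 l ^ q l = c"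
      using ev by eventually_elim (rule s(2))
    show "(\<lambda>l. s2 l ^ n * subdominant_part (j, j)) \<longlonglongrightarrow> (R j j - Q $$ (j, j)) / (c - 1)" if "n \<ge> max N 1" for n
      using lim2 that j by blast
  qed (use q j c in auto)
  ultimately show ?thesis using that s by blast
qed

text \<open>With both eigenvalues tending to 1 the limit is U + V, and (1 + c)(U + c V) - (U + c^2
  V) = c (U + V). As a polynomial identity in M it can be read back as an identity between
  maps.\<close>

lemma limit_is_spectral_projection:
  assumes ij: "i < N" "j < N"
  shows "c * Q $$ (i, j) = (1 + c) * M $$ (i, j) - (M * M) $$ (i, j)"
proof (rule eigenvalue_roots_tendsto_one)
  fix s1 s2
  assume s:
    "\<And>l i j n. q l \<ge> max N 1 \<Longrightarrow> i < N \<Longrightarrow> j < N \<Longrightarrow> n \<ge> N \<Longrightarrow>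
      (S l ^\<^sub>m n) $$ (i, j) = s1 l ^ n * dominant_part (i, j) + s2 l ^ n * subdominant_part (i, j)"
    "s1 \<longlonglongrightarrow> 1" "s2 \<longlonglongrightarrow> 1"
  have ev: "\<forall>\<^sub>F l in sequentially. q l \<ge> max N 1"
    using q unfolding filterlim_at_top by blast
  let ?n = "max N 1"
  have "(\<lambda>l. s1 l ^ ?n * dominant_part (i, j) + s2 l ^ ?n * subdominant_part (i, j)) \<longlonglongrightarrow>
      1 ^ ?n * dominant_part (i, j) + 1 ^ ?n * subdominant_part (i, j)"
    by (intro tendsto_intros s)
  moreover have "\<forall>\<^sub>F l in sequentially.
      s1 l ^ ?n * dominant_part (i, j) + s2 l ^ ?n * subdominant_part (i, j) = (S l ^\<^sub>m ?n) $$ (i, j)"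
    using ev by eventually_elim (simp add: s(1) ij)
  ultimately have "(\<lambda>l. (S l ^\<^sub>m ?n) $$ (i, j)) \<longlonglongrightarrow>
      1 ^ ?n * dominant_part (i, j) + 1 ^ ?n * subdominant_part (i, j)"
    by (rule Lim_transform_eventually)
  with lim[of ?n, OF _ ij] have "Q $$ (i, j) = 1 ^ ?n * dominant_part (i, j) + 1 ^ ?n * subdominant_part (i, j)"
    by (intro LIMSEQ_unique) auto
  then have Q_eq: "Q $$ (i, j) = M $$ (i, j) - (c - 1) * subdominant_part (i, j)"
    by (simp add: dominant_part_def algebra_simps)
  have "c * Q $$ (i, j) = c * M $$ (i, j) - (c ^ 2 - c) * subdominant_part (i, j)"
    unfolding Q_eq by (simp add: algebra_simps power2_eq_square)
  also have "(c ^ 2 - c) * subdominant_part (i, j) = (M * M) $$ (i, j) - M $$ (i, j)"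
    using square_minus_self_nonzero by (simp add: subdominant_part_def)
  finally show ?thesis by (simp add: algebra_simps)
qed

text \<open>Real traces of S and its square make the pair s1, s2 closed under conjugation. If the
  two are conjugate, then so are their powers 1 and c, against c being different from 1. Otherwise
  s2 is real; for odd orders it could still be a negative root of a negative c, which its closeness
  to 1 rules out.\<close>

lemma subdominant_eigenvalue_not_negative:
  assumes real: "\<And>l. mat_trace (S l) \<in> \<real>" "\<And>l. mat_trace (S l ^\<^sub>m 2) \<in> \<real>"
  shows "\<not> (c \<in> \<real> \<and> Re c < 0)"
proof (rule eigenvalue_roots_tendsto_one, rule notI)
  fix s1 s2
  assume c_neg: "c \<in> \<real> \<and> Re c < 0"
  assume s:
    "\<And>l. q l \<ge> max N 1 \<Longrightarrow> s1 l ^ q l = 1" "\<And>l. q l \<ge> max N 1 \<Longrightarrow> s2 l ^ q l = c"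
    "\<And>l k. q l \<ge> max N 1 \<Longrightarrow> k \<ge> 1 \<Longrightarrow> mat_trace (S l ^\<^sub>m k) = s1 l ^ k + s2 l ^ k"
    "s2 \<longlonglongrightarrow> 1"
  have "\<forall>\<^sub>F l in sequentially. q l \<ge> max N 1"
    using q unfolding filterlim_at_top by blast
  moreover have "\<forall>\<^sub>F l in sequentially. Re (s2 l) > 0"
    using tendsto_Re[OF s(4)] by (intro order_tendstoD(1)[of _ 1]) auto
  ultimately have "\<forall>\<^sub>F l in sequentially. q l \<ge> max N 1 \<and> Re (s2 l) > 0"
    by (rule eventually_conj)
  then obtain l where l: "q l \<ge> max N 1" "Re (s2 l) > 0"
    using eventually_happens' sequentially_bot by blast
  have "s1 l + s2 l \<in> \<real>"
    using s(3)[OF l(1), of 1] real(1)[of l] S[of l] by simp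
  then have im1: "Im (s1 l) = - Im (s2 l)"
    by (simp add: complex_is_Real_iff)
  have "s1 l ^ 2 + s2 l ^ 2 \<in> \<real>"
    using s(3)[OF l(1), of 2] real(2)[of l] by (simp del: pow_mat.simps)
  then have "Im (s2 l) * (Re (s2 l) - Re (s1 l)) = 0"
    by (simp add: complex_is_Real_iff im1 power2_eq_square algebra_simps)
  then consider "Im (s2 l) = 0" | "Re (s2 l) = Re (s1 l)" by auto
  then show False
  proof cases
    case 1
    then have "s2 l = of_real (Re (s2 l))" by (simp add: complex_eq_iff)
    then have "c = of_real (Re (s2 l) ^ q l)"
      using s(2)[OF l(1)] by (metis of_real_power)
    then show False using c_neg l(2) by simp
  next
    case 2
    then have "s2 l = cnj (s1 l)" by (simp add: complex_eq_iff im1)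
    then have "c = cnj (s1 l ^ q l)"
      using s(2)[OF l(1)] by simp
    then show False using s(1)[OF l(1)] c by simp
  qed
qed

end

section \<open>Completely positive maps\<close>

lemma mat_adjoint_carrier [simp]: "M \<in> carrier_mat n m \<Longrightarrow> mat_adjoint M \<in> carrier_mat m n"
  by (auto simp: mat_adjoint_def)

lemma mat_adjoint_index [simp]:
  fixes M :: "complex mat"
  shows "M \<in> carrier_mat n m \<Longrightarrow> i < m \<Longrightarrow> j < n \<Longrightarrow> mat_adjoint M $$ (i, j) = cnj (M $$ (j, i))"
  by (auto simp: mat_adjoint_def mat_of_rows_index)

lemma mat_adjoint_mult:
  fixes M :: "complex mat"
  assumes "M \<in> carrier_mat n m" "K \<in> carrier_mat m r"
  shows "mat_adjoint (M * K) = mat_adjoint K * mat_adjoint M"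
proof (rule eq_matI)
  have MK: "M * K \<in> carrier_mat n r" using assms by simp
  have a: "mat_adjoint K \<in> carrier_mat r m" "mat_adjoint M \<in> carrier_mat m n"
    using assms by auto
  fix i j
  assume "i < dim_row (mat_adjoint K * mat_adjoint M)" "j < dim_col (mat_adjoint K * mat_adjoint M)"
  then have ij: "i < r" "j < n" using a by auto
  show "mat_adjoint (M * K) $$ (i, j) = (mat_adjoint K * mat_adjoint M) $$ (i, j)"
    using ij assms
    by (simp add: mat_adjoint_index[OF MK] index_mult_mat_sum[OF a ij] index_mult_mat_sum[OF assms ij(2,1)]
        mult.commute del: index_mult_mat)
qed (use assms in \<open>auto simp: mat_adjoint_def\<close>)

lemma mult_mult_adjoint_index:
  fixes M :: "complex mat"
  assumes M: "M \<in> carrier_mat D D" and X: "X \<in> carrier_mat D D" and ij: "i < D" "j < D"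
  shows "(M * X * mat_adjoint M) $$ (i, j) = (\<Sum>k<D. \<Sum>l<D. M $$ (i, k) * X $$ (k, l) * cnj (M $$ (j, l)))"
proof -
  have "(M * X * mat_adjoint M) $$ (i, j) = (\<Sum>l<D. (M * X) $$ (i, l) * mat_adjoint M $$ (l, j))"
    by (rule index_mult_mat_sum) (use M X ij in auto)
  also have "\<dots> = (\<Sum>l<D. (\<Sum>k<D. M $$ (i, k) * X $$ (k, l)) * cnj (M $$ (j, l)))"
    using M X ij by (intro sum.cong refl arg_cong2[where f = "(*)"] index_mult_mat_sum) auto
  also have "\<dots> = (\<Sum>k<D. \<Sum>l<D. M $$ (i, k) * X $$ (k, l) * cnj (M $$ (j, l)))"
    by (subst sum.swap) (simp add: sum_distrib_right)
  finally show ?thesis .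
qed

lemma sum_div_mod:
  fixes f :: "nat \<Rightarrow> nat \<Rightarrow> 'a :: comm_monoid_add"
  shows "(\<Sum>i<k * D. f (i div D) (i mod D)) = (\<Sum>a<k. \<Sum>b<D. f a b)"
proof -
  have "(\<Sum>i<k * D. f (i div D) (i mod D)) = (\<Sum>a<k. \<Sum>i\<in>{a * D..<a * D + D}. f (i div D) (i mod D))"
    by (rule sum.nat_group[symmetric])
  also have "\<dots> = (\<Sum>a<k. \<Sum>b<D. f a b)"
  proof (rule sum.cong[OF refl])
    fix a
    have "(\<Sum>i\<in>{a * D..<a * D + D}. f (i div D) (i mod D)) =
        (\<Sum>b\<in>{0..<D}. f ((b + a * D) div D) ((b + a * D) mod D))"
      using sum.shift_bounds_nat_ivl[of "\<lambda>i. f (i div D) (i mod D)" 0 "a * D" D] by (simp add: add.commute)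
    also have "\<dots> = (\<Sum>b<D. f a b)"
      by (intro sum.cong) auto
    finally show "(\<Sum>i\<in>{a * D..<a * D + D}. f (i div D) (i mod D)) = (\<Sum>b<D. f a b)" .
  qed
  finally show ?thesis .
qed

lemma block_index_less: "(a::nat) < k \<Longrightarrow> i < D \<Longrightarrow> a * D + i < k * D"
proof -
  assume "a < k" "i < D"
  then have "a * D + i < (a + 1) * D" by simp
  also have "\<dots> \<le> k * D" using \<open>a < k\<close> by (intro mult_right_mono) auto
  finally show ?thesis .
qed

lemma quadratic_form:
  fixes X :: "complex mat"
  assumes "X \<in> carrier_mat m m" "v \<in> carrier_vec m"
  shows "(X *\<^sub>v v) \<bullet>c v = (\<Sum>i<m. \<Sum>j<m. X $$ (i, j) * v $ j * cnj (v $ i))"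
  using assms by (auto simp: scalar_prod_def atLeast0LessThan sum_distrib_right intro!: sum.cong)

lemma linear_map_carrier: "linear_map D T \<Longrightarrow> X \<in> carrier_mat D D \<Longrightarrow> T X \<in> carrier_mat D D"
  by (simp add: linear_map_def)

lemma pos_semidef_add:
  assumes "pos_semidef m X" "pos_semidef m Y"
  shows "pos_semidef m (X + Y)"
  using assms unfolding pos_semidef_def
  by (auto simp: quadratic_form[of _ m] algebra_simps sum.distrib)

lemma transfer_Nil [simp]: "transfer D [] X = 0\<^sub>m D D"
  by (simp add: transfer_def)

lemma transfer_Cons [simp]: "transfer D (M # A) X = M * X * mat_adjoint M + transfer D A X"
  by (simp add: transfer_def)

lemma transfer_carrier:
  "set A \<subseteq> carrier_mat D D \<Longrightarrow> X \<in> carrier_mat D D \<Longrightarrow> transfer D A X \<in> carrier_mat D D"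
  by (induction A) auto

lemma transfer_index:
  assumes A: "set A \<subseteq> carrier_mat D D" and X: "X \<in> carrier_mat D D" and ij: "i < D" "j < D"
  shows "transfer D A X $$ (i, j) = (\<Sum>s<length A. (A ! s * X * mat_adjoint (A ! s)) $$ (i, j))"
  using A
proof (induction A)
  case Nil
  then show ?case using ij by simp
next
  case (Cons M A)
  then have c: "M * X * mat_adjoint M \<in> carrier_mat D D" "transfer D A X \<in> carrier_mat D D"
    using X transfer_carrier by (auto intro!: mult_carrier_mat[of _ D D])
  have "transfer D (M # A) X $$ (i, j) = (M * X * mat_adjoint M) $$ (i, j) + transfer D A X $$ (i, j)"
    unfolding transfer_Cons using c ij by (subst index_add_mat) auto
  then show ?case
    using Cons by (simp add: sum.lessThan_Suc_shift del: sum.lessThan_Suc)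
qed

lemma transfer_index_sum:
  assumes A: "set A \<subseteq> carrier_mat D D" and X: "X \<in> carrier_mat D D" and ij: "i < D" "j < D"
  shows "transfer D A X $$ (i, j) =
    (\<Sum>s<length A. \<Sum>k<D. \<Sum>l<D. (A ! s) $$ (i, k) * X $$ (k, l) * cnj ((A ! s) $$ (j, l)))"
  unfolding transfer_index[OF assms] using A X ij
  by (intro sum.cong refl mult_mult_adjoint_index) (auto intro: nth_mem)

lemma linear_map_transfer:
  assumes A: "set A \<subseteq> carrier_mat D D"
  shows "linear_map D (transfer D A)"
  unfolding linear_map_def
proof (intro conjI ballI allI)
  fix X Y :: "complex mat" and c
  assume X: "X \<in> carrier_mat D D"
  note TX = transfer_carrier[OF A X]
  show "transfer D A X \<in> carrier_mat D D" by (rule TX)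
  have cX: "c \<cdot>\<^sub>m X \<in> carrier_mat D D" using X by simp
  show "transfer D A (c \<cdot>\<^sub>m X) = c \<cdot>\<^sub>m transfer D A X"
    using X TX transfer_carrier[OF A cX]
    by (intro eq_matI) (auto simp: transfer_index_sum[OF A] sum_distrib_left algebra_simps)
  assume Y: "Y \<in> carrier_mat D D"
  have XY: "X + Y \<in> carrier_mat D D" using X Y by simp
  show "transfer D A (X + Y) = transfer D A X + transfer D A Y"
    using X Y TX transfer_carrier[OF A Y] transfer_carrier[OF A XY]
    by (intro eq_matI) (auto simp: transfer_index_sum[OF A] sum.distrib algebra_simps)
qed

text \<open>Conjugation moves onto the vector: the quadratic form of the ampliation at v is that of
  X at \<open>w\<close>, which is v with the adjoint of M applied to each block.\<close>

lemma pos_semidef_ampliation_kraus: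
  assumes M: "(M :: complex mat) \<in> carrier_mat D D" and X: "pos_semidef (k * D) X"
  shows "pos_semidef (k * D) (ampliation D k (\<lambda>Y. M * Y * mat_adjoint M) X)"
proof -
  let ?m = "k * D" and ?A = "ampliation D k (\<lambda>Y. M * Y * mat_adjoint M) X"
  have A: "?A \<in> carrier_mat ?m ?m" by (simp add: ampliation_def)
  have "0 \<le> (?A *\<^sub>v v) \<bullet>c v" if v: "v \<in> carrier_vec ?m" for v
  proof -
    define w where "w = vec ?m (\<lambda>i. \<Sum>j<D. cnj (M $$ (j, i mod D)) * v $ (i div D * D + j))"
    let ?X = "\<lambda>a p b q. X $$ (a * D + p, b * D + q)" and ?v = "\<lambda>a i. v $ (a * D + i)"
    have w_index: "w $ (a * D + p) = (\<Sum>j<D. cnj (M $$ (j, p)) * ?v a j)" if "a < k" "p < D" for a p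
      using that block_index_less[OF that] by (simp add: w_def)
    have D: "i < k * D \<Longrightarrow> 0 < D" for i by (cases D) auto
    have "(?A *\<^sub>v v) \<bullet>c v = (\<Sum>i<?m. \<Sum>j<?m. (\<Sum>p<D. \<Sum>q<D. M $$ (i mod D, p) *
        ?X (i div D) p (j div D) q * cnj (M $$ (j mod D, q))) * ?v (j div D) (j mod D) * cnj (?v (i div D) (i mod D)))"
      unfolding quadratic_form[OF A v]
    proof (intro sum.cong refl)
      fix i j
      assume ij: "i \<in> {..<?m}" "j \<in> {..<?m}"
      then have "?A $$ (i, j) = (M * block_of D X (i div D) (j div D) * mat_adjoint M) $$ (i mod D, j mod D)"
        by (simp add: ampliation_def)
      also have "\<dots> = (\<Sum>p<D. \<Sum>q<D. M $$ (i mod D, p) * ?X (i div D) p (j div D) q * cnj (M $$ (j mod D, q)))"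
        using ij D by (subst mult_mult_adjoint_index[OF M]) (auto simp: block_of_def)
      finally show "?A $$ (i, j) * v $ j * cnj (v $ i) = (\<Sum>p<D. \<Sum>q<D. M $$ (i mod D, p) *
        ?X (i div D) p (j div D) q * cnj (M $$ (j mod D, q))) * ?v (j div D) (j mod D) * cnj (?v (i div D) (i mod D))"
        by simp
    qed
    also have "\<dots> = (\<Sum>a<k. \<Sum>i<D. \<Sum>b<k. \<Sum>j<D. (\<Sum>p<D. \<Sum>q<D. M $$ (i, p) *
        ?X a p b q * cnj (M $$ (j, q))) * ?v b j * cnj (?v a i))"
      by (subst sum_div_mod[symmetric], subst sum_div_mod[symmetric]) (rule refl)
    also have "\<dots> = (\<Sum>a<k. \<Sum>b<k. \<Sum>i<D. \<Sum>j<D. (\<Sum>p<D. \<Sum>q<D. M $$ (i, p) *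
        ?X a p b q * cnj (M $$ (j, q))) * ?v b j * cnj (?v a i))"
      by (rule sum.cong[OF refl], rule sum.swap)
    also have "\<dots> = (\<Sum>a<k. \<Sum>b<k. \<Sum>p<D. \<Sum>q<D. ?X a p b q * w $ (b * D + q) * cnj (w $ (a * D + p)))"
    proof (rule sum.cong[OF refl], rule sum.cong[OF refl])
      fix a b
      assume ab: "a \<in> {..<k}" "b \<in> {..<k}"
      let ?t = "\<lambda>i j p q. M $$ (i, p) * ?X a p b q * cnj (M $$ (j, q)) * ?v b j * cnj (?v a i)"
      have "(\<Sum>i<D. \<Sum>j<D. (\<Sum>p<D. \<Sum>q<D. M $$ (i, p) *
        ?X a p b q * cnj (M $$ (j, q))) * ?v b j * cnj (?v a i)) = (\<Sum>i<D. \<Sum>j<D. \<Sum>p<D. \<Sum>q<D. ?t i j p q)"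
        by (simp add: sum_distrib_right)
      also have "\<dots> = (\<Sum>i<D. \<Sum>p<D. \<Sum>j<D. \<Sum>q<D. ?t i j p q)"
        by (rule sum.cong[OF refl], rule sum.swap)
      also have "\<dots> = (\<Sum>p<D. \<Sum>i<D. \<Sum>j<D. \<Sum>q<D. ?t i j p q)"
        by (rule sum.swap)
      also have "\<dots> = (\<Sum>p<D. \<Sum>i<D. \<Sum>q<D. \<Sum>j<D. ?t i j p q)"
        by (rule sum.cong[OF refl], rule sum.cong[OF refl], rule sum.swap)
      also have "\<dots> = (\<Sum>p<D. \<Sum>q<D. \<Sum>i<D. \<Sum>j<D. ?t i j p q)"
        by (rule sum.cong[OF refl], rule sum.swap)
      also have "\<dots> = (\<Sum>p<D. \<Sum>q<D. ?X a p b q * w $ (b * D + q) * cnj (w $ (a * D + p)))"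
      proof (rule sum.cong[OF refl], rule sum.cong[OF refl])
        fix p q
        assume pq: "p \<in> {..<D}" "q \<in> {..<D}"
        have "?X a p b q * w $ (b * D + q) * cnj (w $ (a * D + p)) =
            ?X a p b q * (\<Sum>j<D. cnj (M $$ (j, q)) * ?v b j) * (\<Sum>i<D. M $$ (i, p) * cnj (?v a i))"
          using ab pq by (simp add: w_index)
        also have "\<dots> = (\<Sum>i<D. \<Sum>j<D. ?X a p b q * (cnj (M $$ (j, q)) * ?v b j) * (M $$ (i, p) * cnj (?v a i)))"
          by (simp only: sum_distrib_left sum_distrib_right)
        finally show "(\<Sum>i<D. \<Sum>j<D. ?t i j p q) = ?X a p b q * w $ (b * D + q) * cnj (w $ (a * D + p))"
          by (simp add: mult_ac)
      qed
      finally show "(\<Sum>i<D. \<Sum>j<D. (\<Sum>p<D. \<Sum>q<D. M $$ (i, p) *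
        ?X a p b q * cnj (M $$ (j, q))) * ?v b j * cnj (?v a i)) =
        (\<Sum>p<D. \<Sum>q<D. ?X a p b q * w $ (b * D + q) * cnj (w $ (a * D + p)))" .
    qed
    also have "\<dots> = (\<Sum>a<k. \<Sum>p<D. \<Sum>b<k. \<Sum>q<D. ?X a p b q * w $ (b * D + q) * cnj (w $ (a * D + p)))"
      by (rule sum.cong[OF refl], rule sum.swap)
    also have "\<dots> = (\<Sum>i<?m. \<Sum>j<?m. ?X (i div D) (i mod D) (j div D) (j mod D) *
        w $ (j div D * D + j mod D) * cnj (w $ (i div D * D + i mod D)))"
      by (subst sum_div_mod[symmetric], subst sum_div_mod[symmetric]) (rule refl)
    also have "\<dots> = (X *\<^sub>v w) \<bullet>c w"
      using X by (subst quadratic_form[of _ ?m]) (auto simp: pos_semidef_def w_def)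
    also have "0 \<le> \<dots>"
      using X by (auto simp: pos_semidef_def w_def)
    finally show ?thesis .
  qed
  then show ?thesis using A by (simp add: pos_semidef_def)
qed

lemma completely_positive_transfer:
  assumes A: "set A \<subseteq> carrier_mat D D"
  shows "completely_positive D (transfer D A)"
proof -
  have "pos_semidef (k * D) (ampliation D k (transfer D A) X)" if X: "pos_semidef (k * D) X" for k X
    using A
  proof (induction A)
    case Nil
    have c: "ampliation D k (transfer D []) X \<in> carrier_mat (k * D) (k * D)"
      by (simp add: ampliation_def)
    have z: "ampliation D k (transfer D []) X $$ (i, j) = 0" if "i < k * D" "j < k * D" for i j
    proof -
      have "0 < D" using that by (cases D) auto
      then show ?thesis using that by (simp add: ampliation_def)
    qed
    show ?case
      unfolding pos_semidef_def
      using c z by (auto simp: quadratic_form[of _ "k * D"] simp del: transfer_Nil)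
  next
    case (Cons M A)
    have "ampliation D k (transfer D (M # A)) X =
        ampliation D k (\<lambda>Y. M * Y * mat_adjoint M) X + ampliation D k (transfer D A) X"
    proof (rule eq_matI)
      fix i j
      assume "i < dim_row (ampliation D k (\<lambda>Y. M * Y * mat_adjoint M) X + ampliation D k (transfer D A) X)"
        "j < dim_col (ampliation D k (\<lambda>Y. M * Y * mat_adjoint M) X + ampliation D k (transfer D A) X)"
      then have ij: "i < k * D" "j < k * D" by (auto simp: ampliation_def)
      then have D: "0 < D" by (cases D) auto
      have "block_of D X (i div D) (j div D) \<in> carrier_mat D D" by (simp add: block_of_def)
      from transfer_carrier[OF _ this, of A] Cons.prems ij D
      show "ampliation D k (transfer D (M # A)) X $$ (i, j) =
          (ampliation D k (\<lambda>Y. M * Y * mat_adjoint M) X + ampliation D k (transfer D A) X) $$ (i, j)"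
        by (simp add: ampliation_def del: index_mult_mat)
    qed (auto simp: ampliation_def)
    then show ?case
      using Cons pos_semidef_ampliation_kraus[OF _ X] pos_semidef_add by (simp del: transfer_Cons)
  qed
  then show ?thesis
    using linear_map_transfer[OF A] by (simp add: completely_positive_def)
qed

lemma completely_positive_compose:
  assumes S: "completely_positive D S" and T: "completely_positive D T"
  shows "completely_positive D (T \<circ> S)"
proof -
  have lin: "linear_map D (T \<circ> S)"
    using S T by (auto simp: completely_positive_def linear_map_def)
  have "ampliation D k (T \<circ> S) X = ampliation D k T (ampliation D k S X)"
    if X: "X \<in> carrier_mat (k * D) (k * D)" for k X
  proof (rule eq_matI)
    fix i j
    assume "i < dim_row (ampliation D k T (ampliation D k S X))"
      "j < dim_col (ampliation D k T (ampliation D k S X))"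
    then have ij: "i < k * D" "j < k * D" by (auto simp: ampliation_def)
    then have D: "i div D < k" "j div D < k" "0 < D"
      by (auto simp: less_mult_imp_div_less intro!: gr0I)
    have "S (block_of D X (i div D) (j div D)) \<in> carrier_mat D D"
      using S by (auto simp: completely_positive_def block_of_def intro: linear_map_carrier)
    then have "block_of D (ampliation D k S X) (i div D) (j div D) = S (block_of D X (i div D) (j div D))"
      using D by (intro eq_matI) (auto simp: block_of_def ampliation_def block_index_less)
    then show "ampliation D k (T \<circ> S) X $$ (i, j) = ampliation D k T (ampliation D k S X) $$ (i, j)"
      using ij by (simp add: ampliation_def)
  qed (auto simp: ampliation_def)
  then show ?thesis
    using lin S T by (simp add: completely_positive_def pos_semidef_def)
qed

text \<open>
  With \<open>\<Omega> = \<Sum>\<^sub>a e\<^sub>a \<otimes> e\<^sub>a\<close> and \<open>v = (1 \<otimes> X) \<Omega>\<close> this is \<open>\<langle>\<Omega>| (id \<otimes> T)(|v\<rangle>\<langle>v|) |\<Omega>\<rangle>\<close>; for \<open>X = 1\<close> it is the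
  trace of \<open>T\<close> as a linear map.
\<close>

definition choi_form :: "nat \<Rightarrow> complex mat \<Rightarrow> (complex mat \<Rightarrow> complex mat) \<Rightarrow> complex" where
  "choi_form D X T =
    (\<Sum>a<D. \<Sum>b<D. T (mat D D (\<lambda>(i, j). X $$ (i, a) * cnj (X $$ (j, b)))) $$ (a, b))"

lemma choi_form_nonneg:
  assumes T: "completely_positive D T"
  shows "0 \<le> choi_form D X T"
proof -
  let ?K = "\<lambda>a b. mat D D (\<lambda>(i, j). X $$ (i, a) * cnj (X $$ (j, b)))"
  \<comment> \<open>The rank-one matrix of the vector whose a-th block is column a of X.\<close>
  define W where "W = mat (D * D) (D * D) (\<lambda>(i, j). X $$ (i mod D, i div D) * cnj (X $$ (j mod D, j div D)))"
  have W: "W \<in> carrier_mat (D * D) (D * D)" by (simp add: W_def)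
  have "0 \<le> (W *\<^sub>v v) \<bullet>c v" if v: "v \<in> carrier_vec (D * D)" for v
  proof -
    define z where "z = (\<Sum>i<D * D. X $$ (i mod D, i div D) * cnj (v $ i))"
    have "(W *\<^sub>v v) \<bullet>c v = z * cnj z"
      unfolding quadratic_form[OF W v] z_def cnj_sum sum_product
      by (intro sum.cong refl) (simp add: W_def algebra_simps)
    then show ?thesis
      by (simp only: complex_norm_square[symmetric]) (simp add: less_eq_complex_def)
  qed
  then have "pos_semidef (D * D) W" using W by (simp add: pos_semidef_def)
  then have psd: "pos_semidef (D * D) (ampliation D D T W)"
    using T by (simp add: completely_positive_def)
  \<comment> \<open>This \<open>v\<close> is the vector \<Omega> of the formula given for
    \<open>choi_form\<close>; the vector called v there is the one that spans the range of
    \<open>W\<close> (if nonzero).\<close>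
  define v where "v = vec (D * D) (\<lambda>i. if i div D = i mod D then 1 else 0 :: complex)"
  have v: "v \<in> carrier_vec (D * D)" by (simp add: v_def)
  have block: "block_of D W a b = ?K a b" if "a < D" "b < D" for a b
    using that by (intro eq_matI) (auto simp: block_of_def W_def block_index_less)
  let ?d = "\<lambda>a i. if a = i then 1 else 0 :: complex"
  have "(ampliation D D T W *\<^sub>v v) \<bullet>c v = (\<Sum>i<D * D. \<Sum>j<D * D.
      T (?K (i div D) (j div D)) $$ (i mod D, j mod D) * ?d (j div D) (j mod D) * ?d (i div D) (i mod D))"
    by (subst quadratic_form[OF _ v])
      (auto simp: ampliation_def v_def block less_mult_imp_div_less intro!: sum.cong)
  also have "\<dots> = (\<Sum>a<D. \<Sum>i<D. \<Sum>b<D. \<Sum>j<D. T (?K a b) $$ (i, j) * ?d b j * ?d a i)"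
    by (subst sum_div_mod[symmetric], subst sum_div_mod[symmetric]) (rule refl)
  also have "\<dots> = choi_form D X T"
    unfolding choi_form_def
  proof (rule sum.cong[OF refl])
    fix a
    assume a: "a \<in> {..<D}"
    have "(\<Sum>i<D. \<Sum>b<D. \<Sum>j<D. T (?K a b) $$ (i, j) * ?d b j * ?d a i) =
        (\<Sum>i<D. if a = i then \<Sum>b<D. \<Sum>j<D. if b = j then T (?K a b) $$ (i, j) else 0 else 0)"
    proof (rule sum.cong[OF refl])
      fix i
      show "(\<Sum>b<D. \<Sum>j<D. T (?K a b) $$ (i, j) * ?d b j * ?d a i) =
          (if a = i then \<Sum>b<D. \<Sum>j<D. if b = j then T (?K a b) $$ (i, j) else 0 else 0)"
        by (cases "a = i") (auto intro!: sum.cong simp del: sum.delta sum.delta')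
    qed
    then show "(\<Sum>i<D. \<Sum>b<D. \<Sum>j<D. T (?K a b) $$ (i, j) * ?d b j * ?d a i) =
        (\<Sum>b<D. T (?K a b) $$ (a, b))"
      using a by simp
  qed
  finally have "(ampliation D D T W *\<^sub>v v) \<bullet>c v = choi_form D X T" .
  then show ?thesis
    using psd v unfolding pos_semidef_def by metis
qed

section \<open>Words\<close>

lemma spin_words_0 [simp]: "spin_words d 0 = {[]}"
  by (auto simp: spin_words_def)

lemma spin_words_Suc: "spin_words d (Suc N) = (\<lambda>(s, t). s # t) ` ({..<d} \<times> spin_words d N)"
  by (auto simp: spin_words_def length_Suc_conv image_iff)

lemma finite_spin_words [simp]: "finite (spin_words d N)"
  by (induction N) (auto simp: spin_words_Suc)

lemma sum_spin_words_Suc: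
  "(\<Sum>w\<in>spin_words d (Suc N). f w) = (\<Sum>s<d. \<Sum>t\<in>spin_words d N. f (s # t))"
  unfolding spin_words_Suc
  by (subst sum.reindex) (auto simp: inj_on_def sum.cartesian_product case_prod_unfold)

lemma Cons_spin_words: "s # t \<in> spin_words d (Suc N) \<longleftrightarrow> s < d \<and> t \<in> spin_words d N"
  by (auto simp: spin_words_def)

lemma spin_words_append:
  "u \<in> spin_words d n \<Longrightarrow> w \<in> spin_words d m \<Longrightarrow> u @ w \<in> spin_words d (n + m)"
  by (auto simp: spin_words_def)

lemma sum_spin_words_add:
  "(\<Sum>w\<in>spin_words d (n + m). f w) = (\<Sum>u\<in>spin_words d n. \<Sum>w\<in>spin_words d m. f (u @ w))"
  by (induction n arbitrary: f) (simp_all add: sum_spin_words_Suc)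

section \<open>Products of tensor matrices along words\<close>

definition word_mat :: "nat \<Rightarrow> tensor \<Rightarrow> nat list \<Rightarrow> complex mat" where
  "word_mat D A w = foldr (\<lambda>i M. (A ! i) * M) w (1\<^sub>m D)"

lemma word_mat_simps [simp]:
  "word_mat D A [] = 1\<^sub>m D" "word_mat D A (s # w) = A ! s * word_mat D A w"
  by (simp_all add: word_mat_def)

lemma word_mat_carrier:
  "set A \<subseteq> carrier_mat D D \<Longrightarrow> w \<in> spin_words (length A) N \<Longrightarrow> word_mat D A w \<in> carrier_mat D D"
proof (induction w arbitrary: N)
  case Nil
  then show ?case by simp
next
  case (Cons s w)
  then obtain N' where "N = Suc N'" by (auto simp: spin_words_def)
  then have "s < length A" "word_mat D A w \<in> carrier_mat D D"
    using Cons by (auto simp: Cons_spin_words)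
  then show ?case
    using Cons.prems(1) by (auto intro!: mult_carrier_mat[of _ D D])
qed

lemma word_mat_append:
  assumes A: "set A \<subseteq> carrier_mat D D" and u: "u \<in> spin_words (length A) n" and w: "w \<in> spin_words (length A) m"
  shows "word_mat D A (u @ w) = word_mat D A u * word_mat D A w"
  using u
proof (induction u arbitrary: n)
  case Nil
  then show ?case using word_mat_carrier[OF A w] by simp
next
  case (Cons s u)
  then obtain n' where n: "n = Suc n'" by (auto simp: spin_words_def)
  with Cons.prems have "s < length A" and u: "u \<in> spin_words (length A) n'"
    by (auto simp: Cons_spin_words)
  then have "A ! s \<in> carrier_mat D D" using A by auto
  then show ?case
    using Cons.IH[OF u] word_mat_carrier[OF A u] word_mat_carrier[OF A w]
    by (simp add: assoc_mult_mat[of _ D D _ D _ D])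
qed

lemma snd_mps:
  "N \<ge> 1 \<Longrightarrow> w \<in> spin_words (length A) N \<Longrightarrow> snd (mps D A) N w = mat_trace (word_mat D A w)"
  by (simp add: mps_def word_mat_def)

lemma fst_mps [simp]: "fst (mps D A) = length A"
  by (simp add: mps_def)

lemma transfer_pow_carrier:
  "set A \<subseteq> carrier_mat D D \<Longrightarrow> X \<in> carrier_mat D D \<Longrightarrow> (transfer D A ^^ m) X \<in> carrier_mat D D"
  by (induction m) (auto intro: transfer_carrier)

lemma transfer_pow_index:
  assumes A: "set A \<subseteq> carrier_mat D D" and X: "X \<in> carrier_mat D D" and ij: "i < D" "j < D"
  shows "(transfer D A ^^ m) X $$ (i, j) =
    (\<Sum>t\<in>spin_words (length A) m. (word_mat D A t * X * mat_adjoint (word_mat D A t)) $$ (i, j))"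
  using ij
proof (induction m arbitrary: i j)
  case 0
  have "mat_adjoint (1\<^sub>m D) = (1\<^sub>m D :: complex mat)"
    by (rule eq_matI) (auto simp: mat_adjoint_def mat_of_rows_index)
  then show ?case using X by simp
next
  case (Suc m)
  let ?W = "word_mat D A" and ?d = "length A"
  have "(transfer D A ^^ Suc m) X $$ (i, j) =
      (\<Sum>s<?d. \<Sum>k<D. \<Sum>l<D. (A ! s) $$ (i, k) * (transfer D A ^^ m) X $$ (k, l) * cnj ((A ! s) $$ (j, l)))"
    using Suc.prems transfer_pow_carrier[OF A X] by (simp add: transfer_index_sum[OF A])
  also have "\<dots> = (\<Sum>s<?d. \<Sum>t\<in>spin_words ?d m. (?W (s # t) * X * mat_adjoint (?W (s # t))) $$ (i, j))"
  proof (rule sum.cong[OF refl])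
    fix s
    assume "s \<in> {..<?d}"
    then have As: "A ! s \<in> carrier_mat D D" using A by auto
    have "(\<Sum>k<D. \<Sum>l<D. (A ! s) $$ (i, k) * (transfer D A ^^ m) X $$ (k, l) * cnj ((A ! s) $$ (j, l))) =
        (\<Sum>k<D. \<Sum>l<D. \<Sum>t\<in>spin_words ?d m. (A ! s) $$ (i, k) *
          (?W t * X * mat_adjoint (?W t)) $$ (k, l) * cnj ((A ! s) $$ (j, l)))"
      by (intro sum.cong refl) (simp add: Suc.IH sum_distrib_left sum_distrib_right del: index_mult_mat)
    also have "\<dots> = (\<Sum>k<D. \<Sum>t\<in>spin_words ?d m. \<Sum>l<D. (A ! s) $$ (i, k) *
          (?W t * X * mat_adjoint (?W t)) $$ (k, l) * cnj ((A ! s) $$ (j, l)))"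
      by (rule sum.cong[OF refl], rule sum.swap)
    also have "\<dots> = (\<Sum>t\<in>spin_words ?d m. \<Sum>k<D. \<Sum>l<D. (A ! s) $$ (i, k) *
          (?W t * X * mat_adjoint (?W t)) $$ (k, l) * cnj ((A ! s) $$ (j, l)))"
      by (rule sum.swap)
    also have "\<dots> = (\<Sum>t\<in>spin_words ?d m. (?W (s # t) * X * mat_adjoint (?W (s # t))) $$ (i, j))"
    proof (rule sum.cong[OF refl])
      fix t
      assume "t \<in> spin_words ?d m"
      then have Wt: "?W t \<in> carrier_mat D D" by (rule word_mat_carrier[OF A])
      have c: "?W t * X * mat_adjoint (?W t) \<in> carrier_mat D D"
        using Wt X by (auto intro!: mult_carrier_mat[of _ D D])
      have "?W (s # t) * X * mat_adjoint (?W (s # t)) = A ! s * (?W t * X * mat_adjoint (?W t)) * mat_adjoint (A ! s)"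
        using As Wt X mat_adjoint_carrier[OF As] mat_adjoint_carrier[OF Wt]
        by (simp add: mat_adjoint_mult[OF As Wt] assoc_mult_mat[of _ D D _ D _ D] mult_carrier_mat[of _ D D _ D])
      then show "(\<Sum>k<D. \<Sum>l<D. (A ! s) $$ (i, k) *
          (?W t * X * mat_adjoint (?W t)) $$ (k, l) * cnj ((A ! s) $$ (j, l))) =
          (?W (s # t) * X * mat_adjoint (?W (s # t))) $$ (i, j)"
        using mult_mult_adjoint_index[OF As c Suc.prems] by simp
    qed
    finally show "(\<Sum>k<D. \<Sum>l<D. (A ! s) $$ (i, k) * (transfer D A ^^ m) X $$ (k, l) * cnj ((A ! s) $$ (j, l))) =
      (\<Sum>t\<in>spin_words ?d m. (?W (s # t) * X * mat_adjoint (?W (s # t))) $$ (i, j))" .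
  qed
  finally show ?case by (simp add: sum_spin_words_Suc del: word_mat_simps)
qed

text \<open>Word matrices are the Kraus operators of the power, and a single Kraus operator K
  contributes the product of tr(K X) with its conjugate. This is the bridge from channels to
  amplitudes: X acts as a boundary condition closing a chain of m sites.\<close>

lemma choi_form_transfer_pow:
  assumes A: "set A \<subseteq> carrier_mat D D" and X: "X \<in> carrier_mat D D"
  shows "choi_form D X (transfer D A ^^ m) =
    (\<Sum>t\<in>spin_words (length A) m. of_real ((cmod (mat_trace (X * word_mat D A t)))\<^sup>2))"
proof -
  let ?K = "\<lambda>a b. mat D D (\<lambda>(i, j). X $$ (i, a) * cnj (X $$ (j, b)))"
  let ?W = "word_mat D A"
  have "choi_form D X (transfer D A ^^ m) =
      (\<Sum>a<D. \<Sum>b<D. \<Sum>t\<in>spin_words (length A) m. (?W t * ?K a b * mat_adjoint (?W t)) $$ (a, b))"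
    unfolding choi_form_def by (intro sum.cong refl) (simp add: transfer_pow_index[OF A] del: index_mult_mat)
  also have "\<dots> = (\<Sum>a<D. \<Sum>t\<in>spin_words (length A) m. \<Sum>b<D. (?W t * ?K a b * mat_adjoint (?W t)) $$ (a, b))"
    by (rule sum.cong[OF refl], rule sum.swap)
  also have "\<dots> = (\<Sum>t\<in>spin_words (length A) m. \<Sum>a<D. \<Sum>b<D. (?W t * ?K a b * mat_adjoint (?W t)) $$ (a, b))"
    by (rule sum.swap)
  also have "\<dots> = (\<Sum>t\<in>spin_words (length A) m. of_real ((cmod (mat_trace (X * ?W t)))\<^sup>2))"
  proof (rule sum.cong[OF refl])
    fix t
    assume "t \<in> spin_words (length A) m"
    then have Wt: "?W t \<in> carrier_mat D D" by (rule word_mat_carrier[OF A])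
    define f where "f a = (\<Sum>k<D. ?W t $$ (a, k) * X $$ (k, a))" for a
    have "(\<Sum>a<D. \<Sum>b<D. (?W t * ?K a b * mat_adjoint (?W t)) $$ (a, b)) = (\<Sum>a<D. \<Sum>b<D. f a * cnj (f b))"
    proof (intro sum.cong refl)
      fix a b
      assume ab: "a \<in> {..<D}" "b \<in> {..<D}"
      have "(?W t * ?K a b * mat_adjoint (?W t)) $$ (a, b) =
          (\<Sum>k<D. \<Sum>l<D. ?W t $$ (a, k) * ?K a b $$ (k, l) * cnj (?W t $$ (b, l)))"
        using ab by (intro mult_mult_adjoint_index[OF Wt]) auto
      also have "\<dots> = (\<Sum>k<D. \<Sum>l<D. (?W t $$ (a, k) * X $$ (k, a)) * cnj (?W t $$ (b, l) * X $$ (l, b)))"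
        by (intro sum.cong refl) (simp add: algebra_simps)
      also have "\<dots> = f a * cnj (f b)"
        unfolding f_def cnj_sum sum_product ..
      finally show "(?W t * ?K a b * mat_adjoint (?W t)) $$ (a, b) = f a * cnj (f b)" .
    qed
    also have "\<dots> = (\<Sum>a<D. f a) * cnj (\<Sum>a<D. f a)"
      by (simp add: sum_product cnj_sum)
    also have "\<dots> = of_real ((cmod (\<Sum>a<D. f a))\<^sup>2)"
      by (simp only: complex_norm_square)
    also have "(\<Sum>a<D. f a) = mat_trace (?W t * X)"
      unfolding mat_trace_def f_def using Wt X
      by (auto simp: index_mult_mat_sum[OF Wt X] simp del: index_mult_mat(1) intro!: sum.cong)
    also have "\<dots> = mat_trace (X * ?W t)"
      by (rule mat_trace_mult_comm[OF Wt X])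
    finally show "(\<Sum>a<D. \<Sum>b<D. (?W t * ?K a b * mat_adjoint (?W t)) $$ (a, b)) =
      of_real ((cmod (mat_trace (X * ?W t)))\<^sup>2)" .
  qed
  finally show ?thesis .
qed

section \<open>Matrix representation of linear maps\<close>

definition mat_unit :: "nat \<Rightarrow> nat \<Rightarrow> nat \<Rightarrow> complex mat" where
  "mat_unit D a b = mat D D (\<lambda>(i, j). if i = a \<and> j = b then 1 else 0)"

lemma mat_unit_carrier [simp]: "mat_unit D a b \<in> carrier_mat D D"
  by (simp add: mat_unit_def)

lemma linear_map_add: "linear_map D T \<Longrightarrow> X \<in> carrier_mat D D \<Longrightarrow> Y \<in> carrier_mat D D \<Longrightarrow> T (X + Y) = T X + T Y"
  by (simp add: linear_map_def)

lemma linear_map_smult: "linear_map D T \<Longrightarrow> X \<in> carrier_mat D D \<Longrightarrow> T (c \<cdot>\<^sub>m X) = c \<cdot>\<^sub>m T X"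
  by (simp add: linear_map_def)

lemma linear_map_index:
  assumes T: "linear_map D T" and X: "X \<in> carrier_mat D D" and ij: "i < D" "j < D"
  shows "T X $$ (i, j) = (\<Sum>a<D. \<Sum>b<D. X $$ (a, b) * T (mat_unit D a b) $$ (i, j))"
proof -
  \<comment> \<open>X with the entries outside S erased; the expansion in matrix units is built up
    one position at a time.\<close>
  let ?R = "\<lambda>S. mat D D (\<lambda>ab. if ab \<in> S then X $$ ab else 0)"
  have R: "?R S \<in> carrier_mat D D" for S by simp
  have *: "T (?R S) $$ (i, j) = (\<Sum>(a, b)\<in>S. X $$ (a, b) * T (mat_unit D a b) $$ (i, j))"
    if "finite S" "S \<subseteq> {..<D} \<times> {..<D}" for S
    using that
  proof (induction S)
    case empty
    have "?R {} = 0 \<cdot>\<^sub>m ?R {}" by (rule eq_matI) auto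
    then have "T (?R {}) = 0 \<cdot>\<^sub>m T (?R {})" using linear_map_smult[OF T R] by metis
    then have "T (?R {}) $$ (i, j) = (0 \<cdot>\<^sub>m T (?R {})) $$ (i, j)" by simp
    also have "\<dots> = 0" using linear_map_carrier[OF T R, of "{}"] ij by simp
    finally show ?case by simp
  next
    case (insert ab S)
    obtain a b where ab: "ab = (a, b)" by (cases ab)
    have "?R (insert ab S) = X $$ (a, b) \<cdot>\<^sub>m mat_unit D a b + ?R S"
      using insert by (intro eq_matI) (auto simp: ab mat_unit_def)
    then have "T (?R (insert ab S)) = X $$ (a, b) \<cdot>\<^sub>m T (mat_unit D a b) + T (?R S)"
      by (simp add: linear_map_add[OF T _ R] linear_map_smult[OF T])
    then show ?case
      using insert ij linear_map_carrier[OF T R, of S] linear_map_carrier[OF T mat_unit_carrier, of a b]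
      by (simp add: ab)
  qed
  have "?R ({..<D} \<times> {..<D}) = X"
    using X by (intro eq_matI) auto
  then show ?thesis
    using *[of "{..<D} \<times> {..<D}"] by (simp add: sum.cartesian_product)
qed

text \<open>Row-major vectorisation turns composition of maps into the matrix product, so the
  results on roots of matrices apply to roots of channels.\<close>

definition mat_of_map :: "nat \<Rightarrow> (complex mat \<Rightarrow> complex mat) \<Rightarrow> complex mat" where
  "mat_of_map D T = mat (D * D) (D * D)
    (\<lambda>(r, c). T (mat_unit D (c div D) (c mod D)) $$ (r div D, r mod D))"

lemma mat_of_map_carrier [simp]: "mat_of_map D T \<in> carrier_mat (D * D) (D * D)"
  by (simp add: mat_of_map_def)

lemma mat_of_map_index [simp]:
  "r < D * D \<Longrightarrow> c < D * D \<Longrightarrow>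
    mat_of_map D T $$ (r, c) = T (mat_unit D (c div D) (c mod D)) $$ (r div D, r mod D)"
  by (simp add: mat_of_map_def)

lemma div_mod_less_square: "r < D * D \<Longrightarrow> r div D < D \<and> r mod D < (D :: nat)"
  by (cases "D = 0") (auto simp: less_mult_imp_div_less)

lemma mat_of_map_compose:
  assumes T: "linear_map D T" and S: "linear_map D S"
  shows "mat_of_map D (T \<circ> S) = mat_of_map D T * mat_of_map D S"
proof (rule eq_matI)
  fix r c
  assume "r < dim_row (mat_of_map D T * mat_of_map D S)" "c < dim_col (mat_of_map D T * mat_of_map D S)"
  then have rc: "r < D * D" "c < D * D" by (auto simp: mat_of_map_def)
  have "mat_of_map D (T \<circ> S) $$ (r, c) = (\<Sum>a<D. \<Sum>b<D. S (mat_unit D (c div D) (c mod D)) $$ (a, b) *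
      T (mat_unit D a b) $$ (r div D, r mod D))"
    using rc div_mod_less_square[OF rc(1)]
    by (simp add: linear_map_index[OF T linear_map_carrier[OF S]])
  also have "\<dots> = (\<Sum>k<D * D. S (mat_unit D (c div D) (c mod D)) $$ (k div D, k mod D) *
      T (mat_unit D (k div D) (k mod D)) $$ (r div D, r mod D))"
    by (rule sum_div_mod[symmetric])
  also have "\<dots> = (mat_of_map D T * mat_of_map D S) $$ (r, c)"
    using rc by (subst index_mult_mat_sum[of _ "D * D" "D * D"]) (auto intro!: sum.cong)
  finally show "mat_of_map D (T \<circ> S) $$ (r, c) = (mat_of_map D T * mat_of_map D S) $$ (r, c)" .
qed (auto simp: mat_of_map_def)

lemma linear_map_pow: "linear_map D T \<Longrightarrow> linear_map D (T ^^ n)"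
  by (induction n) (auto simp: linear_map_def)

lemma mat_of_map_pow:
  assumes T: "linear_map D T"
  shows "mat_of_map D (T ^^ n) = mat_of_map D T ^\<^sub>m n"
proof (induction n)
  case 0
  have "mat_of_map D id = 1\<^sub>m (D * D)"
  proof (rule eq_matI)
    fix r c
    assume "r < dim_row (1\<^sub>m (D * D) :: complex mat)" "c < dim_col (1\<^sub>m (D * D) :: complex mat)"
    then have rc: "r < D * D" "c < D * D" by auto
    have "r div D = c div D \<and> r mod D = c mod D \<longleftrightarrow> r = c"
      by (metis div_mult_mod_eq)
    then show "mat_of_map D id $$ (r, c) = 1\<^sub>m (D * D) $$ (r, c)"
      using rc div_mod_less_square by (auto simp: mat_unit_def)
  qed (auto simp: mat_of_map_def)
  then show ?case by (simp add: mat_of_map_def)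
next
  case (Suc n)
  have "mat_of_map D (T ^^ Suc n) = mat_of_map D (T \<circ> T ^^ n)" by simp
  also have "\<dots> = mat_of_map D T * mat_of_map D T ^\<^sub>m n"
    using mat_of_map_compose[OF T linear_map_pow[OF T]] Suc by simp
  also have "\<dots> = mat_of_map D T ^\<^sub>m Suc n"
    by (rule pow_mat_Suc_left[symmetric, of _ "D * D"]) simp
  finally show ?case .
qed

lemma mat_of_map_cong:
  "(\<And>X. X \<in> carrier_mat D D \<Longrightarrow> T X = S X) \<Longrightarrow> mat_of_map D T = mat_of_map D S"
  by (simp add: mat_of_map_def)

lemma mat_trace_mat_of_map: "mat_trace (mat_of_map D T) = choi_form D (1\<^sub>m D) T"
proof -
  have "mat_trace (mat_of_map D T) =
      (\<Sum>r<D * D. T (mat_unit D (r div D) (r mod D)) $$ (r div D, r mod D))"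
    by (auto simp: mat_trace_def mat_of_map_def intro!: sum.cong)
  also have "\<dots> = (\<Sum>a<D. \<Sum>b<D. T (mat_unit D a b) $$ (a, b))"
    by (rule sum_div_mod)
  also have "\<dots> = choi_form D (1\<^sub>m D) T"
    unfolding choi_form_def
  proof (intro sum.cong refl)
    fix a b
    assume "a \<in> {..<D}" "b \<in> {..<D}"
    then have "mat_unit D a b = mat D D (\<lambda>(i, j). 1\<^sub>m D $$ (i, a) * cnj (1\<^sub>m D $$ (j, b)))"
      by (intro eq_matI) (auto simp: mat_unit_def)
    then show "T (mat_unit D a b) $$ (a, b) =
        T (mat D D (\<lambda>(i, j). 1\<^sub>m D $$ (i, a) * cnj (1\<^sub>m D $$ (j, b)))) $$ (a, b)" by simp
  qed
  finally show ?thesis .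
qed

text \<open>For positive m the right side is the squared norm of the m-site state. Through these
  power sums the nonzero spectrum of the transfer map becomes a property of the family.\<close>

lemma mat_trace_mat_of_map_transfer_pow:
  assumes A: "set A \<subseteq> carrier_mat D D"
  shows "mat_trace (mat_of_map D (transfer D A) ^\<^sub>m m) =
    (\<Sum>t\<in>spin_words (length A) m. of_real ((cmod (mat_trace (word_mat D A t)))\<^sup>2))"
proof -
  have "mat_trace (1\<^sub>m D * word_mat D A t) = mat_trace (word_mat D A t)"
    if "t \<in> spin_words (length A) m" for t
    using word_mat_carrier[OF A that] by simp
  then show ?thesis
    unfolding mat_of_map_pow[OF linear_map_transfer[OF A], symmetric] mat_trace_mat_of_map
    by (subst choi_form_transfer_pow[OF A]) (auto intro!: sum.cong)
qed

section \<open>Continuum limits of channels with two nonzero eigenvalues\<close>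

context
  fixes D :: nat and E :: "complex mat \<Rightarrow> complex mat" and c :: real
  assumes lim: "channel_continuum_limit D E" and c: "c \<noteq> 0" "c \<noteq> 1"
    and tr: "\<And>k. k \<ge> 1 \<Longrightarrow> mat_trace (mat_of_map D E ^\<^sub>m k) = 1 + of_real c ^ k"
begin

text \<open>Already with one spin per block the roots R converge to Q, so \<open>choi_form\<close>
  of Q is a limit of nonnegative numbers. Inserting c Q = (1 + c) E - E^2 removes Q and leaves an
  inequality in E alone. The sign of c comes from the traces of R and of R composed with itself,
  which are real because both maps are completely positive.\<close>

lemma continuum_limit_choi_form:
  assumes E: "linear_map D E"
  shows "c > 0"
    and "(1 + c) * Re (choi_form D X E) \<ge> Re (choi_form D X (E ^^ 2))"
proof -
  obtain p R Q where p: "p > 1"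
    and R: "\<And>l. l \<ge> 1 \<Longrightarrow> quantum_channel D (R l)"
    and root: "\<And>l X. l \<ge> 1 \<Longrightarrow> X \<in> carrier_mat D D \<Longrightarrow> (R l ^^ (p ^ l)) X = E X"
    and Q: "linear_map D Q"
    and conv: "\<And>n l X i j. (\<forall>k. n k \<ge> 1 \<and> l k \<ge> 1) \<Longrightarrow> (\<lambda>k. real (n k) / real p ^ l k) \<longlonglongrightarrow> 0 \<Longrightarrow>
      X \<in> carrier_mat D D \<Longrightarrow> i < D \<Longrightarrow> j < D \<Longrightarrow> (\<lambda>k. (R (l k) ^^ n k) X $$ (i, j)) \<longlonglongrightarrow> Q X $$ (i, j)"
    using lim unfolding channel_continuum_limit_def by blast
  \<comment> \<open>The shift by one is needed because \<open>R l\<close> is constrained only for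
    positive l.\<close>
  define S where "S l = mat_of_map D (R (Suc l))" for l
  define M where "M = mat_of_map D E"
  define q where "q l = p ^ Suc l" for l
  have R_cp: "completely_positive D (R (Suc l))" for l
    using R[of "Suc l"] by (simp add: quantum_channel_def)
  then have R_lin: "linear_map D (R (Suc l))" for l
    by (simp add: completely_positive_def)
  \<comment> \<open>A constant number n of blocked spins is admissible since p^l grows; these are
    the only sequences from the definition that the argument needs.\<close>
  have conv': "(\<lambda>l. (R (Suc l) ^^ n) X $$ (i, j)) \<longlonglongrightarrow> Q X $$ (i, j)"
    if "n \<ge> 1" "X \<in> carrier_mat D D" "i < D" "j < D" for n X i j
  proof (rule conv[of "\<lambda>_. n" Suc])
    have "(\<lambda>k. real n / real p ^ Suc k) = (\<lambda>k. real n * inverse (real p) ^ Suc k)"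
      by (simp add: field_simps)
    also have "\<dots> \<longlonglongrightarrow> real n * 0"
      using p by (intro tendsto_intros LIMSEQ_Suc LIMSEQ_power_zero) (auto simp: field_simps)
    finally show "(\<lambda>k. real n / real p ^ Suc k) \<longlonglongrightarrow> 0" by simp
  qed (use that in auto)
  have S: "S l \<in> carrier_mat (D * D) (D * D)" for l by (simp add: S_def)
  have M: "M \<in> carrier_mat (D * D) (D * D)" by (simp add: M_def)
  have S_root: "S l ^\<^sub>m q l = M" for l
    unfolding S_def M_def q_def mat_of_map_pow[OF R_lin, symmetric]
    by (rule mat_of_map_cong, rule root) auto
  have q: "filterlim q at_top sequentially"
  proof (rule filterlim_at_top_mono[OF filterlim_ident])
    show "\<forall>\<^sub>F l in sequentially. l \<le> q l"
      unfolding q_def using p less_exp by (intro always_eventually allI)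
        (metis One_nat_def less_imp_le_nat less_or_eq_imp_le n_less_n_mult_m nat_less_le power_gt_expt Suc_leD)
  qed
  have S_lim: "(\<lambda>l. (S l ^\<^sub>m n) $$ (r, s)) \<longlonglongrightarrow> mat_of_map D Q $$ (r, s)"
    if "n \<ge> 1" "r < D * D" "s < D * D" for n r s
    unfolding S_def mat_of_map_pow[OF R_lin, symmetric] using that
    by (auto intro!: conv' simp: div_mod_less_square)
  have c': "complex_of_real c \<noteq> 0" "complex_of_real c \<noteq> 1" using c by auto
  have tr': "\<And>k. k \<ge> 1 \<Longrightarrow> mat_trace (M ^\<^sub>m k) = 1 + complex_of_real c ^ k"
    using tr by (simp add: M_def)
  have real: "mat_trace (mat_of_map D T) \<in> \<real>" if "completely_positive D T" for T
    using choi_form_nonneg[OF that, of "1\<^sub>m D"]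
    by (simp add: mat_trace_mat_of_map less_eq_complex_def complex_is_Real_iff)
  have "mat_trace (S l) \<in> \<real>" for l
    unfolding S_def by (rule real[OF R_cp])
  moreover have "mat_trace (S l ^\<^sub>m 2) \<in> \<real>" for l
    unfolding S_def mat_of_map_pow[OF R_lin, symmetric]
    using real[OF completely_positive_compose[OF R_cp R_cp]] by (simp add: numeral_2_eq_2)
  ultimately show "c > 0"
    using subdominant_eigenvalue_not_negative[OF M c' tr' S S_root q S_lim] c by force
  have entry: "of_real c * mat_of_map D Q $$ (r, s) =
      (1 + of_real c) * M $$ (r, s) - (M * M) $$ (r, s)" if "r < D * D" "s < D * D" for r s
    using limit_is_spectral_projection[OF M c' tr' S S_root q S_lim that] .
  have M2: "M * M = mat_of_map D (E ^^ 2)"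
    unfolding M_def mat_of_map_pow[OF E] by (simp add: numeral_2_eq_2)
  have unit: "of_real c * Q (mat_unit D a b) $$ (i, j) =
      (1 + of_real c) * E (mat_unit D a b) $$ (i, j) - (E ^^ 2) (mat_unit D a b) $$ (i, j)"
    if "a < D" "b < D" "i < D" "j < D" for a b i j
    using entry[of "i * D + j" "a * D + b"] that
    unfolding M2 unfolding M_def by (simp add: block_index_less del: funpow.simps)
  have Q_eq: "of_real c * Q X $$ (i, j) = (1 + of_real c) * E X $$ (i, j) - (E ^^ 2) X $$ (i, j)"
    if "X \<in> carrier_mat D D" "i < D" "j < D" for X i j
  proof -
    have "of_real c * Q X $$ (i, j) =
        (\<Sum>a<D. \<Sum>b<D. X $$ (a, b) * (of_real c * Q (mat_unit D a b) $$ (i, j)))"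
      by (simp add: linear_map_index[OF Q that] sum_distrib_left mult.left_commute)
    also have "\<dots> = (\<Sum>a<D. \<Sum>b<D. (1 + of_real c) * (X $$ (a, b) * E (mat_unit D a b) $$ (i, j)) -
        X $$ (a, b) * (E ^^ 2) (mat_unit D a b) $$ (i, j))"
      using that by (intro sum.cong refl) (simp add: unit algebra_simps)
    also have "\<dots> = (1 + of_real c) * E X $$ (i, j) - (E ^^ 2) X $$ (i, j)"
      by (simp add: linear_map_index[OF E that] linear_map_index[OF linear_map_pow[OF E] that]
          sum_subtractf sum_distrib_left del: funpow.simps)
    finally show ?thesis .
  qed
  let ?K = "\<lambda>a b. mat D D (\<lambda>(i, j). X $$ (i, a) * cnj (X $$ (j, b)))"
  have "of_real c * choi_form D X Q = (\<Sum>a<D. \<Sum>b<D. of_real c * Q (?K a b) $$ (a, b))"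
    by (simp add: choi_form_def sum_distrib_left)
  also have "\<dots> = (\<Sum>a<D. \<Sum>b<D. (1 + of_real c) * E (?K a b) $$ (a, b) - (E ^^ 2) (?K a b) $$ (a, b))"
    by (intro sum.cong refl Q_eq) auto
  also have "\<dots> = (1 + of_real c) * choi_form D X E - choi_form D X (E ^^ 2)"
    by (simp add: choi_form_def sum_subtractf sum_distrib_left del: funpow.simps)
  finally have Q_form: "of_real c * choi_form D X Q = (1 + of_real c) * choi_form D X E - choi_form D X (E ^^ 2)" .
  have "(\<lambda>l. choi_form D X (R (Suc l))) \<longlonglongrightarrow> choi_form D X Q"
    unfolding choi_form_def using conv'[of 1] by (intro tendsto_sum) simp
  then have "(\<lambda>l. Re (choi_form D X (R (Suc l)))) \<longlonglongrightarrow> Re (choi_form D X Q)"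
    by (rule tendsto_Re)
  moreover have "0 \<le> Re (choi_form D X (R (Suc l)))" for l
    using choi_form_nonneg[OF R_cp] by (simp add: less_eq_complex_def)
  ultimately have "0 \<le> Re (choi_form D X Q)"
    using LIMSEQ_le_const by blast
  then have "0 \<le> c * Re (choi_form D X Q)" using \<open>c > 0\<close> by simp
  also have "\<dots> = (1 + c) * Re (choi_form D X E) - Re (choi_form D X (E ^^ 2))"
    using arg_cong[OF Q_form, of Re] by (simp del: funpow.simps)
  finally show "(1 + c) * Re (choi_form D X E) \<ge> Re (choi_form D X (E ^^ 2))" by simp
qed

end

section \<open>Refinements\<close>

lemma segment_prod_append:
  assumes "length I = n"
  shows "(\<Prod>k<Suc m. W (take n (drop (k * n) (I @ w))) ((j # t) ! k)) =
    W I j * (\<Prod>k<m. W (take n (drop (k * n) w)) (t ! k) :: complex)"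
  using assms by (simp add: prod.lessThan_Suc_shift del: prod.lessThan_Suc)

lemma tensor_power_apply_append:
  assumes "length I = n"
  shows "tensor_power_apply n (Suc m) W d' v (I @ w) =
    (\<Sum>j<d'. W I j * tensor_power_apply n m W d' (\<lambda>t. v (j # t)) w)"
  unfolding tensor_power_apply_def sum_spin_words_Suc segment_prod_append[OF assms]
  by (simp add: sum_distrib_left mult.assoc)

lemma spin_words_mult_Suc_cases:
  assumes "w \<in> spin_words d (n * Suc m)"
  obtains I w' where "w = I @ w'" "I \<in> spin_words d n" "w' \<in> spin_words d (n * m)"
proof
  show "w = take n w @ drop n w" by simp
  show "take n w \<in> spin_words d n" "drop n w \<in> spin_words d (n * m)"
    using assms set_take_subset[of n w] set_drop_subset[of n w] by (auto simp: spin_words_def)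
qed

text \<open>A condition on a single block of n sites suffices. The induction over blocks runs on all
  matrix entries, because amplitudes, being traces, do not multiply.\<close>

lemma is_refinementI:
  assumes A: "set A \<subseteq> carrier_mat D D" and B: "set B \<subseteq> carrier_mat D D"
    and n: "n \<ge> 1" and W: "is_isometry n (length A) (length B) W"
    and expand: "\<And>I a b. I \<in> spin_words (length A) n \<Longrightarrow> a < D \<Longrightarrow> b < D \<Longrightarrow>
      word_mat D A I $$ (a, b) = (\<Sum>j<length B. W I j * (B ! j) $$ (a, b))"
  shows "is_refinement n (mps D A) (mps D B)"
proof -
  let ?d = "length A" and ?d' = "length B"
  have entries: "word_mat D A w $$ (a, b) = tensor_power_apply n m W ?d' (\<lambda>u. word_mat D B u $$ (a, b)) w"
    if "w \<in> spin_words ?d (n * m)" "a < D" "b < D" for w m a b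
    using that
  proof (induction m arbitrary: w a b)
    case 0
    then show ?case by (simp add: tensor_power_apply_def)
  next
    case (Suc m)
    from spin_words_mult_Suc_cases[OF Suc.prems(1)] obtain I w' where
      w: "w = I @ w'" and I: "I \<in> spin_words ?d n" and w': "w' \<in> spin_words ?d (n * m)" .
    have len: "length I = n" using I by (simp add: spin_words_def)
    note WA = word_mat_carrier[OF A I] word_mat_carrier[OF A w']
    have "word_mat D A w $$ (a, b) = (\<Sum>c<D. word_mat D A I $$ (a, c) * word_mat D A w' $$ (c, b))"
      unfolding w word_mat_append[OF A I w'] using WA Suc.prems by (intro index_mult_mat_sum)
    also have "\<dots> = (\<Sum>c<D. \<Sum>j<?d'. W I j * ((B ! j) $$ (a, c) *
        tensor_power_apply n m W ?d' (\<lambda>u. word_mat D B u $$ (c, b)) w'))"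
      using Suc.prems by (simp add: expand[OF I] Suc.IH[OF w'] sum_distrib_right mult.assoc)
    also have "\<dots> = (\<Sum>j<?d'. W I j * (\<Sum>c<D. (B ! j) $$ (a, c) *
        tensor_power_apply n m W ?d' (\<lambda>u. word_mat D B u $$ (c, b)) w'))"
      by (subst sum.swap) (simp add: sum_distrib_left)
    also have "\<dots> = (\<Sum>j<?d'. W I j * tensor_power_apply n m W ?d' (\<lambda>u. word_mat D B (j # u) $$ (a, b)) w')"
    proof (intro sum.cong refl arg_cong2[where f = "(*)"])
      fix j
      assume "j \<in> {..<?d'}"
      then have Bj: "B ! j \<in> carrier_mat D D" using B by auto
      have "(\<Sum>c<D. (B ! j) $$ (a, c) * tensor_power_apply n m W ?d' (\<lambda>u. word_mat D B u $$ (c, b)) w') =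
          (\<Sum>u\<in>spin_words ?d' m. \<Sum>c<D. (\<Prod>k<m. W (take n (drop (k * n) w')) (u ! k)) *
            ((B ! j) $$ (a, c) * word_mat D B u $$ (c, b)))"
        unfolding tensor_power_apply_def sum_distrib_left by (subst sum.swap) (simp add: mult_ac)
      also have "\<dots> = tensor_power_apply n m W ?d' (\<lambda>u. word_mat D B (j # u) $$ (a, b)) w'"
        unfolding tensor_power_apply_def word_mat_simps
      proof (rule sum.cong[OF refl])
        fix u
        assume "u \<in> spin_words ?d' m"
        then show "(\<Sum>c<D. (\<Prod>k<m. W (take n (drop (k * n) w')) (u ! k)) *
            ((B ! j) $$ (a, c) * word_mat D B u $$ (c, b))) =
            (\<Prod>k<m. W (take n (drop (k * n) w')) (u ! k)) * (B ! j * word_mat D B u) $$ (a, b)"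
          using Suc.prems by (subst index_mult_mat_sum[OF Bj word_mat_carrier[OF B]])
            (auto simp: sum_distrib_left)
      qed
      finally show "(\<Sum>c<D. (B ! j) $$ (a, c) *
          tensor_power_apply n m W ?d' (\<lambda>u. word_mat D B u $$ (c, b)) w') =
          tensor_power_apply n m W ?d' (\<lambda>u. word_mat D B (j # u) $$ (a, b)) w'" .
    qed
    also have "\<dots> = tensor_power_apply n (Suc m) W ?d' (\<lambda>u. word_mat D B u $$ (a, b)) w"
      unfolding w by (rule tensor_power_apply_append[OF len, symmetric])
    finally show ?case .
  qed
  have "snd (mps D A) (n * N) w = tensor_power_apply n N W ?d' (snd (mps D B) N) w"
    if N: "N \<ge> 1" and w: "w \<in> spin_words ?d (n * N)" for N w
  proof -
    have "n * N \<ge> 1" using n N by simp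
    then have "snd (mps D A) (n * N) w = (\<Sum>a<D. word_mat D A w $$ (a, a))"
      using word_mat_carrier[OF A w] by (simp add: snd_mps[OF _ w] mat_trace_def)
    also have "\<dots> = (\<Sum>a<D. tensor_power_apply n N W ?d' (\<lambda>u. word_mat D B u $$ (a, a)) w)"
      using entries[OF w] by simp
    also have "\<dots> = tensor_power_apply n N W ?d' (\<lambda>u. \<Sum>a<D. word_mat D B u $$ (a, a)) w"
      unfolding tensor_power_apply_def sum_distrib_left by (rule sum.swap)
    also have "\<dots> = tensor_power_apply n N W ?d' (snd (mps D B) N) w"
      unfolding tensor_power_apply_def
    proof (rule sum.cong[OF refl])
      fix u
      assume u: "u \<in> spin_words ?d' N"
      show "(\<Prod>k<N. W (take n (drop (k * n) w)) (u ! k)) * (\<Sum>a<D. word_mat D B u $$ (a, a)) =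
          (\<Prod>k<N. W (take n (drop (k * n) w)) (u ! k)) * snd (mps D B) N u"
        using word_mat_carrier[OF B u] by (simp add: snd_mps[OF N u] mat_trace_def)
    qed
    finally show ?thesis .
  qed
  then show ?thesis
    unfolding is_refinement_def using W by auto
qed

text \<open>Blocking merely renames n-letter words as letters, so W is a permutation matrix.\<close>

lemma is_refinement_coding:
  assumes A: "set A \<subseteq> carrier_mat D D" and n: "n \<ge> 1"
    and code: "bij_betw code {..<length B} (spin_words (length A) n)"
    and B: "\<And>j. j < length B \<Longrightarrow> B ! j = word_mat D A (code j)"
  shows "is_refinement n (mps D A) (mps D B)"
proof (rule is_refinementI[OF A _ n])
  have inj: "code i = code j \<longleftrightarrow> i = j" if "i < length B" "j < length B" for i j
    using code that by (auto simp: bij_betw_def inj_on_def)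
  have mem: "code j \<in> spin_words (length A) n" if "j < length B" for j
    using code that by (auto simp: bij_betw_def)
  show "set B \<subseteq> carrier_mat D D"
    using B mem word_mat_carrier[OF A] by (fastforce simp: in_set_conv_nth)
  show "is_isometry n (length A) (length B) (\<lambda>I j. if I = code j then 1 else 0)"
    unfolding is_isometry_def
  proof (intro allI impI)
    fix j j'
    assume jj: "j < length B" "j' < length B"
    have "(\<Sum>I\<in>spin_words (length A) n. cnj (if I = code j then 1 else 0) * (if I = code j' then 1 else 0)) =
        (\<Sum>I\<in>spin_words (length A) n. if I = code j then if j = j' then 1 else 0 else 0 :: complex)"
      using inj[OF jj] by (intro sum.cong) auto
    also have "\<dots> = (if j = j' then 1 else 0)"
      using mem jj by simp
    finally show "(\<Sum>I\<in>spin_words (length A) n. cnj (if I = code j then 1 else 0) *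
      (if I = code j' then 1 else 0 :: complex)) = (if j = j' then 1 else 0)" .
  qed
  fix I a b
  assume I: "I \<in> spin_words (length A) n"
  then obtain i where i: "i < length B" "I = code i"
    using code by (auto simp: bij_betw_def)
  have "(\<Sum>j<length B. (if I = code j then 1 else 0) * (B ! j) $$ (a, b)) =
      (\<Sum>j<length B. if j = i then (B ! i) $$ (a, b) else 0)"
    using inj i by (intro sum.cong) auto
  then show "word_mat D A I $$ (a, b) = (\<Sum>j<length B. (if I = code j then 1 else 0) * (B ! j) $$ (a, b))"
    using i B by simp
qed

lemma transfer_coding:
  assumes A: "set A \<subseteq> carrier_mat D D"
    and code: "bij_betw code {..<length B} (spin_words (length A) n)"
    and B: "\<And>j. j < length B \<Longrightarrow> B ! j = word_mat D A (code j)"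
    and X: "X \<in> carrier_mat D D"
  shows "transfer D B X = (transfer D A ^^ n) X"
proof -
  have mem: "code j \<in> spin_words (length A) n" if "j < length B" for j
    using code that by (auto simp: bij_betw_def)
  have BC: "set B \<subseteq> carrier_mat D D"
    using B mem word_mat_carrier[OF A] by (fastforce simp: in_set_conv_nth)
  have "transfer D B X $$ (i, j) = (transfer D A ^^ n) X $$ (i, j)" if "i < D" "j < D" for i j
    unfolding transfer_index[OF BC X that] transfer_pow_index[OF A X that]
    by (subst sum.reindex_bij_betw[OF code, symmetric]) (simp add: B)
  then show ?thesis
    using transfer_carrier[OF BC X] transfer_pow_carrier[OF A X, of n] by (intro eq_matI) auto
qed

lemma bij_betw_singleton_words: "bij_betw (\<lambda>j. [j]) {..<d} (spin_words d 1)"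
  by (auto simp: bij_betw_def inj_on_def spin_words_Suc image_iff)

lemma bij_betw_pair_words: "bij_betw (\<lambda>k. [k div d, k mod d]) {..<d * d} (spin_words d 2)"
proof (rule bij_betw_byWitness[where f' = "\<lambda>w. w ! 0 * d + w ! 1"])
  show "\<forall>w\<in>spin_words d 2. [(w ! 0 * d + w ! 1) div d, (w ! 0 * d + w ! 1) mod d] = w"
    by (auto simp: spin_words_Suc numeral_2_eq_2)
  show "(\<lambda>k. [k div d, k mod d]) ` {..<d * d} \<subseteq> spin_words d 2"
    using div_mod_less_square by (fastforce simp: spin_words_def)
  show "(\<lambda>w. w ! 0 * d + w ! 1) ` spin_words d 2 \<subseteq> {..<d * d}"
    using block_index_less by (fastforce simp: spin_words_Suc numeral_2_eq_2)
qed auto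

text \<open>Besides embedding one class in the other, this lets bounds proved for refinements apply
  to two tensors that generate the same family.\<close>

lemma is_refinement_refl:
  assumes A: "set A \<subseteq> carrier_mat D D"
  shows "is_refinement 1 (mps D A) (mps D A)"
proof (rule is_refinement_coding[OF A _ bij_betw_singleton_words])
  show "A ! j = word_mat D A [j]" if "j < length A" for j
    using A that by (auto intro!: right_mult_one_mat[symmetric])
qed simp

section \<open>Numbers that a refinement preserves\<close>

lemma isometry_preserves_norm:
  assumes W: "is_isometry n d d' W"
  shows "(\<Sum>I\<in>spin_words d n. (\<Sum>j<d'. W I j * a j) * cnj (\<Sum>j<d'. W I j * a j)) = (\<Sum>j<d'. a j * cnj (a j))"
proof -
  have "(\<Sum>I\<in>spin_words d n. (\<Sum>j<d'. W I j * a j) * cnj (\<Sum>j<d'. W I j * a j)) =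
      (\<Sum>I\<in>spin_words d n. \<Sum>j<d'. \<Sum>j'<d'. (cnj (W I j') * W I j) * (a j * cnj (a j')))"
    unfolding cnj_sum sum_product by (simp add: mult_ac)
  also have "\<dots> = (\<Sum>j<d'. \<Sum>I\<in>spin_words d n. \<Sum>j'<d'. (cnj (W I j') * W I j) * (a j * cnj (a j')))"
    by (rule sum.swap)
  also have "\<dots> = (\<Sum>j<d'. \<Sum>j'<d'. (\<Sum>I\<in>spin_words d n. cnj (W I j') * W I j) * (a j * cnj (a j')))"
    unfolding sum_distrib_right by (rule sum.cong[OF refl], rule sum.swap)
  also have "\<dots> = (\<Sum>j<d'. \<Sum>j'<d'. if j' = j then a j * cnj (a j) else 0)"
    using W unfolding is_isometry_def by (intro sum.cong refl) auto
  also have "\<dots> = (\<Sum>j<d'. a j * cnj (a j))"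
    by simp
  finally show ?thesis .
qed

lemma tensor_power_preserves_norm:
  assumes W: "is_isometry n d d' W"
  shows "(\<Sum>w\<in>spin_words d (n * m). tensor_power_apply n m W d' v w * cnj (tensor_power_apply n m W d' v w)) =
    (\<Sum>t\<in>spin_words d' m. v t * cnj (v t))"
proof (induction m arbitrary: v)
  case 0
  then show ?case by (simp add: tensor_power_apply_def)
next
  case (Suc m)
  let ?a = "\<lambda>w j. tensor_power_apply n m W d' (\<lambda>t. v (j # t)) w"
  have "(\<Sum>w\<in>spin_words d (n * Suc m). tensor_power_apply n (Suc m) W d' v w * cnj (tensor_power_apply n (Suc m) W d' v w)) =
      (\<Sum>I\<in>spin_words d n. \<Sum>w\<in>spin_words d (n * m). (\<Sum>j<d'. W I j * ?a w j) * cnj (\<Sum>j<d'. W I j * ?a w j))"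
    unfolding mult_Suc_right sum_spin_words_add
    by (intro sum.cong refl) (auto simp: tensor_power_apply_append spin_words_def)
  also have "\<dots> = (\<Sum>w\<in>spin_words d (n * m). \<Sum>I\<in>spin_words d n. (\<Sum>j<d'. W I j * ?a w j) * cnj (\<Sum>j<d'. W I j * ?a w j))"
    by (rule sum.swap)
  also have "\<dots> = (\<Sum>w\<in>spin_words d (n * m). \<Sum>j<d'. ?a w j * cnj (?a w j))"
    unfolding isometry_preserves_norm[OF W] ..
  also have "\<dots> = (\<Sum>j<d'. \<Sum>w\<in>spin_words d (n * m). ?a w j * cnj (?a w j))"
    by (rule sum.swap)
  also have "\<dots> = (\<Sum>t\<in>spin_words d' (Suc m). v t * cnj (v t))"
    unfolding Suc.IH sum_spin_words_Suc ..
  finally show ?case .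
qed

text \<open>For X of this form, tr(X K) with K an m-letter word matrix is a contraction of the first
  n sites of an (n + m)-site state. Such boundary conditions belong to the family, not to a choice
  of tensor.\<close>

definition word_comb :: "nat \<Rightarrow> tensor \<Rightarrow> nat \<Rightarrow> (nat list \<Rightarrow> complex) \<Rightarrow> complex mat" where
  "word_comb D A n y = mat D D (\<lambda>ab. \<Sum>I\<in>spin_words (length A) n. y I * word_mat D A I $$ ab)"

lemma word_comb_carrier [simp]: "word_comb D A n y \<in> carrier_mat D D"
  by (simp add: word_comb_def)

lemma choi_form_word_comb:
  fixes y :: "nat list \<Rightarrow> complex"
  assumes A: "set A \<subseteq> carrier_mat D D" and n: "n \<ge> 1"
  defines "f \<equiv> (\<lambda>w. \<Sum>I\<in>spin_words (length A) n. y I * snd (mps D A) (length (I @ w)) (I @ w))"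
  shows "choi_form D (word_comb D A n y) (transfer D A ^^ m) =
    (\<Sum>w\<in>spin_words (length A) m. f w * cnj (f w))"
  unfolding choi_form_transfer_pow[OF A word_comb_carrier]
proof (rule sum.cong[OF refl])
  fix w
  assume w: "w \<in> spin_words (length A) m"
  note Ww = word_mat_carrier[OF A w]
  have "mat_trace (word_comb D A n y * word_mat D A w) =
      (\<Sum>a<D. \<Sum>b<D. \<Sum>I\<in>spin_words (length A) n. y I * (word_mat D A I $$ (a, b) * word_mat D A w $$ (b, a)))"
  proof -
    have "mat_trace (word_comb D A n y * word_mat D A w) =
        (\<Sum>a<D. \<Sum>b<D. word_comb D A n y $$ (a, b) * word_mat D A w $$ (b, a))"
      unfolding mat_trace_def
      by (intro sum.cong index_mult_mat_sum[OF word_comb_carrier Ww]) (auto simp: word_comb_def)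
    then show ?thesis
      by (simp add: word_comb_def sum_distrib_right mult.assoc)
  qed
  also have "\<dots> = (\<Sum>I\<in>spin_words (length A) n. y I * (\<Sum>a<D. \<Sum>b<D. word_mat D A I $$ (a, b) * word_mat D A w $$ (b, a)))"
    unfolding sum_distrib_left
    by (rule trans[OF sum.cong[OF refl sum.swap] sum.swap])
  also have "\<dots> = f w"
    unfolding f_def
  proof (intro sum.cong refl arg_cong2[where f = "(*)"])
    fix I
    assume I: "I \<in> spin_words (length A) n"
    have "length (I @ w) = n + m" using I w by (simp add: spin_words_def)
    then have "snd (mps D A) (length (I @ w)) (I @ w) = mat_trace (word_mat D A I * word_mat D A w)"
      using n spin_words_append[OF I w] by (simp add: snd_mps word_mat_append[OF A I w])
    then show "(\<Sum>a<D. \<Sum>b<D. word_mat D A I $$ (a, b) * word_mat D A w $$ (b, a)) =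
        snd (mps D A) (length (I @ w)) (I @ w)"
      using word_mat_carrier[OF A I] Ww
      by (simp add: mat_trace_def index_mult_mat_sum[OF word_mat_carrier[OF A I] Ww] del: index_mult_mat(1))
  qed
  finally show "of_real ((cmod (mat_trace (word_comb D A n y * word_mat D A w)))\<^sup>2) = f w * cnj (f w)"
    by (simp only: complex_norm_square)
qed

text \<open>Contracting the first block of A with y amounts to contracting the first site of B with
  the pullback of y along W; on the other m blocks the isometry preserves norms. The same X serves
  every m, so an inequality between different powers for B carries over to A.\<close>

lemma is_refinement_choi_form:
  assumes A: "set A \<subseteq> carrier_mat D D" and B: "set B \<subseteq> carrier_mat D' D'" and n: "n \<ge> 1"
    and ref: "is_refinement n (mps D A) (mps D' B)"
  obtains X where "X \<in> carrier_mat D' D'"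
    "\<And>m. choi_form D (word_comb D A n y) (transfer D A ^^ (n * m)) = choi_form D' X (transfer D' B ^^ m)"
proof -
  let ?d = "length A" and ?d' = "length B"
  obtain W where W: "is_isometry n ?d ?d' W"
    and V: "\<And>N w. N \<ge> 1 \<Longrightarrow> w \<in> spin_words ?d (n * N) \<Longrightarrow>
      snd (mps D A) (n * N) w = tensor_power_apply n N W ?d' (snd (mps D' B) N) w"
    using ref unfolding is_refinement_def by auto
  \<comment> \<open>The transpose of W applied to y, indexed by one-letter words to fit
    \<open>word_comb\<close>.\<close>
  define x where "x j = (\<Sum>I\<in>spin_words ?d n. y I * W I (hd j))" for j :: "nat list"
  define g where "g t = (\<Sum>j\<in>spin_words ?d' 1. x j * snd (mps D' B) (length (j @ t)) (j @ t))" for t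
  have f_eq: "(\<Sum>I\<in>spin_words ?d n. y I * snd (mps D A) (length (I @ w)) (I @ w)) = tensor_power_apply n m W ?d' g w"
    if w: "w \<in> spin_words ?d (n * m)" for w m
  proof -
    have "(\<Sum>I\<in>spin_words ?d n. y I * snd (mps D A) (length (I @ w)) (I @ w)) =
        (\<Sum>I\<in>spin_words ?d n. \<Sum>j<?d'. y I * W I j * tensor_power_apply n m W ?d' (\<lambda>t. snd (mps D' B) (Suc m) (j # t)) w)"
    proof (rule sum.cong[OF refl])
      fix I
      assume I: "I \<in> spin_words ?d n"
      have len: "length I = n" "length (I @ w) = n * Suc m" using I w by (auto simp: spin_words_def)
      have "snd (mps D A) (n * Suc m) (I @ w) =
          tensor_power_apply n (Suc m) W ?d' (snd (mps D' B) (Suc m)) (I @ w)"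
        using spin_words_append[OF I w] by (intro V) auto
      then show "y I * snd (mps D A) (length (I @ w)) (I @ w) =
          (\<Sum>j<?d'. y I * W I j * tensor_power_apply n m W ?d' (\<lambda>t. snd (mps D' B) (Suc m) (j # t)) w)"
        unfolding len(2) by (simp add: tensor_power_apply_append[OF len(1)] sum_distrib_left mult.assoc)
    qed
    also have "\<dots> = (\<Sum>j<?d'. x [j] * tensor_power_apply n m W ?d' (\<lambda>t. snd (mps D' B) (Suc m) (j # t)) w)"
      unfolding x_def sum_distrib_right by (subst sum.swap) simp
    also have "\<dots> = (\<Sum>t\<in>spin_words ?d' m. (\<Prod>k<m. W (take n (drop (k * n) w)) (t ! k)) *
        (\<Sum>j<?d'. x [j] * snd (mps D' B) (Suc m) (j # t)))"
      unfolding tensor_power_apply_def sum_distrib_left by (subst sum.swap) (simp add: mult_ac)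
    also have "\<dots> = tensor_power_apply n m W ?d' g w"
      unfolding tensor_power_apply_def
    proof (intro sum.cong refl arg_cong2[where f = "(*)"])
      fix t
      assume "t \<in> spin_words ?d' m"
      then have "length t = m" by (simp add: spin_words_def)
      then show "(\<Sum>j<?d'. x [j] * snd (mps D' B) (Suc m) (j # t)) = g t"
        by (simp add: g_def sum_spin_words_Suc)
    qed
    finally show ?thesis .
  qed
  show ?thesis
  proof (rule that)
    show "word_comb D' B 1 x \<in> carrier_mat D' D'" by simp
    fix m
    have "choi_form D (word_comb D A n y) (transfer D A ^^ (n * m)) =
        (\<Sum>w\<in>spin_words ?d (n * m). tensor_power_apply n m W ?d' g w * cnj (tensor_power_apply n m W ?d' g w))"
      unfolding choi_form_word_comb[OF A n] by (intro sum.cong refl) (simp only: f_eq)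
    also have "\<dots> = choi_form D' (word_comb D' B 1 x) (transfer D' B ^^ m)"
      unfolding tensor_power_preserves_norm[OF W] choi_form_word_comb[OF B order_refl] g_def ..
    finally show "choi_form D (word_comb D A n y) (transfer D A ^^ (n * m)) =
        choi_form D' (word_comb D' B 1 x) (transfer D' B ^^ m)" .
  qed
qed

lemma is_refinement_trace:
  assumes A: "set A \<subseteq> carrier_mat D D" and B: "set B \<subseteq> carrier_mat D' D'" and n: "n \<ge> 1"
    and ref: "is_refinement n (mps D A) (mps D' B)" and m: "m \<ge> 1"
  shows "mat_trace (mat_of_map D' (transfer D' B) ^\<^sub>m m) = mat_trace (mat_of_map D (transfer D A) ^\<^sub>m (n * m))"
proof -
  let ?d = "length A" and ?d' = "length B"
  obtain W where W: "is_isometry n ?d ?d' W"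
    and V: "\<And>N w. N \<ge> 1 \<Longrightarrow> w \<in> spin_words ?d (n * N) \<Longrightarrow>
      snd (mps D A) (n * N) w = tensor_power_apply n N W ?d' (snd (mps D' B) N) w"
    using ref unfolding is_refinement_def by auto
  have norm: "mat_trace (mat_of_map D (transfer D A) ^\<^sub>m k) =
      (\<Sum>t\<in>spin_words (length A) k. snd (mps D A) k t * cnj (snd (mps D A) k t))"
    if "set A \<subseteq> carrier_mat D D" "k \<ge> 1" for D A k
    unfolding mat_trace_mat_of_map_transfer_pow[OF that(1)]
    by (intro sum.cong refl) (simp only: snd_mps[OF that(2)] complex_norm_square)
  have nm: "n * m \<ge> 1" using n m by simp
  have "mat_trace (mat_of_map D (transfer D A) ^\<^sub>m (n * m)) =
      (\<Sum>w\<in>spin_words ?d (n * m). tensor_power_apply n m W ?d' (snd (mps D' B) m) w *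
        cnj (tensor_power_apply n m W ?d' (snd (mps D' B) m) w))"
    unfolding norm[OF A nm] by (intro sum.cong refl) (simp add: V[OF m])
  also have "\<dots> = mat_trace (mat_of_map D' (transfer D' B) ^\<^sub>m m)"
    unfolding tensor_power_preserves_norm[OF W] norm[OF B m] ..
  finally show ?thesis ..
qed

text \<open>Equality of norms gives the transfer map of B the nonzero eigenvalues 1 and c^n whatever
  its bond dimension is. The first and second powers compared for B become the powers n and 2 n for
  A.\<close>

lemma coarse_continuum_limit_bounds:
  assumes A: "set A \<subseteq> carrier_mat D D" and B: "set B \<subseteq> carrier_mat D' D'" and n: "n \<ge> 1"
    and ref: "is_refinement n (mps D A) (mps D' B)"
    and lim: "channel_continuum_limit D' (transfer D' B)"
    and tr: "\<And>k. k \<ge> 1 \<Longrightarrow> mat_trace (mat_of_map D (transfer D A) ^\<^sub>m k) = 1 + of_real c ^ k"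
    and c: "c \<noteq> 0" "\<bar>c\<bar> < 1"
  shows "c ^ n > 0"
    and "(1 + c ^ n) * Re (choi_form D (word_comb D A n y) (transfer D A ^^ n)) \<ge>
      Re (choi_form D (word_comb D A n y) (transfer D A ^^ (n * 2)))"
proof -
  have tr': "mat_trace (mat_of_map D' (transfer D' B) ^\<^sub>m k) = 1 + of_real (c ^ n) ^ k" if "k \<ge> 1" for k
    using is_refinement_trace[OF A B n ref that] tr[of "n * k"] n that by (simp add: power_mult)
  have "\<bar>c ^ n\<bar> < 1"
    using c n by (simp add: power_abs power_less_one_iff)
  then have cn: "c ^ n \<noteq> 0" "c ^ n \<noteq> 1" using c by auto
  note bounds = continuum_limit_choi_form[OF lim cn tr' linear_map_transfer[OF B]]
  show "c ^ n > 0" by (rule bounds(1))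
  obtain X where X:
    "\<And>m. choi_form D (word_comb D A n y) (transfer D A ^^ (n * m)) = choi_form D' X (transfer D' B ^^ m)"
    using is_refinement_choi_form[OF A B n ref] by metis
  show "(1 + c ^ n) * Re (choi_form D (word_comb D A n y) (transfer D A ^^ n)) \<ge>
      Re (choi_form D (word_comb D A n y) (transfer D A ^^ (n * 2)))"
    using bounds(2)[of X] X[of 1] X[of 2] by simp
qed

section \<open>Channels with spectrum \<open>{1, c, 0}\<close>\<close>

lemma mat_trace_minus:
  "X \<in> carrier_mat D D \<Longrightarrow> Y \<in> carrier_mat D D \<Longrightarrow> mat_trace (X - Y) = mat_trace X - mat_trace Y"
  by (simp add: mat_trace_def sum_subtractf)

lemma mat_trace_smult: "X \<in> carrier_mat D D \<Longrightarrow> mat_trace (z \<cdot>\<^sub>m X) = z * mat_trace X"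
  by (simp add: mat_trace_def sum_distrib_left)

lemma one_smult_single_block:
  assumes "M \<in> carrier_mat D D"
  shows "diag_block_mat [1 \<cdot>\<^sub>m M] = (M :: complex mat)"
  using assms by (intro eq_matI) (auto simp: Let_def)

text \<open>Here G is the diagonal matrix with entries \<open>g\<close>, and F has the rows of the
  orthogonal matrix \<open>U\<close> as eigenvectors with eigenvalues \<open>f\<close>. The last
  three assumptions are tr F = 0, tr G = 0 and tr(F G) = 1, and \<open>phi X\<close> below is tr(F
  X).\<close>

locale rank_two_channel =
  fixes D :: nat and f g :: "nat \<Rightarrow> real" and U :: "nat \<Rightarrow> nat \<Rightarrow> real"
  assumes D: "D \<ge> 1"
    and U_rows: "b < D \<Longrightarrow> (\<Sum>j<D. (U b j)\<^sup>2) = 1"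
    and U_cols: "j < D \<Longrightarrow> j' < D \<Longrightarrow> (\<Sum>b<D. U b j * U b j') = (if j = j' then 1 else 0)"
    and f0: "(\<Sum>b<D. f b) = 0" and g0: "(\<Sum>a<D. g a) = 0"
    and fg: "(\<Sum>b<D. f b * (\<Sum>j<D. (U b j)\<^sup>2 * g j)) = 1"
begin

text \<open>
  With \<open>\<phi>\<^sub>b\<close> the real unit vector formed by row \<open>b\<close> of \<open>U\<close>, \<open>overlap b X\<close> is
  \<open>\<langle>\<phi>\<^sub>b|X|\<phi>\<^sub>b\<rangle>\<close>, and \<open>chan c\<close> measures in the basis \<open>\<phi>\<close> and then prepares the basis state \<open>a\<close>
  with the conditional probability \<open>prob c a b\<close>.
\<close>

definition overlap :: "nat \<Rightarrow> complex mat \<Rightarrow> complex" where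
  "overlap b X = (\<Sum>k<D. \<Sum>l<D. of_real (U b k) * X $$ (k, l) * of_real (U b l))"

definition phi :: "complex mat \<Rightarrow> complex" where
  "phi X = (\<Sum>b<D. of_real (f b) * overlap b X)"

definition prob :: "real \<Rightarrow> nat \<Rightarrow> nat \<Rightarrow> real" where
  "prob c a b = 1 / real D + c * g a * f b"

definition chan :: "real \<Rightarrow> complex mat \<Rightarrow> complex mat" where
  "chan c X = mat D D (\<lambda>(i, j). if i = j then mat_trace X / of_nat D + of_real (c * g i) * phi X else 0)"

text \<open>The operator numbered a * D + b is \<open>|a\<rangle>\<langle>\<phi>\<^sub>b|\<close>
  times the square root of \<open>prob c a b\<close>: outcome b, then preparation of a.\<close>

definition kraus :: "real \<Rightarrow> tensor" where
  "kraus c = map (\<lambda>s. mat D D (\<lambda>(i, j). if i = s div D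
      then of_real (sqrt (prob c i (s mod D)) * U (s mod D) j) else 0)) [0..<D * D]"

lemma chan_carrier [simp]: "chan c X \<in> carrier_mat D D"
  by (simp add: chan_def)

lemma kraus_carrier: "set (kraus c) \<subseteq> carrier_mat D D"
  by (auto simp: kraus_def)

lemma length_kraus [simp]: "length (kraus c) = D * D"
  by (simp add: kraus_def)

lemma overlap_diag:
  "overlap b (mat D D (\<lambda>(i, j). if i = j then y i else 0)) = (\<Sum>k<D. of_real ((U b k)\<^sup>2) * y k)"
proof -
  have "overlap b (mat D D (\<lambda>(i, j). if i = j then y i else 0)) =
      (\<Sum>k<D. \<Sum>l<D. if k = l then of_real ((U b k)\<^sup>2) * y k else 0)"
    unfolding overlap_def by (intro sum.cong refl) (auto simp: power2_eq_square)
  then show ?thesis by simp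
qed

lemma sum_overlap:
  assumes X: "X \<in> carrier_mat D D"
  shows "(\<Sum>b<D. overlap b X) = mat_trace X"
proof -
  have "(\<Sum>b<D. overlap b X) = (\<Sum>k<D. \<Sum>b<D. \<Sum>l<D. of_real (U b k) * X $$ (k, l) * of_real (U b l))"
    unfolding overlap_def by (rule sum.swap)
  also have "\<dots> = (\<Sum>k<D. \<Sum>l<D. \<Sum>b<D. of_real (U b k) * X $$ (k, l) * of_real (U b l))"
    by (rule sum.cong[OF refl], rule sum.swap)
  also have "\<dots> = (\<Sum>k<D. \<Sum>l<D. of_real (\<Sum>b<D. U b k * U b l) * X $$ (k, l))"
    by (intro sum.cong refl) (simp add: sum_distrib_left sum_distrib_right mult_ac)
  also have "\<dots> = (\<Sum>k<D. \<Sum>l<D. if k = l then X $$ (k, k) else 0)"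
    by (intro sum.cong refl) (simp add: U_cols del: of_real_sum)
  also have "\<dots> = mat_trace X"
    using X by (simp add: mat_trace_def)
  finally show ?thesis .
qed

lemma phi_smult: "X \<in> carrier_mat D D \<Longrightarrow> phi (z \<cdot>\<^sub>m X) = z * phi X"
  unfolding phi_def overlap_def sum_distrib_left by (intro sum.cong refl) (simp add: mult_ac)

lemma mat_trace_chan: "mat_trace (chan c X) = mat_trace X"
proof -
  have "mat_trace (chan c X) = (\<Sum>i<D. mat_trace X / of_nat D + of_real (g i) * (of_real c * phi X))"
    by (simp add: mat_trace_def chan_def mult_ac)
  also have "\<dots> = of_nat D * (mat_trace X / of_nat D) + of_real (\<Sum>i<D. g i) * (of_real c * phi X)"
    by (simp add: sum.distrib sum_distrib_right)
  finally show ?thesis using D g0 by simp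
qed

lemma phi_chan: "phi (chan c X) = of_real c * phi X"
proof -
  let ?t = "mat_trace X / of_nat D"
  have "overlap b (chan c X) = ?t + of_real c * phi X * of_real (\<Sum>k<D. (U b k)\<^sup>2 * g k)" if "b < D" for b
  proof -
    have "overlap b (chan c X) = (\<Sum>k<D. of_real ((U b k)\<^sup>2) * (?t + of_real (c * g k) * phi X))"
      unfolding chan_def by (rule overlap_diag)
    also have "\<dots> = of_real (\<Sum>k<D. (U b k)\<^sup>2) * ?t + of_real c * phi X * of_real (\<Sum>k<D. (U b k)\<^sup>2 * g k)"
      unfolding of_real_sum sum_distrib_left sum_distrib_right sum.distrib[symmetric]
      by (intro sum.cong refl) (simp add: algebra_simps)
    finally show ?thesis using U_rows[OF that] by simp
  qed
  then have "phi (chan c X) = (\<Sum>b<D. of_real (f b) *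
      (?t + of_real c * phi X * of_real (\<Sum>k<D. (U b k)\<^sup>2 * g k)))"
    unfolding phi_def[of "chan c X"] by simp
  also have "\<dots> = of_real (\<Sum>b<D. f b) * ?t +
      of_real c * phi X * of_real (\<Sum>b<D. f b * (\<Sum>k<D. (U b k)\<^sup>2 * g k))"
    unfolding of_real_sum[of _ "{..<D}"] sum_distrib_left[of _ _ "{..<D}"] sum_distrib_right[of _ "{..<D}"]
      sum.distrib[symmetric]
    by (intro sum.cong refl) (simp add: algebra_simps sum_distrib_left)
  finally show ?thesis using f0 fg by simp
qed

lemma chan_chan: "chan c (chan c' X) = chan (c * c') X"
  unfolding chan_def[of c] mat_trace_chan phi_chan by (simp add: chan_def mult_ac cong: if_cong)

lemma chan_pow: "n \<ge> 1 \<Longrightarrow> (chan c ^^ n) X = chan (c ^ n) X"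
  by (induction n rule: dec_induct) (simp_all add: chan_chan)

lemma chan_index_eq_sum:
  assumes X: "X \<in> carrier_mat D D"
  shows "mat_trace X / of_nat D + of_real (c * g i) * phi X = (\<Sum>b<D. of_real (prob c i b) * overlap b X)"
  unfolding sum_overlap[OF X, symmetric] phi_def prob_def sum_divide_distrib sum_distrib_left sum.distrib[symmetric]
  by (intro sum.cong refl) (simp add: algebra_simps)

lemma transfer_kraus:
  assumes X: "X \<in> carrier_mat D D" and prob: "\<And>a b. a < D \<Longrightarrow> b < D \<Longrightarrow> prob c a b \<ge> 0"
  shows "transfer D (kraus c) X = chan c X"
proof (rule eq_matI)
  fix i j
  assume "i < dim_row (chan c X)" "j < dim_col (chan c X)"
  then have ij: "i < D" "j < D" by (auto simp: chan_def)
  let ?x = "\<lambda>i s k. if i = s div D then of_real (sqrt (prob c i (s mod D)) * U (s mod D) k) else 0 :: complex"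
  let ?y = "\<lambda>i a b k. if i = a then of_real (sqrt (prob c i b) * U b k) else 0 :: complex"
  have "transfer D (kraus c) X $$ (i, j) =
      (\<Sum>s<D * D. \<Sum>k<D. \<Sum>l<D. ?x i s k * X $$ (k, l) * cnj (?x j s l))"
    unfolding transfer_index_sum[OF kraus_carrier X ij] length_kraus
    using ij by (intro sum.cong refl) (simp add: kraus_def)
  also have "\<dots> = (\<Sum>a<D. \<Sum>b<D. \<Sum>k<D. \<Sum>l<D. ?y i a b k * X $$ (k, l) * cnj (?y j a b l))"
    by (rule sum_div_mod)
  also have "\<dots> = (\<Sum>a<D. if a = i then if i = j then \<Sum>b<D. of_real (prob c i b) * overlap b X else 0 else 0)"
  proof (rule sum.cong[OF refl])
    fix a
    have "(\<Sum>k<D. \<Sum>l<D. ?y i i b k * X $$ (k, l) * cnj (?y i i b l)) = of_real (prob c i b) * overlap b X"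
      if "b < D" for b
    proof -
      have "of_real (sqrt (prob c i b)) * of_real (sqrt (prob c i b)) = (of_real (prob c i b) :: complex)"
        using prob[OF ij(1) that] by (simp flip: of_real_mult)
      then have term_eq: "?y i i b k * X $$ (k, l) * cnj (?y i i b l) =
          of_real (prob c i b) * (of_real (U b k) * X $$ (k, l) * of_real (U b l))" for k l
        by (simp add: mult_ac)
      show ?thesis
        unfolding overlap_def sum_distrib_left by (intro sum.cong refl term_eq)
    qed
    then have diag: "(\<Sum>b<D. \<Sum>k<D. \<Sum>l<D. ?y i i b k * X $$ (k, l) * cnj (?y i i b l)) =
        (\<Sum>b<D. of_real (prob c i b) * overlap b X)"
      by (intro sum.cong refl) blast
    show "(\<Sum>b<D. \<Sum>k<D. \<Sum>l<D. ?y i a b k * X $$ (k, l) * cnj (?y j a b l)) =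
        (if a = i then if i = j then \<Sum>b<D. of_real (prob c i b) * overlap b X else 0 else 0)"
    proof (cases "a = i \<and> i = j")
      case True
      then show ?thesis using diag by (simp only: if_True simp_thms)
    next
      case False
      then have "?y i a b k * X $$ (k, l) * cnj (?y j a b l) = 0" for b k l by auto
      then show ?thesis using False by (simp only: sum.neutral_const if_cancel) auto
    qed
  qed
  also have "\<dots> = chan c X $$ (i, j)"
    using ij chan_index_eq_sum[OF X, of c i] by (auto simp: chan_def)
  finally show "transfer D (kraus c) X $$ (i, j) = chan c X $$ (i, j)" .
qed (use transfer_carrier[OF kraus_carrier X] in \<open>auto simp: chan_def\<close>)

text \<open>P equals its adjoint times itself, so the form measures the squared length of
  \<open>P \<phi>\<^sub>b\<close>: it is nonnegative, and zero only if P annihilates that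
  vector.\<close>

lemma overlap_projection:
  assumes P: "orth_projection D P"
  shows "overlap b P = of_real (\<Sum>m<D. (cmod (\<Sum>l<D. P $$ (m, l) * of_real (U b l)))\<^sup>2)"
proof -
  have Pc: "P \<in> carrier_mat D D" and PP: "P * P = P" and Pa: "mat_adjoint P = P"
    using P by (auto simp: orth_projection_def)
  have entry: "P $$ (k, l) = (\<Sum>m<D. cnj (P $$ (m, k)) * P $$ (m, l))" if "k < D" "l < D" for k l
  proof -
    have "P $$ (k, l) = (mat_adjoint P * P) $$ (k, l)" by (simp add: PP Pa)
    also have "\<dots> = (\<Sum>m<D. mat_adjoint P $$ (k, m) * P $$ (m, l))"
      by (rule index_mult_mat_sum) (use Pc that in auto)
    also have "\<dots> = (\<Sum>m<D. cnj (P $$ (m, k)) * P $$ (m, l))"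
      using Pc that by simp
    finally show ?thesis .
  qed
  have "overlap b P = (\<Sum>k<D. \<Sum>l<D. \<Sum>m<D. cnj (P $$ (m, k) * of_real (U b k)) * (P $$ (m, l) * of_real (U b l)))"
    unfolding overlap_def
    by (intro sum.cong refl, subst entry) (auto simp: sum_distrib_left sum_distrib_right mult_ac)
  also have "\<dots> = (\<Sum>k<D. \<Sum>m<D. \<Sum>l<D. cnj (P $$ (m, k) * of_real (U b k)) * (P $$ (m, l) * of_real (U b l)))"
    by (rule sum.cong[OF refl], rule sum.swap)
  also have "\<dots> = (\<Sum>m<D. \<Sum>k<D. \<Sum>l<D. cnj (P $$ (m, k) * of_real (U b k)) * (P $$ (m, l) * of_real (U b l)))"
    by (rule sum.swap)
  also have "\<dots> = (\<Sum>m<D. of_real ((cmod (\<Sum>l<D. P $$ (m, l) * of_real (U b l)))\<^sup>2))"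
    unfolding complex_norm_square cnj_sum sum_product
    by (rule sum.cong[OF refl], rule trans[OF sum.swap]) (simp add: mult_ac)
  finally show ?thesis by simp
qed

text \<open>With strictly positive probabilities, the image Y of a nonzero projection P is diagonal
  without zeros on the diagonal, hence invertible. Invariance of the corner gives P Y = Y, which
  forces P = 1.\<close>

lemma irreducible_cp_transfer:
  assumes A: "set A \<subseteq> carrier_mat D D"
    and T: "\<And>X. X \<in> carrier_mat D D \<Longrightarrow> transfer D A X = chan c X"
    and pos: "\<And>a b. a < D \<Longrightarrow> b < D \<Longrightarrow> prob c a b > 0"
  shows "irreducible_cp D (transfer D A)"
proof -
  have "P = 1\<^sub>m D" if P: "orth_projection D P" and inv: "\<forall>X\<in>carrier_mat D D.
      transfer D A (P * X * P) = P * transfer D A (P * X * P) * P" and "P \<noteq> 0\<^sub>m D D" for P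
  proof -
    have Pc: "P \<in> carrier_mat D D" and PP: "P * P = P" and Pa: "mat_adjoint P = P"
      using P by (auto simp: orth_projection_def)
    define r where "r b = (\<Sum>m<D. (cmod (\<Sum>l<D. P $$ (m, l) * of_real (U b l)))\<^sup>2)" for b
    have r: "overlap b P = of_real (r b)" for b
      unfolding r_def by (rule overlap_projection[OF P])
    have r_nonneg: "r b \<ge> 0" for b by (simp add: r_def sum_nonneg)
    \<comment> \<open>Otherwise P annihilates a whole basis.\<close>
    have "\<exists>b<D. r b \<noteq> 0"
    proof (rule ccontr)
      assume "\<not> ?thesis"
      then have zero: "r b = 0" if "b < D" for b using that by blast
      have "P $$ (m, k) = 0" if m: "m < D" and k: "k < D" for m k
      proof -
        have orth: "(\<Sum>l<D. P $$ (m, l) * of_real (U b l)) = 0" if "b < D" for b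
          using zero[OF that] m unfolding r_def by (subst (asm) sum_nonneg_eq_0_iff) auto
        have "P $$ (m, k) = (\<Sum>l<D. P $$ (m, l) * of_real (\<Sum>b<D. U b l * U b k))"
        proof -
          have "(\<Sum>l<D. P $$ (m, l) * of_real (\<Sum>b<D. U b l * U b k)) =
              (\<Sum>l<D. if l = k then P $$ (m, k) else 0)"
            using k by (intro sum.cong refl) (simp add: U_cols del: of_real_sum)
          then show ?thesis using k by simp
        qed
        also have "\<dots> = (\<Sum>b<D. (\<Sum>l<D. P $$ (m, l) * of_real (U b l)) * of_real (U b k))"
          unfolding of_real_sum sum_distrib_left sum_distrib_right by (subst sum.swap) (simp add: mult_ac)
        also have "\<dots> = 0" using orth by simp
        finally show ?thesis .
      qed
      then have "P = 0\<^sub>m D D" using Pc by (intro eq_matI) auto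
      then show False using \<open>P \<noteq> 0\<^sub>m D D\<close> by simp
    qed
    then obtain b0 where b0: "b0 < D" "r b0 \<noteq> 0" by blast
    define Y where "Y = chan c P"
    define y where "y i = mat_trace P / of_nat D + of_real (c * g i) * phi P" for i
    have Yc: "Y \<in> carrier_mat D D" by (simp add: Y_def)
    have Y: "Y $$ (i, j) = (if i = j then y i else 0)" if "i < D" "j < D" for i j
      using that by (simp add: Y_def y_def chan_def)
    have y: "y i \<noteq> 0" if "i < D" for i
    proof -
      have y_eq: "y i = of_real (\<Sum>b<D. prob c i b * r b)"
        unfolding y_def chan_index_eq_sum[OF Pc] r by simp
      have "(\<Sum>b<D. prob c i b * r b) > 0"
      proof (rule sum_pos2[of _ b0])
        have "r b0 > 0" using r_nonneg[of b0] b0(2) by linarith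
        then show "0 < prob c i b0 * r b0" using pos[OF that b0(1)] by simp
        show "0 \<le> prob c i b * r b" if "b \<in> {..<D}" for b
          using pos[OF \<open>i < D\<close>, of b] r_nonneg[of b] that by simp
      qed (use b0 in auto)
      then have "(\<Sum>b<D. prob c i b * r b) \<noteq> 0" by linarith
      then show ?thesis unfolding y_eq of_real_eq_0_iff .
    qed
    have "P * 1\<^sub>m D * P = P" using Pc PP by simp
    then have Y_eq: "Y = P * Y * P"
      using inv[rule_format, of "1\<^sub>m D"] T[OF Pc] by (simp add: Y_def)
    have YP: "Y * P \<in> carrier_mat D D" by (rule mult_carrier_mat[OF Yc Pc])
    have "P * (P * Y * P) = P * P * (Y * P)"
      unfolding assoc_mult_mat[OF Pc Yc Pc] by (rule assoc_mult_mat[OF Pc Pc YP, symmetric])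
    also have "\<dots> = P * Y * P"
      unfolding PP by (rule assoc_mult_mat[OF Pc Yc Pc, symmetric])
    finally have PY: "P * Y = Y"
      unfolding Y_eq[symmetric] .
    show ?thesis
    proof (rule eq_matI)
      fix i j
      assume "i < dim_row (1\<^sub>m D :: complex mat)" "j < dim_col (1\<^sub>m D :: complex mat)"
      then have ij: "i < D" "j < D" by auto
      have "Y $$ (i, j) = (\<Sum>k<D. P $$ (i, k) * Y $$ (k, j))"
        using index_mult_mat_sum[OF Pc Yc ij] PY by simp
      also have "\<dots> = (\<Sum>k<D. if k = j then P $$ (i, j) * y j else 0)"
        using ij by (intro sum.cong refl) (simp add: Y)
      also have "\<dots> = P $$ (i, j) * y j" using ij by simp
      finally show "P $$ (i, j) = 1\<^sub>m D $$ (i, j)"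
        using ij y[of j] by (auto simp: Y split: if_splits)
    qed (use Pc in auto)
  qed
  then show ?thesis
    unfolding irreducible_cp_def using completely_positive_transfer[OF A] by blast
qed

text \<open>The functional \<open>phi\<close> is multiplied by c under \<open>chan c\<close>, so it
  vanishes on a fixed point and only the multiple of the identity survives.\<close>

lemma fixed_point_scalar:
  assumes "chan c Z = Z" and c: "c \<noteq> 1"
  shows "Z = (mat_trace Z / of_nat D) \<cdot>\<^sub>m 1\<^sub>m D"
proof -
  have "phi Z = of_real c * phi Z" using phi_chan[of c Z] assms by simp
  then have "phi Z * (1 - of_real c) = 0" by (simp add: algebra_simps)
  then have "phi Z = 0" using c by (simp add: right_minus_eq)
  then have "chan c Z = (mat_trace Z / of_nat D) \<cdot>\<^sub>m 1\<^sub>m D"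
    by (intro eq_matI) (auto simp: chan_def)
  then show ?thesis using assms by simp
qed

lemma tensors_transfer_chan:
  assumes A: "set A \<subseteq> carrier_mat D D"
    and T: "\<And>X. X \<in> carrier_mat D D \<Longrightarrow> transfer D A X = chan c X"
    and pos: "\<And>a b. a < D \<Longrightarrow> b < D \<Longrightarrow> prob c a b > 0" and c: "\<bar>c\<bar> < 1"
  shows "A \<in> tensors D"
proof -
  have "nondegenerate_eigenvalue_one D (transfer D A)"
    unfolding nondegenerate_eigenvalue_one_def
  proof (intro bexI conjI ballI impI)
    show "1\<^sub>m D \<in> carrier_mat D D" by simp
    show "1\<^sub>m D \<noteq> (0\<^sub>m D D :: complex mat)"
    proof
      assume "1\<^sub>m D = (0\<^sub>m D D :: complex mat)"
      then have "1\<^sub>m D $$ (0, 0) = (0\<^sub>m D D :: complex mat) $$ (0, 0)" by simp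
      then show False using D by simp
    qed
    have "overlap b (1\<^sub>m D) = 1" if "b < D" for b
      using overlap_diag[of b "\<lambda>_. 1"] U_rows[OF that]
      by (simp add: one_mat_def flip: of_real_power of_real_sum)
    then have "phi (1\<^sub>m D) = of_real (\<Sum>b<D. f b)" by (simp add: phi_def)
    then have "phi (1\<^sub>m D) = 0" by (simp add: f0)
    moreover have "mat_trace (1\<^sub>m D) = of_nat D" by (simp add: mat_trace_def)
    ultimately have "chan c (1\<^sub>m D) = 1\<^sub>m D"
      using D by (intro eq_matI) (auto simp: chan_def)
    then show "transfer D A (1\<^sub>m D) = 1\<^sub>m D" using T by simp
    fix Y
    assume Y: "Y \<in> carrier_mat D D" and fix1: "transfer D A (transfer D A Y - Y) = transfer D A Y - Y"
    \<comment> \<open>A generalised eigenvector Y yields a fixed point Z, which is scalar; it is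
      also traceless because \<open>chan c\<close> preserves the trace. So Z = 0 and there is no
      Jordan block at 1.\<close>
    define Z where "Z = chan c Y - Y"
    have Z: "Z \<in> carrier_mat D D" using Y by (simp add: Z_def minus_carrier_mat)
    have "chan c Z = Z" using fix1 T[OF Y] T[OF Z] by (simp add: Z_def)
    then have "Z = (mat_trace Z / of_nat D) \<cdot>\<^sub>m 1\<^sub>m D" using c by (intro fixed_point_scalar) auto
    moreover have "mat_trace Z = 0"
      using mat_trace_minus[OF chan_carrier Y] by (simp add: Z_def mat_trace_chan)
    ultimately have Z0: "Z = 0 \<cdot>\<^sub>m 1\<^sub>m D" by simp
    have "chan c Y = Y"
    proof (rule eq_matI)
      fix i j
      assume ij: "i < dim_row Y" "j < dim_col Y"
      then have "Z $$ (i, j) = 0" unfolding Z0 using Y by simp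
      then show "chan c Y $$ (i, j) = Y $$ (i, j)"
        using ij Y by (simp add: Z_def)
    qed (use Y in \<open>auto simp: chan_def\<close>)
    then show "\<exists>z. Y = z \<cdot>\<^sub>m 1\<^sub>m D"
      using fixed_point_scalar[of c Y] c by fastforce
  qed
  moreover have "eigenvalues_in_unit_disc D (transfer D A)"
    unfolding eigenvalues_in_unit_disc_def
  proof (intro allI ballI impI)
    fix z X
    assume X: "X \<in> carrier_mat D D" and ev: "X \<noteq> 0\<^sub>m D D \<and> transfer D A X = z \<cdot>\<^sub>m X"
    show "cmod z \<le> 1"
    proof (rule ccontr)
      assume z: "\<not> cmod z \<le> 1"
      have eq: "chan c X = z \<cdot>\<^sub>m X" using ev T[OF X] by simp
      have "mat_trace X = z * mat_trace X"
        using mat_trace_chan[of c X] mat_trace_smult[OF X] by (simp add: eq)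
      then have "mat_trace X = 0" using z by auto
      moreover have "of_real c * phi X = z * phi X"
        using phi_chan[of c X] phi_smult[OF X] by (simp only: eq)
      then have "(of_real c - z) * phi X = 0" by (simp add: algebra_simps)
      moreover have "complex_of_real c \<noteq> z" using z c by auto
      ultimately have "phi X = 0" "mat_trace X = 0" by auto
      then have "chan c X = 0\<^sub>m D D" by (intro eq_matI) (auto simp: chan_def)
      have "X $$ (i, j) = 0" if "i < D" "j < D" for i j
      proof -
        have "z * X $$ (i, j) = (z \<cdot>\<^sub>m X) $$ (i, j)" using X that by simp
        also have "\<dots> = 0" using \<open>chan c X = 0\<^sub>m D D\<close> that by (simp flip: eq)
        finally show ?thesis using z by auto
      qed
      then have "X = 0\<^sub>m D D" using X by (intro eq_matI) auto
      then show False using ev by simp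
    qed
  qed
  moreover note irreducible_cp_transfer[OF A T pos]
  ultimately have "irreducible_form A"
    unfolding irreducible_form_def
  \<comment> \<open>An irreducible tensor is its own irreducible form: a single block of weight
    1.\<close>
  proof (intro exI[of _ "[(1, D, A)]"] conjI allI impI)
    fix i
    assume "i < length A"
    then have "A ! i \<in> carrier_mat D D" using A by auto
    then show "A ! i = diag_block_mat (map (\<lambda>(\<mu>, m, B). complex_of_real \<mu> \<cdot>\<^sub>m B ! i) [(1, D, A)])"
      by (simp only: list.map prod.case of_real_1 one_smult_single_block)
  qed (use A D in simp)
  moreover have "quantum_channel D (transfer D A)"
    using completely_positive_transfer[OF A]
    by (simp add: quantum_channel_def trace_preserving_def T mat_trace_chan)
  ultimately show ?thesis using A D by (simp add: tensors_def)
qed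

lemma transfer_pow_chan:
  assumes A: "set A \<subseteq> carrier_mat D D"
    and T: "\<And>X. X \<in> carrier_mat D D \<Longrightarrow> transfer D A X = chan c X"
    and n: "n \<ge> 1" and X: "X \<in> carrier_mat D D"
  shows "(transfer D A ^^ n) X = chan (c ^ n) X"
proof -
  have "(transfer D A ^^ n) X = (chan c ^^ n) X" for n
  proof (induction n)
    case (Suc n)
    then show ?case using T[OF transfer_pow_carrier[OF A X, of n]] by simp
  qed simp
  then show ?thesis using chan_pow[OF n] by simp
qed

text \<open>Images of \<open>chan c\<close> are diagonal, so only the terms with equal block indices
  survive. Column a of Y then enters through its norm and its components along the basis
  \<phi>.\<close>

lemma choi_form_chan:
  "choi_form D Y (chan c) = (\<Sum>a<D. (\<Sum>i<D. Y $$ (i, a) * cnj (Y $$ (i, a))) / of_nat D +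
    of_real (c * g a) * (\<Sum>b<D. of_real (f b) * (\<Sum>i<D. of_real (U b i) * Y $$ (i, a)) *
      cnj (\<Sum>i<D. of_real (U b i) * Y $$ (i, a))))"
proof -
  let ?K = "\<lambda>a b. mat D D (\<lambda>(i, j). Y $$ (i, a) * cnj (Y $$ (j, b)))"
  have ov: "overlap b (?K a a) = (\<Sum>i<D. of_real (U b i) * Y $$ (i, a)) * cnj (\<Sum>i<D. of_real (U b i) * Y $$ (i, a))"
    for a b
    unfolding overlap_def cnj_sum sum_product by (intro sum.cong refl) (simp add: mult_ac)
  have "choi_form D Y (chan c) = (\<Sum>a<D. \<Sum>b<D. if a = b then chan c (?K a a) $$ (a, a) else 0)"
    unfolding choi_form_def by (intro sum.cong refl) (auto simp: chan_def)
  also have "\<dots> = (\<Sum>a<D. chan c (?K a a) $$ (a, a))" by simp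
  also have "\<dots> = (\<Sum>a<D. (\<Sum>i<D. Y $$ (i, a) * cnj (Y $$ (i, a))) / of_nat D +
    of_real (c * g a) * (\<Sum>b<D. of_real (f b) * (\<Sum>i<D. of_real (U b i) * Y $$ (i, a)) *
      cnj (\<Sum>i<D. of_real (U b i) * Y $$ (i, a))))"
    by (intro sum.cong refl) (simp add: chan_def mat_trace_def phi_def ov mult.assoc)
  finally show ?thesis .
qed

lemma choi_form_cong:
  "(\<And>X. X \<in> carrier_mat D D \<Longrightarrow> T X = S X) \<Longrightarrow> choi_form D Y T = choi_form D Y S"
  by (simp add: choi_form_def)

text \<open>At Y = 1 the form of \<open>chan e\<close> is 1 + e tr(F G), and tr(F G) = 1.\<close>

lemma trace_transfer_pow_chan:
  assumes A: "set A \<subseteq> carrier_mat D D"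
    and T: "\<And>X. X \<in> carrier_mat D D \<Longrightarrow> transfer D A X = chan c X" and k: "k \<ge> 1"
  shows "mat_trace (mat_of_map D (transfer D A) ^\<^sub>m k) = 1 + of_real c ^ k"
proof -
  have "mat_trace (mat_of_map D (transfer D A) ^\<^sub>m k) = choi_form D (1\<^sub>m D) (chan (c ^ k))"
    unfolding mat_of_map_pow[OF linear_map_transfer[OF A], symmetric] mat_trace_mat_of_map
    by (rule choi_form_cong) (rule transfer_pow_chan[OF A T k])
  also have "\<dots> = (\<Sum>a<D. 1 / of_nat D + of_real (c ^ k) * of_real (\<Sum>b<D. f b * ((U b a)\<^sup>2 * g a)))"
    unfolding choi_form_chan
  proof (rule sum.cong[OF refl])
    fix a
    assume a: "a \<in> {..<D}"
    have "(\<Sum>i<D. 1\<^sub>m D $$ (i, a) * cnj (1\<^sub>m D $$ (i, a))) = (\<Sum>i<D. if i = a then 1 else 0 :: complex)"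
      using a by (intro sum.cong) auto
    moreover have "(\<Sum>i<D. of_real (U b i) * 1\<^sub>m D $$ (i, a)) = (\<Sum>i<D. if i = a then of_real (U b a) else 0 :: complex)"
      for b using a by (intro sum.cong) auto
    ultimately show "(\<Sum>i<D. 1\<^sub>m D $$ (i, a) * cnj (1\<^sub>m D $$ (i, a))) / of_nat D +
        of_real (c ^ k * g a) * (\<Sum>b<D. of_real (f b) * (\<Sum>i<D. of_real (U b i) * 1\<^sub>m D $$ (i, a)) *
          cnj (\<Sum>i<D. of_real (U b i) * 1\<^sub>m D $$ (i, a))) =
        1 / of_nat D + of_real (c ^ k) * of_real (\<Sum>b<D. f b * ((U b a)\<^sup>2 * g a))"
      using a by (simp add: sum_distrib_left power2_eq_square mult_ac)
  qed
  also have "\<dots> = 1 + of_real (c ^ k) * of_real (\<Sum>a<D. \<Sum>b<D. f b * ((U b a)\<^sup>2 * g a))"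
    using D by (simp add: sum.distrib sum_distrib_left)
  also have "(\<Sum>a<D. \<Sum>b<D. f b * ((U b a)\<^sup>2 * g a)) = 1"
    using fg by (subst sum.swap) (simp add: sum_distrib_left)
  finally show ?thesis by simp
qed

text \<open>All \<open>chan t\<close> with t between 0 and 1 are channels and multiply like their
  parameters, so the roots of \<open>chan e\<close> can be taken along the semigroup of powers of e,
  here with p = 2. If n / 2^l tends to 0, the parameter tends to 1 and the map to
  \<open>chan 1\<close>.\<close>

lemma channel_continuum_limit_chan:
  assumes prob: "\<And>t a b. 0 \<le> t \<Longrightarrow> t \<le> 1 \<Longrightarrow> a < D \<Longrightarrow> b < D \<Longrightarrow> prob t a b \<ge> 0"
    and e: "0 < e" "e \<le> 1"
    and T: "\<And>X. X \<in> carrier_mat D D \<Longrightarrow> T X = chan e X"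
  shows "channel_continuum_limit D T"
proof -
  define t where "t l = e powr (1 / 2 ^ l)" for l :: nat
  have t: "0 \<le> t l" "t l \<le> 1" for l
    using e by (auto simp: t_def powr_le_one_le intro!: powr_le1)
  have tK: "transfer D (kraus s) X = chan s X" if "0 \<le> s" "s \<le> 1" "X \<in> carrier_mat D D" for s X
    using transfer_kraus[OF that(3)] prob that by blast
  have pow: "(transfer D (kraus (t l)) ^^ n) X = chan (e powr (real n / 2 ^ l)) X"
    if "X \<in> carrier_mat D D" "n \<ge> 1" for l n X
  proof -
    have "(transfer D (kraus (t l)) ^^ n) X = chan (t l ^ n) X"
      by (rule transfer_pow_chan[OF kraus_carrier tK[OF t] that(2,1)])
    also have "t l ^ n = e powr (real n / 2 ^ l)"
      using e by (simp add: t_def powr_powr flip: powr_realpow)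
    finally show ?thesis .
  qed
  show ?thesis
    unfolding channel_continuum_limit_def
  \<comment> \<open>Roots and limit are given as transfer maps of Kraus tensors, for which complete
    positivity of the roots and linearity of the limit are already known.\<close>
  proof (intro exI[of _ 2] conjI exI[of _ "\<lambda>l. transfer D (kraus (t l))"] exI[of _ "transfer D (kraus 1)"]
      allI impI ballI)
    show "(1::nat) < 2" by simp
    show "quantum_channel D (transfer D (kraus (t l)))" for l
      using completely_positive_transfer[OF kraus_carrier] tK[OF t]
      by (simp add: quantum_channel_def trace_preserving_def mat_trace_chan)
    show "(transfer D (kraus (t l)) ^^ 2 ^ l) X = T X" if "X \<in> carrier_mat D D" for l X
      using pow[OF that, of "2 ^ l" l] T[OF that] e by simp
    show "linear_map D (transfer D (kraus 1))"
      by (rule linear_map_transfer[OF kraus_carrier])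
    fix n l :: "nat \<Rightarrow> nat" and X :: "complex mat" and i j
    assume nl: "(\<forall>k. 1 \<le> n k \<and> 1 \<le> l k) \<and> (\<lambda>k. real (n k) / real 2 ^ l k) \<longlonglongrightarrow> 0"
      and X: "X \<in> carrier_mat D D" and ij: "i < D" "j < D"
    have "(\<lambda>k. e powr (real (n k) / 2 ^ l k)) \<longlonglongrightarrow> e powr 0"
      using nl e by (intro tendsto_intros) auto
    then have lim: "(\<lambda>k. e powr (real (n k) / 2 ^ l k)) \<longlonglongrightarrow> 1" using e by simp
    have "(\<lambda>k. mat_trace X / of_nat D + of_real (e powr (real (n k) / 2 ^ l k) * g i) * phi X)
        \<longlonglongrightarrow> mat_trace X / of_nat D + of_real (1 * g i) * phi X"
      by (intro tendsto_intros lim)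
    then have "(\<lambda>k. chan (e powr (real (n k) / 2 ^ l k)) X $$ (i, j)) \<longlonglongrightarrow> chan 1 X $$ (i, j)"
      unfolding chan_def using ij by (cases "i = j") simp_all
    then show "(\<lambda>k. (transfer D (kraus (t (l k))) ^^ n k) X $$ (i, j)) \<longlonglongrightarrow> transfer D (kraus 1) X $$ (i, j)"
      using nl pow[OF X] tK[of 1, OF _ _ X] by simp
  qed
qed

end

section \<open>Spanning by words\<close>

lemma word_comb_Suc:
  assumes A: "set A \<subseteq> carrier_mat D D"
  shows "word_comb D A (Suc n) (\<lambda>w. y (hd w) * z (tl w)) =
    mat D D (\<lambda>(i, j). \<Sum>s<length A. y s * (A ! s) $$ (i, j)) * word_comb D A n z"
    (is "_ = ?Y * ?Z")
proof (rule eq_matI)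
  fix i j
  assume "i < dim_row (?Y * ?Z)" "j < dim_col (?Y * ?Z)"
  then have ij: "i < D" "j < D" by (auto simp: word_comb_def)
  have "word_comb D A (Suc n) (\<lambda>w. y (hd w) * z (tl w)) $$ (i, j) =
      (\<Sum>s<length A. \<Sum>w\<in>spin_words (length A) n. \<Sum>k<D. y s * (A ! s) $$ (i, k) * (z w * word_mat D A w $$ (k, j)))"
    unfolding word_comb_def using ij
  proof (simp add: sum_spin_words_Suc del: index_mult_mat, intro sum.cong refl)
    fix s w
    assume s: "s \<in> {..<length A}" and w: "w \<in> spin_words (length A) n"
    then have As: "A ! s \<in> carrier_mat D D" using A by auto
    show "y s * z w * (A ! s * word_mat D A w) $$ (i, j) =
        (\<Sum>k<D. y s * (A ! s) $$ (i, k) * (z w * word_mat D A w $$ (k, j)))"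
      unfolding index_mult_mat_sum[OF As word_mat_carrier[OF A w] ij] by (simp add: sum_distrib_left mult_ac)
  qed
  also have "\<dots> = (\<Sum>s<length A. \<Sum>k<D. \<Sum>w\<in>spin_words (length A) n. y s * (A ! s) $$ (i, k) * (z w * word_mat D A w $$ (k, j)))"
    by (rule sum.cong[OF refl], rule sum.swap)
  also have "\<dots> = (\<Sum>k<D. \<Sum>s<length A. \<Sum>w\<in>spin_words (length A) n. y s * (A ! s) $$ (i, k) * (z w * word_mat D A w $$ (k, j)))"
    by (rule sum.swap)
  also have "\<dots> = (\<Sum>k<D. ?Y $$ (i, k) * ?Z $$ (k, j))"
    using ij by (simp add: word_comb_def sum_product)
  also have "\<dots> = (?Y * ?Z) $$ (i, j)"
    by (rule index_mult_mat_sum[symmetric]) (use ij in auto)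
  finally show "word_comb D A (Suc n) (\<lambda>w. y (hd w) * z (tl w)) $$ (i, j) = (?Y * ?Z) $$ (i, j)" .
qed (auto simp: word_comb_def)

text \<open>If the identity is a combination of m-letter words, then X = X * 1 is one of (m +
  1)-letter words, the first letter being used to expand X.\<close>

lemma word_comb_surj:
  assumes A: "set A \<subseteq> carrier_mat D D" and n: "n \<ge> 1"
    and span: "\<And>X. X \<in> carrier_mat D D \<Longrightarrow> \<exists>y. X = mat D D (\<lambda>(i, j). \<Sum>s<length A. y s * (A ! s) $$ (i, j))"
    and X: "X \<in> carrier_mat D D"
  shows "\<exists>y. word_comb D A n y = X"
proof -
  have step: "\<exists>y. word_comb D A (Suc m) y = X"
    if z: "word_comb D A m z = 1\<^sub>m D" and X: "X \<in> carrier_mat D D" for m z X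
  proof -
    obtain y where y: "X = mat D D (\<lambda>(i, j). \<Sum>s<length A. y s * (A ! s) $$ (i, j))"
      using span[OF X] by blast
    have "word_comb D A (Suc m) (\<lambda>w. y (hd w) * z (tl w)) = X"
      unfolding word_comb_Suc[OF A] z y[symmetric] using X by simp
    then show ?thesis by blast
  qed
  have one: "\<exists>z. word_comb D A m z = 1\<^sub>m D" for m
  proof (induction m)
    case 0
    have "word_comb D A 0 (\<lambda>_. 1) = 1\<^sub>m D"
      by (intro eq_matI) (auto simp: word_comb_def)
    then show ?case by blast
  next
    case (Suc m)
    then show ?case using step by (metis one_carrier_mat)
  qed
  obtain m where "n = Suc m" using n by (cases n) auto
  then show ?thesis using one[of m] step X by blast
qed

lemma (in rank_two_channel) kraus_span:
  assumes pos: "\<And>a b. a < D \<Longrightarrow> b < D \<Longrightarrow> prob c a b > 0" and X: "X \<in> carrier_mat D D"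
  shows "\<exists>y. X = mat D D (\<lambda>(i, j). \<Sum>s<length (kraus c). y s * (kraus c ! s) $$ (i, j))"
proof -
  \<comment> \<open>The operators \<open>|a\<rangle>\<langle>\<phi>\<^sub>b|\<close> form a basis of
    all matrices; the coefficient of X is \<open>\<langle>a|X|\<phi>\<^sub>b\<rangle>\<close>,
    divided by the Kraus weight.\<close>
  define x where "x a b = (\<Sum>j<D. X $$ (a, j) * of_real (U b j)) / of_real (sqrt (prob c a b))" for a b
  have "X $$ (i, j) = (\<Sum>s<D * D. x (s div D) (s mod D) * (kraus c ! s) $$ (i, j))" if ij: "i < D" "j < D" for i j
  proof -
    have "(\<Sum>s<D * D. x (s div D) (s mod D) * (kraus c ! s) $$ (i, j)) =
        (\<Sum>s<D * D. x (s div D) (s mod D) *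
          (if i = s div D then of_real (sqrt (prob c i (s mod D)) * U (s mod D) j) else 0))"
      using ij by (intro sum.cong refl) (simp add: kraus_def)
    also have "\<dots> = (\<Sum>a<D. \<Sum>b<D. x a b * (if i = a then of_real (sqrt (prob c i b) * U b j) else 0))"
      by (rule sum_div_mod)
    also have "\<dots> = (\<Sum>a<D. if a = i then \<Sum>b<D. x i b * of_real (sqrt (prob c i b) * U b j) else 0)"
      by (intro sum.cong refl) auto
    also have "\<dots> = (\<Sum>b<D. x i b * of_real (sqrt (prob c i b) * U b j))"
      using ij by simp
    also have "\<dots> = (\<Sum>b<D. \<Sum>l<D. X $$ (i, l) * of_real (U b l * U b j))"
    proof (rule sum.cong[OF refl])
      fix b
      assume "b \<in> {..<D}"
      then have "prob c i b \<noteq> 0" using pos[OF ij(1), of b] by auto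
      then have "x i b * of_real (sqrt (prob c i b) * U b j) =
          (\<Sum>l<D. X $$ (i, l) * of_real (U b l)) * of_real (U b j)"
        by (simp add: x_def)
      then show "x i b * of_real (sqrt (prob c i b) * U b j) = (\<Sum>l<D. X $$ (i, l) * of_real (U b l * U b j))"
        by (simp add: sum_distrib_right mult.assoc)
    qed
    also have "\<dots> = (\<Sum>l<D. \<Sum>b<D. X $$ (i, l) * of_real (U b l * U b j))"
      by (rule sum.swap)
    also have "\<dots> = (\<Sum>l<D. X $$ (i, l) * of_real (\<Sum>b<D. U b l * U b j))"
      by (simp add: sum_distrib_left)
    also have "\<dots> = (\<Sum>l<D. if l = j then X $$ (i, j) else 0)"
      using ij by (intro sum.cong refl) (simp add: U_cols del: of_real_sum)
    also have "\<dots> = X $$ (i, j)" using ij by simp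
    finally show ?thesis ..
  qed
  then have "X = mat D D (\<lambda>(i, j). \<Sum>s<length (kraus c). x (s div D) (s mod D) * (kraus c ! s) $$ (i, j))"
    using X by (intro eq_matI) auto
  then show ?thesis by (rule exI[of _ "\<lambda>s. x (s div D) (s mod D)"])
qed

section \<open>The two examples\<close>

lemma continuum_families_subset_coarse: "continuum_families D \<subseteq> coarse_continuum_families D"
proof
  fix F
  assume F: "F \<in> continuum_families D"
  then obtain B where B: "B \<in> tensors D" "F = mps D B"
    by (auto simp: continuum_families_def)
  then have "is_refinement 1 F F"
    using is_refinement_refl[of B D] by (simp add: tensors_def)
  then show "F \<in> coarse_continuum_families D"
    using F B unfolding coarse_continuum_families_def mps_families_def by blast
qed

text \<open>
  Here \<open>c < 0\<close>, while the two-site blocking has the eigenvalue \<open>c\<^sup>2 > 0\<close>. The idempotent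
  \<open>chan 1\<close> is completely positive: its transition probabilities \<open>1/D + g a f b\<close> are those of the
  partition \<open>{0}, {1, \<dots>, D - 1}\<close>.
\<close>

lemma coarse_not_continuum:
  assumes D: "D \<ge> 2"
  shows "\<exists>F \<in> coarse_continuum_families D. F \<notin> continuum_families D"
proof -
  \<comment> \<open>\<open>f\<close> is the indicator of 0 minus its mean, and \<open>g\<close> is
    its multiple with tr(F G) = 1. With \<open>U\<close> the identity the channel acts as a
    classical Markov chain; \<open>prob 1\<close> is 1 at (0, 0), 1 / (D - 1) at two nonzero
    indices, and 0 elsewhere.\<close>
  define f where "f b = (if b = 0 then (real D - 1) / real D else - 1 / real D)" for b :: nat
  define g where "g a = (if a = 0 then 1 else - 1 / (real D - 1))" for a :: nat
  define U where "U b j = (if b = j then 1 else 0 :: real)" for b j :: nat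
  \<comment> \<open>Since \<open>g a * f b\<close> is at most 1, this negative value keeps every
    probability at least 1 / (2 D).\<close>
  define c where "c = - 1 / (2 * real D)"
  have sum_split: "(\<Sum>b<D. h b) = h 0 + (\<Sum>b\<in>{1..<D}. h b)" for h :: "nat \<Rightarrow> real"
    using D by (simp add: lessThan_atLeast0 sum.atLeast_Suc_lessThan)
  interpret rank_two_channel D f g U
  proof
    show "D \<ge> 1" using D by simp
    show "(\<Sum>j<D. (U b j)\<^sup>2) = 1" if "b < D" for b
    proof -
      have "(\<Sum>j<D. (U b j)\<^sup>2) = (\<Sum>j<D. if j = b then 1 else 0)"
        by (intro sum.cong) (auto simp: U_def)
      then show ?thesis using that by simp
    qed
    show "(\<Sum>b<D. U b j * U b j') = (if j = j' then 1 else 0)" if "j < D" "j' < D" for j j'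
    proof -
      have "(\<Sum>b<D. U b j * U b j') = (\<Sum>b<D. if b = j then if j = j' then 1 else 0 else 0)"
        by (intro sum.cong) (auto simp: U_def)
      then show ?thesis using that by simp
    qed
    have "(\<Sum>b\<in>{1..<D}. f b) = (\<Sum>b\<in>{1..<D}. - 1 / real D)"
      by (intro sum.cong) (auto simp: f_def)
    also have "\<dots> = (1 - real D) / real D"
      using D by (simp add: of_nat_diff field_simps)
    finally have f_tail: "(\<Sum>b\<in>{1..<D}. f b) = (1 - real D) / real D" .
    have "(\<Sum>b<D. f b) = f 0 + (1 - real D) / real D"
      unfolding f_tail[symmetric] by (rule sum_split)
    also have "\<dots> = (real D - 1) / real D + (1 - real D) / real D"
      by (simp add: f_def)
    also have "\<dots> = 0"
      by (simp only: add_divide_distrib[symmetric]) simp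
    finally show "(\<Sum>b<D. f b) = 0" .
    have "(\<Sum>b\<in>{1..<D}. g b) = (\<Sum>b\<in>{1..<D}. - 1 / (real D - 1))"
      by (intro sum.cong) (auto simp: g_def)
    also have "\<dots> = - 1"
      using D by (simp add: of_nat_diff)
    finally have g_tail: "(\<Sum>b\<in>{1..<D}. g b) = - 1" .
    have "(\<Sum>b<D. g b) = g 0 + - 1"
      unfolding g_tail[symmetric] by (rule sum_split)
    then show "(\<Sum>b<D. g b) = 0"
      by (simp add: g_def)
    have "(\<Sum>b<D. f b * (\<Sum>j<D. (U b j)\<^sup>2 * g j)) = (\<Sum>b<D. f b * g b)"
    proof (rule sum.cong[OF refl])
      fix b
      assume "b \<in> {..<D}"
      moreover have "(\<Sum>j<D. (U b j)\<^sup>2 * g j) = (\<Sum>j<D. if j = b then g b else 0)"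
        by (intro sum.cong) (auto simp: U_def)
      ultimately show "f b * (\<Sum>j<D. (U b j)\<^sup>2 * g j) = f b * g b" by simp
    qed
    also have "\<dots> = (real D - 1) / real D + (\<Sum>b\<in>{1..<D}. 1 / (real D * (real D - 1)))"
      by (subst sum_split, intro arg_cong2[where f = "(+)"] sum.cong) (auto simp: f_def g_def)
    also have "\<dots> = 1"
      using D by (simp add: of_nat_diff field_simps)
    finally show "(\<Sum>b<D. f b * (\<Sum>j<D. (U b j)\<^sup>2 * g j)) = 1" .
  qed
  have D': "real D \<ge> 2" using assms by simp
  have fg_bounds: "- 1 / real D \<le> g a * f b" "g a * f b \<le> 1" for a b
  proof -
    consider "a = 0" "b = 0" | "a = 0" "b \<noteq> 0" | "a \<noteq> 0" "b = 0" | "a \<noteq> 0" "b \<noteq> 0" by blast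
    then have "g a * f b \<in> {(real D - 1) / real D, - 1 / real D, 1 / ((real D - 1) * real D)}"
      by cases (use D' in \<open>auto simp: f_def g_def\<close>)
    moreover have "- 1 / real D \<le> 0" using D' by simp
    moreover have "(real D - 1) / real D \<ge> 0" "(real D - 1) / real D \<le> 1"
      using D' by simp_all
    moreover have "1 * 1 \<le> (real D - 1) * real D"
      using D' by (intro mult_mono) auto
    then have "1 / ((real D - 1) * real D) \<ge> 0" "1 / ((real D - 1) * real D) \<le> 1"
      by simp_all
    ultimately show "- 1 / real D \<le> g a * f b" "g a * f b \<le> 1"
      by (elim insertE emptyE; linarith)+
  qed
  have prob_nonneg: "prob t a b \<ge> 0" if "0 \<le> t" "t \<le> 1" for t a b
  proof -
    have "t * (- 1 / real D) \<le> t * (g a * f b)"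
      using fg_bounds that by (intro mult_left_mono)
    moreover have "t * (1 / real D) \<le> 1 * (1 / real D)"
      using that D' by (intro mult_right_mono) auto
    ultimately show ?thesis by (simp add: prob_def mult.assoc)
  qed
  have prob_pos: "prob c a b > 0" for a b
  proof -
    have "1 / (2 * real D) * (g a * f b) \<le> 1 / (2 * real D) * 1"
      using fg_bounds(2)[of a b] D' by (intro mult_left_mono) auto
    moreover have "1 / (2 * real D) < 1 / real D" using D' by (simp add: divide_simps)
    ultimately show ?thesis by (simp add: prob_def c_def mult.assoc)
  qed
  have c: "c \<noteq> 0" "\<bar>c\<bar> < 1" "c < 0" using D' by (auto simp: c_def divide_simps)
  define A where "A = kraus c"
  have A: "set A \<subseteq> carrier_mat D D" by (simp add: A_def kraus_carrier)
  have TA: "transfer D A X = chan c X" if "X \<in> carrier_mat D D" for X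
    unfolding A_def using transfer_kraus[OF that] prob_pos less_imp_le by blast
  have A_tensor: "A \<in> tensors D"
    using tensors_transfer_chan[OF A TA] prob_pos c by blast
  define B where "B = map (\<lambda>k. word_mat D A [k div length A, k mod length A]) [0..<length A * length A]"
  have code: "bij_betw (\<lambda>k. [k div length A, k mod length A]) {..<length B} (spin_words (length A) 2)"
    using bij_betw_pair_words by (simp add: B_def)
  have B_nth: "B ! j = word_mat D A [j div length A, j mod length A]" if "j < length B" for j
    using that by (simp add: B_def del: word_mat_simps)
  have B: "set B \<subseteq> carrier_mat D D"
  proof
    fix M
    assume "M \<in> set B"
    then obtain j where j: "j < length B" "M = B ! j" by (auto simp: in_set_conv_nth)
    then have "[j div length A, j mod length A] \<in> spin_words (length A) 2"
      using bij_betwE[OF code] by blast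
    then show "M \<in> carrier_mat D D"
      unfolding j(2) B_nth[OF j(1)] by (rule word_mat_carrier[OF A])
  qed
  have TB: "transfer D B X = chan (c\<^sup>2) X" if X: "X \<in> carrier_mat D D" for X
    by (rule trans[OF transfer_coding[OF A code B_nth X]], assumption, rule transfer_pow_chan[OF A TA _ X]) simp_all
  have c2: "0 < c\<^sup>2" "c\<^sup>2 < 1"
    using c by (simp_all add: abs_square_less_1)
  have "prob (c\<^sup>2) a b > 0" if "a < D" "b < D" for a b
  proof -
    have "c\<^sup>2 * (- 1 / real D) \<le> c\<^sup>2 * (g a * f b)"
      using fg_bounds c2 by (intro mult_left_mono) auto
    moreover have "c\<^sup>2 * (1 / real D) < 1 * (1 / real D)"
      using c2 D' by (intro mult_strict_right_mono) auto
    ultimately show ?thesis by (simp add: prob_def mult.assoc)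
  qed
  then have "B \<in> tensors D"
    using c2 by (intro tensors_transfer_chan[OF B TB]) auto
  moreover have "channel_continuum_limit D (transfer D B)"
    using prob_nonneg c2 by (intro channel_continuum_limit_chan[of "c\<^sup>2"] TB) auto
  ultimately have "mps D B \<in> continuum_families D"
    by (auto simp: continuum_families_def)
  moreover have "is_refinement 2 (mps D A) (mps D B)"
    by (rule is_refinement_coding[OF A _ code B_nth]) simp_all
  ultimately have "mps D A \<in> coarse_continuum_families D"
    using A_tensor unfolding coarse_continuum_families_def mps_families_def
    by (intro CollectI conjI exI[of _ 2] exI[of _ D]) auto
  moreover have "mps D A \<notin> continuum_families D"
  proof
    assume "mps D A \<in> continuum_families D"
    then obtain B' where B': "B' \<in> tensors D" "mps D A = mps D B'" "channel_continuum_limit D (transfer D B')"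
      by (auto simp: continuum_families_def)
    then have "set B' \<subseteq> carrier_mat D D" by (simp add: tensors_def)
    \<comment> \<open>The family may have its continuum limit through another tensor B' with a
      different transfer map. Reading the equality of families as a refinement with n = 1 transfers
      the sign condition from B' to A.\<close>
    moreover have "is_refinement 1 (mps D A) (mps D B')"
      using is_refinement_refl[OF A] B'(2) by simp
    ultimately have "c ^ 1 > 0"
      by (intro coarse_continuum_limit_bounds(1)[OF A _ _ _ B'(3) trace_transfer_pow_chan[OF A TA] c(1,2)]) auto
    then show False using c by simp
  qed
  ultimately show ?thesis by blast
qed

text \<open>
  Here \<open>c > 0\<close>, but the idempotent \<open>chan 1\<close> is not even positive: it maps the projection onto
  \<open>\<phi>\<^sub>1\<close> to a matrix with the negative diagonal entry \<open>1/D - g 0\<close>.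
\<close>

lemma not_coarse_continuum:
  assumes D: "D \<ge> 2"
  shows "\<exists>F \<in> mps_families D. F \<notin> coarse_continuum_families D"
proof -
  define f where "f b = (if b = 0 then 1 else if b = 1 then - 1 else 0 :: real)" for b :: nat
  \<comment> \<open>The value is forced by tr(F G) = 1: the squared entries 16/25 and 9/25 of
    \<open>U\<close> differ by 7/25, and this difference counts once for each of the two nonzero
    eigenvalues of F.\<close>
  define g where "g a = (if a = 0 then 25 / 14 else if a = 1 then - 25 / 14 else 0 :: real)" for a :: nat
  \<comment> \<open>A reflection with rational entries, from the triple 3, 4, 5. Some rotation is
    unavoidable for D = 2: if F and G are both diagonal there, the values of \<open>prob 1\<close>
    are 0 and 1, and the idempotent is completely positive.\<close>
  define U where "U b j = (if b = 0 \<and> j = 0 then 4 / 5 else if b = 0 \<and> j = 1 then 3 / 5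
    else if b = 1 \<and> j = 0 then 3 / 5 else if b = 1 \<and> j = 1 then - 4 / 5
    else if b = j then 1 else 0 :: real)" for b j :: nat
  \<comment> \<open>Small enough for positivity: the worst product -25/14 leaves the probability 3 /
    (28 D).\<close>
  define c where "c = 1 / (2 * real D)"
  have sum2: "(\<Sum>b<D. h b) = h 0 + h 1" if "\<And>b. 2 \<le> b \<Longrightarrow> h b = 0" for h :: "nat \<Rightarrow> real"
  proof -
    have "(\<Sum>b<D. h b) = (\<Sum>b<2. h b)"
      using D that by (intro sum.mono_neutral_right) auto
    then show ?thesis by (simp add: numeral_2_eq_2)
  qed
  have U_sym: "U b j = U j b" for b j by (auto simp: U_def)
  have U_orth: "(\<Sum>b<D. U b j * U b j') = (if j = j' then 1 else 0)" if "j < D" "j' < D" for j j'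
  proof (cases "j < 2")
    case True
    then have "(\<Sum>b<D. U b j * U b j') = U 0 j * U 0 j' + U 1 j * U 1 j'"
      by (intro sum2) (auto simp: U_def)
    moreover consider "j = 0" | "j = 1" using True by linarith
    ultimately show ?thesis by cases (auto simp: U_def)
  next
    case False
    then have "(\<Sum>b<D. U b j * U b j') = (\<Sum>b<D. if b = j then if j = j' then 1 else 0 else 0)"
      by (intro sum.cong) (auto simp: U_def)
    then show ?thesis using that by simp
  qed
  interpret rank_two_channel D f g U
  proof
    show "D \<ge> 1" using D by simp
    show "(\<Sum>j<D. (U b j)\<^sup>2) = 1" if "b < D" for b
      using U_orth[OF that that] by (simp add: power2_eq_square U_sym[of b])
    show "(\<Sum>b<D. U b j * U b j') = (if j = j' then 1 else 0)" if "j < D" "j' < D" for j j'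
      by (rule U_orth[OF that])
    show "(\<Sum>b<D. f b) = 0" by (subst sum2) (auto simp: f_def)
    show "(\<Sum>a<D. g a) = 0" by (subst sum2) (auto simp: g_def)
    have inner: "(\<Sum>j<D. (U b j)\<^sup>2 * g j) = (U b 0)\<^sup>2 * g 0 + (U b 1)\<^sup>2 * g 1" for b
      by (rule sum2) (auto simp: g_def)
    show "(\<Sum>b<D. f b * (\<Sum>j<D. (U b j)\<^sup>2 * g j)) = 1"
      unfolding inner by (subst sum2) (auto simp: f_def g_def U_def power2_eq_square)
  qed
  have D': "real D \<ge> 2" using assms by simp
  have prob_pos: "prob c a b > 0" for a b
  proof -
    have "g a * f b \<ge> - 25 / 14" by (auto simp: f_def g_def)
    then have "c * (g a * f b) \<ge> c * (- 25 / 14)"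
      using D' by (intro mult_left_mono) (auto simp: c_def)
    moreover have "1 / real D + c * (- 25 / 14) > 0"
      using D' by (simp add: c_def field_simps)
    ultimately show ?thesis by (simp add: prob_def mult.assoc)
  qed
  have c: "c \<noteq> 0" "\<bar>c\<bar> < 1" "c > 0" using D' by (auto simp: c_def divide_simps)
  define A where "A = kraus c"
  have A: "set A \<subseteq> carrier_mat D D" by (simp add: A_def kraus_carrier)
  have TA: "transfer D A X = chan c X" if "X \<in> carrier_mat D D" for X
    unfolding A_def using transfer_kraus[OF that] prob_pos less_imp_le by blast
  have A_tensor: "A \<in> tensors D"
    using tensors_transfer_chan[OF A TA] prob_pos c by blast
  \<comment> \<open>Only column 0 is nonzero and equals \<open>\<phi>\<^sub>1\<close>, so the form
    of \<open>chan e\<close> at Y is the single number \<open>prob e 0 1\<close>, which is negative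
    at e = 1.\<close>
  define Y where "Y = mat D D (\<lambda>(i, j). if j = 0 then complex_of_real (U 1 i) else 0)"
  have form: "choi_form D Y (chan e) = of_real (1 / real D - e * (25 / 14))" for e
  proof -
    have U1: "(\<Sum>i<D. complex_of_real (U b i) * of_real (U 1 i)) = of_real (if b = 1 then 1 else 0)" if "b < D" for b
    proof -
      have "(\<Sum>i<D. U b i * U 1 i) = (\<Sum>i<D. U i b * U i 1)"
        by (intro sum.cong refl arg_cong2[where f = "(*)"] U_sym)
      also have "\<dots> = (if b = 1 then 1 else 0)"
        using assms by (intro U_orth that) simp
      finally show ?thesis by (simp only: of_real_mult[symmetric] of_real_sum[symmetric])
    qed
    have "choi_form D Y (chan e) = (\<Sum>a<D. if a = 0 then
        (\<Sum>i<D. of_real (U 1 i) * of_real (U 1 i)) / of_nat D + of_real (e * g 0) *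
        (\<Sum>b<D. of_real (f b) * (\<Sum>i<D. of_real (U b i) * of_real (U 1 i)) *
          cnj (\<Sum>i<D. of_real (U b i) * of_real (U 1 i))) else 0)"
      unfolding choi_form_chan by (intro sum.cong refl) (simp add: Y_def)
    also have "\<dots> = (\<Sum>i<D. of_real (U 1 i) * of_real (U 1 i)) / of_nat D + of_real (e * g 0) *
        (\<Sum>b<D. of_real (f b) * (\<Sum>i<D. of_real (U b i) * of_real (U 1 i)) *
          cnj (\<Sum>i<D. of_real (U b i) * of_real (U 1 i)))"
      using D by simp
    also have "(\<Sum>b<D. of_real (f b) * (\<Sum>i<D. of_real (U b i) * of_real (U 1 i)) *
          cnj (\<Sum>i<D. of_real (U b i) * of_real (U 1 i))) = (\<Sum>b<D. if b = 1 then - 1 else 0 :: complex)"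
    proof (rule sum.cong[OF refl])
      fix b
      assume "b \<in> {..<D}"
      then have b: "b < D" by simp
      show "of_real (f b) * (\<Sum>i<D. of_real (U b i) * of_real (U 1 i)) *
          cnj (\<Sum>i<D. of_real (U b i) * of_real (U 1 i)) = (if b = 1 then - 1 else 0)"
        unfolding U1[OF b] by (simp add: f_def)
    qed
    also have "\<dots> = - 1" using assms by simp
    also have "(\<Sum>i<D. complex_of_real (U 1 i) * of_real (U 1 i)) = 1"
      using U1[of 1] assms by simp
    also have "g 0 = 25 / 14" by (simp add: g_def)
    finally show ?thesis by simp
  qed
  have "mps D A \<notin> coarse_continuum_families D"
  proof
    assume "mps D A \<in> coarse_continuum_families D"
    then obtain n D' B where n: "n \<ge> 1" and B: "B \<in> tensors D'" "channel_continuum_limit D' (transfer D' B)"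
      and ref: "is_refinement n (mps D A) (mps D' B)"
      unfolding coarse_continuum_families_def continuum_families_def by blast
    have B_carrier: "set B \<subseteq> carrier_mat D' D'" using B by (simp add: tensors_def)
    \<comment> \<open>The number n of refined sites is arbitrary, so Y has to be reachable by words
      of every positive length.\<close>
    have "\<exists>y. word_comb D A n y = Y"
    proof (rule word_comb_surj[OF A n])
      show "\<exists>y. X = mat D D (\<lambda>(i, j). \<Sum>s<length A. y s * (A ! s) $$ (i, j))" if "X \<in> carrier_mat D D" for X
        unfolding A_def using kraus_span[OF prob_pos that] .
    qed (simp add: Y_def)
    then obtain y where y: "word_comb D A n y = Y" by blast
    have E_form: "choi_form D Y (transfer D A ^^ m) = of_real (1 / real D - c ^ m * (25 / 14))" if "m \<ge> 1" for m
      using choi_form_cong[OF transfer_pow_chan[OF A TA that]] form by simp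
    define x where "x = 1 / real D"
    define e where "e = c ^ n"
    have e: "e > 0" using c by (simp add: e_def)
    \<comment> \<open>The two sides differ by e (x - 25/14), that is, by e times
      \<open>prob 1 0 1\<close>.\<close>
    have "(1 + e) * (x - e * (25 / 14)) \<ge> x - e ^ 2 * (25 / 14)"
      using coarse_continuum_limit_bounds(2)[OF A B_carrier n ref B(2) trace_transfer_pow_chan[OF A TA] c(1,2), of y]
        E_form[of n] E_form[of "n * 2"] n
      by (simp add: y e_def x_def power_mult)
    then have "e * (x - 25 / 14) \<ge> 0"
      by (simp add: algebra_simps power2_eq_square)
    then have "x \<ge> 25 / 14"
      using e by (simp add: zero_le_mult_iff)
    moreover have "x \<le> 1 / 2"
      using D' by (simp add: x_def divide_simps)
    ultimately show False by simp
  qed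
  then show ?thesis
    using A_tensor by (auto simp: mps_families_def)
qed

theorem proposition15:
  fixes D :: nat
  assumes "D \<ge> 2"
  shows "continuum_families D \<subset> coarse_continuum_families D \<and>
         (\<exists>F \<in> mps_families D. F \<notin> coarse_continuum_families D)"
proof (intro conjI psubsetI)
  show "continuum_families D \<subseteq> coarse_continuum_families D"
    by (rule continuum_families_subset_coarse)
  show "continuum_families D \<noteq> coarse_continuum_families D"
    using coarse_not_continuum[OF assms] by metis
  show "\<exists>F \<in> mps_families D. F \<notin> coarse_continuum_families D"
    by (rule not_coarse_continuum[OF assms])
qed

end
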